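(* Let $\mu$ and $\widetilde\mu$ be non-negative measures on $\mathbb R$ of at most polynomial growth which are weakly equivalent. Then $T(\mu)=T(\widetilde\mu)$.
   Context: Measures are Borel measures. A non-negative measure $\mu$ on $\mathbb R$ has at most polynomial growth if $\int_{\mathbb R}\frac{d\mu(\lambda)}{1+|\lambda|^{2s}}<\infty$ for some $s<\infty$. For $a>0$, $\mathcal E(a)$ is the linear space of Fourier transforms $\widehat f(\lambda)=\int_{\mathbb R} f(x)e^{-i\lambda x}\,dx$ of complex-valued $C^\infty$ functions $f$ compactly supported in $(-a,a)$, regarded as elements of $L^2(\mu)$ by restriction to $\mathbb R$. The type of a measure $\mu$ of at most polynomial growth is $T(\mu)=\inf\{a>0:\mathcal E(a)\text{ is dense in }L^2(\mu)\}\in[0,\infty]$, with $\inf\emptyset=\infty$. For $\delta>0$ and $x\in\mathbb R$ let $I_{x,\delta}=[x-e^{-\delta|x|},x+e^{-\delta|x|}]$, and let $2I_{x,\delta}=[x-2e^{-\delta|x|},x+2e^{-\delta|x|}]$. One writes $\mu\preccurlyeq\widetilde\mu$ if there exist constants $\delta>0$, $C>0$ and $n\ge 0$ such that for all $x\in\mathbb R$, $\mu(I_{x,\delta})\le C(1+|x|)^n\left(\widetilde\mu(2I_{x,\delta})+e^{-2\delta|x|}\right)$. The measures $\mu$ and $\widetilde\mu$ are weakly equivalent if $\mu\preccurlyeq\widetilde\mu$ and $\widetilde\mu\preccurlyeq\mu$. *)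

theory Defs
  imports "HOL-Analysis.Analysis"
begin

(* The bound s \<ge> 0 is implicit in the usual notion: a negative exponent would make the integrand
   tend to 0 at the origin and so permit infinite mass near 0.  Since 0 powr 0 = 0, for s = 0 the
   integrand is 1 rather than 1/2 at the origin, which does not affect finiteness. *)
definition polynomial_growth :: "real measure \<Rightarrow> bool" where
  "polynomial_growth \<mu> \<longleftrightarrow>
     (\<exists>s::real. 0 \<le> s \<and> (\<integral>\<^sup>+ t. ennreal (1 / (1 + \<bar>t\<bar> powr (2 * s))) \<partial>\<mu>) < \<infinity>)"

definition fourier_transform :: "(real \<Rightarrow> complex) \<Rightarrow> real \<Rightarrow> complex" where
  "fourier_transform f t = (\<integral>x. f x * exp (- \<i> * complex_of_real (t * x)) \<partial>lborel)"

definition smooth :: "(real \<Rightarrow> complex) \<Rightarrow> bool" where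
  "smooth f \<longleftrightarrow> (\<forall>k x. ((\<lambda>g t. vector_derivative g (at t)) ^^ k) f differentiable (at x))"

(* Compactness of the support is automatic: a closed subset of a bounded interval. *)
definition test_functions :: "real \<Rightarrow> (real \<Rightarrow> complex) set" where
  "test_functions a = {f. smooth f \<and> closure (support_on UNIV f) \<subseteq> {-a<..<a}}"

definition fourier_space :: "real \<Rightarrow> (real \<Rightarrow> complex) set" where
  "fourier_space a = fourier_transform ` test_functions a"

(* Functions rather than classes modulo null sets; density does not see the difference. *)
definition L2_functions :: "real measure \<Rightarrow> (real \<Rightarrow> complex) set" where
  "L2_functions \<mu> = {g \<in> borel_measurable \<mu>. (\<integral>\<^sup>+ t. ennreal ((cmod (g t))\<^sup>2) \<partial>\<mu>) < \<infinity>}"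

(* The distance is an extended-valued integral, so the bound also forces h, when measurable, to be
   square integrable. *)
definition dense_in_L2 :: "(real \<Rightarrow> complex) set \<Rightarrow> real measure \<Rightarrow> bool" where
  "dense_in_L2 V \<mu> \<longleftrightarrow>
     (\<forall>g \<in> L2_functions \<mu>. \<forall>\<epsilon>::real. 0 < \<epsilon> \<longrightarrow>
        (\<exists>h \<in> V. (\<integral>\<^sup>+ t. ennreal ((cmod (g t - h t))\<^sup>2) \<partial>\<mu>) < ennreal (\<epsilon>\<^sup>2)))"

definition measure_type :: "real measure \<Rightarrow> ennreal" where
  "measure_type \<mu> = Inf {ennreal a | a. 0 < a \<and> dense_in_L2 (fourier_space a) \<mu>}"

(* scaled_interval r x \<delta> is the interval r I_{x,\<delta>}. *)
definition scaled_interval :: "real \<Rightarrow> real \<Rightarrow> real \<Rightarrow> real set" where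
  "scaled_interval r x \<delta> = {x - r * exp (- \<delta> * \<bar>x\<bar>) .. x + r * exp (- \<delta> * \<bar>x\<bar>)}"

definition weakly_dominated :: "real measure \<Rightarrow> real measure \<Rightarrow> bool" (infix "\<preceq>\<^sub>w" 50) where
  "\<mu> \<preceq>\<^sub>w \<nu> \<longleftrightarrow>
     (\<exists>\<delta> C n::real. 0 < \<delta> \<and> 0 < C \<and> 0 \<le> n \<and>
        (\<forall>x. emeasure \<mu> (scaled_interval 1 x \<delta>)
             \<le> ennreal (C * (1 + \<bar>x\<bar>) powr n)
                * (emeasure \<nu> (scaled_interval 2 x \<delta>) + ennreal (exp (- 2 * \<delta> * \<bar>x\<bar>)))))"

definition weakly_equivalent :: "real measure \<Rightarrow> real measure \<Rightarrow> bool" where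
  "weakly_equivalent \<mu> \<nu> \<longleftrightarrow> \<mu> \<preceq>\<^sub>w \<nu> \<and> \<nu> \<preceq>\<^sub>w \<mu>"

end

theory Submission
  imports Defs "HOL-Complex_Analysis.Complex_Analysis"
begin

text \<open>
  Weak equivalence is symmetric, so it suffices that \<open>\<mu> \<preceq>\<^sub>w \<nu>\<close> implies \<open>T(\<mu>) \<le> T(\<nu>)\<close>: if \<open>\<E>(a)\<close> is dense in
  \<open>L\<^sup>2(\<nu>)\<close> and \<open>a\<^sub>1 > a\<close>, then \<open>\<E>(a\<^sub>1)\<close> is dense in \<open>L\<^sup>2(\<mu>)\<close> (\<open>density_transfer\<close>).

  Suppose that \<open>\<E>(a\<^sub>1)\<close> is not dense in \<open>L\<^sup>2(\<mu>)\<close>, and let \<open>L\<close> be a bounded functional on \<open>L\<^sup>2(\<mu>)\<close> that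
  vanishes on it. For \<open>F\<close> and \<open>h\<close> in the space of entire extensions, \<open>(F(z) h - h(z) F) / (x - z)\<close> lies in
  that space again, and applying \<open>L\<close> gives \<open>F(z) \<Phi>\<^sub>h(z) = h(z) \<Phi>\<^sub>F(z)\<close> with the Cauchy transforms
  \<open>\<Phi>\<^sub>F(z) = L(F / (x - z))\<close>. As \<open>\<bar>\<Phi>\<^sub>F(z)\<bar> \<le> C \<parallel>F\<parallel> / \<bar>Im z\<bar>\<close>, every \<open>F\<close> of norm one is, in a half-plane, a
  quotient of controlled analytic functions with one and the same denominator. After division by the
  largest admissible exponential \<open>exp (i c z)\<close>, the denominator is bounded and, for every \<open>\<eta> > 0\<close>, at some
  point \<open>z\<^sub>0\<close> not smaller than \<open>exp (- \<eta> Im z\<^sub>0)\<close>; Harnack's inequality spreads this lower bound over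
  the half-plane (\<open>growth_off_axis\<close>). Multiplication by a barrier on a rhombus with two vertices on the
  real axis carries the bound across the axis (\<open>rhombus_bound\<close>). The outcome is
  \<open>\<bar>F(x)\<bar> + \<bar>F'(x)\<bar> \<le> C\<^sub>\<epsilon> exp (\<epsilon> \<bar>x\<bar>) \<parallel>F\<parallel>\<close> on the real line, for every \<open>\<epsilon> > 0\<close>.

  Hence the oscillation of \<open>F\<close> over \<open>I\<^bsub>x,\<delta>\<^esub>\<close> is exponentially small, and weak domination bounds the part
  of \<open>\<parallel>F\<parallel>\<^sup>2\<close> outside a large interval by a weighted \<open>L\<^sup>2(\<nu>)\<close>-norm of \<open>F\<close> plus a small multiple of \<open>\<parallel>F\<parallel>\<^sup>2\<close>
  (\<open>sampling_tail\<close>). The part inside the interval is small, by the maximum principle, once \<open>F\<close> has a zero of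
  high order at the origin. So evaluation at \<open>\<i>\<close> is bounded by a polynomially weighted \<open>L\<^sup>2(\<nu>)\<close>-norm
  (\<open>point_evaluation_bound\<close>). If \<open>\<E>(a)\<close> were dense in \<open>L\<^sup>2(\<nu>)\<close>, this would fail: for a rapidly decreasing
  \<open>h\<close> of small exponential type with \<open>h(\<i>) \<noteq> 0\<close>, approximate \<open>h / (x - \<i>)\<close> by \<open>H \<in> \<E>(a)\<close>; then
  \<open>(z - \<i>) h H - h\<^sup>2\<close> has small weighted norm, but its value at \<open>\<i>\<close> is \<open>- h(\<i>)\<^sup>2\<close>.
\<close>

section \<open>Smooth functions\<close>

abbreviation vderiv :: "(real \<Rightarrow> complex) \<Rightarrow> real \<Rightarrow> complex" where
  "vderiv f \<equiv> (\<lambda>t. vector_derivative f (at t))"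

text \<open>Smoothness concerns all iterated derivatives, so it is enough to exhibit a class of functions that
  contains \<open>f\<close> and is closed under differentiation.\<close>

lemma smooth_coinduct:
  assumes "P f" and step: "\<And>g. P g \<Longrightarrow> \<exists>g'. (\<forall>x. (g has_vector_derivative g' x) (at x)) \<and> P g'"
  shows "smooth f"
proof -
  have *: "P g \<Longrightarrow> P (vderiv g) \<and> (\<forall>x. g differentiable at x)" for g
  proof -
    assume "P g"
    then obtain g' where g': "\<And>x. (g has_vector_derivative g' x) (at x)" "P g'" using step by blast
    then have "vderiv g = g'" by (auto simp: vector_derivative_at)
    then show ?thesis using g' by (auto intro: differentiableI_vector)
  qed
  have "P (((\<lambda>g t. vector_derivative g (at t)) ^^ k) f)" for k
    by (induction k) (use assms(1) * in auto)
  then show ?thesis unfolding smooth_def using * by blast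
qed

lemma smooth_vector_derivative:
  assumes "smooth f"
  shows "(f has_vector_derivative vderiv f x) (at x)"
proof -
  have "f differentiable (at x)" using assms unfolding smooth_def by (metis funpow_0)
  then show ?thesis using vector_derivative_works by blast
qed

lemma smooth_vderiv: "smooth f \<Longrightarrow> smooth (vderiv f)"
  unfolding smooth_def by (metis funpow_Suc_right comp_apply)

lemma smooth_continuous_on: "smooth f \<Longrightarrow> continuous_on S f"
  by (meson continuous_at_imp_continuous_on has_vector_derivative_continuous smooth_vector_derivative)

lemma smooth_linear_combination:
  assumes "smooth f" "smooth g"
  shows "smooth (\<lambda>x. c * f x + d * g x)"
proof (rule smooth_coinduct[where P = "\<lambda>h. \<exists>f g. smooth f \<and> smooth g \<and> h = (\<lambda>x. c * f x + d * g x)"])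
  fix h assume "\<exists>f g. smooth f \<and> smooth g \<and> h = (\<lambda>x. c * f x + d * g x)"
  then obtain f g where fg: "smooth f" "smooth g" "h = (\<lambda>x. c * f x + d * g x)" by blast
  have "(h has_vector_derivative (c * vderiv f x + d * vderiv g x)) (at x)" for x
    unfolding fg(3) by (intro has_vector_derivative_add has_vector_derivative_mult_right smooth_vector_derivative fg)
  then show "\<exists>g'. (\<forall>x. (h has_vector_derivative g' x) (at x)) \<and>
      (\<exists>f g. smooth f \<and> smooth g \<and> g' = (\<lambda>x. c * f x + d * g x))"
    by (intro exI[of _ "\<lambda>x. c * vderiv f x + d * vderiv g x"] conjI allI exI[of _ "vderiv f"] exI[of _ "vderiv g"]
        smooth_vderiv fg refl)
qed (intro exI[of _ f] exI[of _ g] conjI assms refl)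

lemma smooth_cmult: "smooth f \<Longrightarrow> smooth (\<lambda>x. c * f x)"
  using smooth_linear_combination[of f f c 0] by simp

text \<open>The Leibniz rule leads from a product to a sum of products; this is the smallest class containing the
  products and closed under differentiation.\<close>

inductive smooth_products :: "(real \<Rightarrow> complex) \<Rightarrow> bool" where
  mult: "smooth f \<Longrightarrow> smooth g \<Longrightarrow> smooth_products (\<lambda>x. f x * g x)"
| add: "smooth_products u \<Longrightarrow> smooth_products v \<Longrightarrow> smooth_products (\<lambda>x. u x + v x)"

lemma smooth_mult:
  assumes "smooth f" "smooth g"
  shows "smooth (\<lambda>x. f x * g x)"
proof (rule smooth_coinduct[where P = smooth_products])
  fix h assume "smooth_products h"
  then show "\<exists>h'. (\<forall>x. (h has_vector_derivative h' x) (at x)) \<and> smooth_products h'"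
  proof induction
    case (mult f g)
    have "((\<lambda>x. f x * g x) has_vector_derivative (f x * vderiv g x + vderiv f x * g x)) (at x)" for x
      by (intro has_vector_derivative_mult smooth_vector_derivative mult)
    moreover have "smooth_products (\<lambda>x. f x * vderiv g x + vderiv f x * g x)"
      by (intro smooth_products.intros smooth_vderiv mult)
    ultimately show ?case by (intro exI[of _ "\<lambda>x. f x * vderiv g x + vderiv f x * g x"] conjI allI)
  next
    case (add u v)
    then obtain u' v' where *: "\<forall>x. (u has_vector_derivative u' x) (at x)" "smooth_products u'"
       "\<forall>x. (v has_vector_derivative v' x) (at x)" "smooth_products v'" by blast
    then have "\<forall>x. ((\<lambda>x. u x + v x) has_vector_derivative (u' x + v' x)) (at x)"
      by (auto intro!: has_vector_derivative_add)
    moreover have "smooth_products (\<lambda>x. u' x + v' x)" using * by (intro smooth_products.add)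
    ultimately show ?case by (intro exI[of _ "\<lambda>x. u' x + v' x"] conjI)
  qed
qed (intro smooth_products.mult assms)

lemma smooth_affine:
  assumes "smooth f"
  shows "smooth (\<lambda>x. f (c + d * x))"
proof (rule smooth_coinduct[where P = "\<lambda>h. \<exists>f k. smooth f \<and> h = (\<lambda>x. of_real k * f (c + d * x))"])
  fix h assume "\<exists>f k. smooth f \<and> h = (\<lambda>x. of_real k * f (c + d * x))"
  then obtain f k where f: "smooth f" "h = (\<lambda>x. of_real k * f (c + d * x))" by blast
  have "(h has_vector_derivative (of_real (k * d) * vderiv f (c + d * x))) (at x)" for x
  proof -
    have "((f \<circ> (\<lambda>x. c + d * x)) has_vector_derivative (d *\<^sub>R vderiv f (c + d * x))) (at x)"
      by (rule vector_diff_chain_at) (auto intro!: derivative_eq_intros smooth_vector_derivative f simp: has_real_derivative_iff_has_vector_derivative[symmetric])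
    then have "((\<lambda>x. of_real k * (f \<circ> (\<lambda>x. c + d * x)) x) has_vector_derivative (of_real k * (d *\<^sub>R vderiv f (c + d * x)))) (at x)"
      by (rule has_vector_derivative_mult_right)
    then show ?thesis by (simp add: f(2) o_def scaleR_conv_of_real mult.assoc)
  qed
  then show "\<exists>g'. (\<forall>x. (h has_vector_derivative g' x) (at x)) \<and> (\<exists>f k. smooth f \<and> g' = (\<lambda>x. of_real k * f (c + d * x)))"
    by (intro exI[of _ "\<lambda>x. of_real (k * d) * vderiv f (c + d * x)"] conjI allI exI[of _ "vderiv f"] exI[of _ "k * d"]
        smooth_vderiv f refl)
next
  show "\<exists>f' k. smooth f' \<and> (\<lambda>x. f (c + d * x)) = (\<lambda>x. of_real k * f' (c + d * x))"
    by (intro exI[of _ f] exI[of _ 1] conjI assms) simp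
qed

lemma smooth_cnj_reflect:
  assumes "smooth f"
  shows "smooth (\<lambda>x. cnj (f (- x)))"
proof -
  have "smooth (\<lambda>x. cnj (f x))" 
  proof (rule smooth_coinduct[where P = "\<lambda>h. \<exists>f. smooth f \<and> h = (\<lambda>x. cnj (f x))"])
    fix h assume "\<exists>f. smooth f \<and> h = (\<lambda>x. cnj (f x))"
    then obtain f where f: "smooth f" "h = (\<lambda>x. cnj (f x))" by blast
    have "(h has_vector_derivative (cnj (vderiv f x))) (at x)" for x
      unfolding f(2) by (intro has_vector_derivative_cnj smooth_vector_derivative f)
    then show "\<exists>g'. (\<forall>x. (h has_vector_derivative g' x) (at x)) \<and> (\<exists>f. smooth f \<and> g' = (\<lambda>x. cnj (f x)))"
      by (intro exI[of _ "\<lambda>x. cnj (vderiv f x)"] conjI allI exI[of _ "vderiv f"] smooth_vderiv f refl)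
  qed (intro exI[of _ f] conjI assms refl)
  from smooth_affine[OF this, of 0 "-1"] show ?thesis by simp
qed

text \<open>Each derivative of a solution is again a multiple of \<open>k\<close> plus a smooth function. Quotients
  of Fourier transforms by linear factors arise as transforms of such solutions.\<close>

lemma smooth_ODE:
  assumes g: "smooth g" and k: "\<And>x. (k has_vector_derivative (\<alpha> * k x + \<beta> * g x)) (at x)"
  shows "smooth k"
proof (rule smooth_coinduct[where P = "\<lambda>h. \<exists>c g. smooth g \<and> h = (\<lambda>x. c * k x + g x)"])
  fix h assume "\<exists>c g. smooth g \<and> h = (\<lambda>x. c * k x + g x)"
  then obtain c u where u: "smooth u" "h = (\<lambda>x. c * k x + u x)" by blast
  have "(h has_vector_derivative (c * (\<alpha> * k x + \<beta> * g x) + vderiv u x)) (at x)" for x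
    unfolding u(2) by (intro has_vector_derivative_add has_vector_derivative_mult_right smooth_vector_derivative k u)
  moreover have "(\<lambda>x. c * (\<alpha> * k x + \<beta> * g x) + vderiv u x) = (\<lambda>x. (c * \<alpha>) * k x + ((c * \<beta>) * g x + 1 * vderiv u x))"
    by (auto simp: algebra_simps)
  moreover have "smooth (\<lambda>x. (c * \<beta>) * g x + 1 * vderiv u x)"
    by (intro smooth_linear_combination g smooth_vderiv u)
  ultimately show "\<exists>g'. (\<forall>x. (h has_vector_derivative g' x) (at x)) \<and> (\<exists>c g. smooth g \<and> g' = (\<lambda>x. c * k x + g x))"
    by (intro exI[of _ "\<lambda>x. c * (\<alpha> * k x + \<beta> * g x) + vderiv u x"] conjI allI) (simp, blast)
next
  show "\<exists>c g. smooth g \<and> k = (\<lambda>x. c * k x + g x)"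
    by (rule exI[of _ 1], rule exI[of _ "\<lambda>x. 0 * g x"], rule conjI, rule smooth_cmult[OF g], simp)
qed

text \<open>The functions \<open>x\<^bsup>-k\<^esup> exp (- 1 / x)\<close>, continued by zero: differentiation maps their span into
  itself, and for \<open>k = 0\<close> one obtains the standard smooth function that is flat at the origin.\<close>

definition flat_power :: "nat \<Rightarrow> real \<Rightarrow> real" where
  "flat_power k x = (if x > 0 then (1 / x) ^ k * exp (- (1 / x)) else 0)"

lemma flat_power_tendsto_0: "(flat_power k \<longlongrightarrow> 0) (at 0)"
proof -
  have "((\<lambda>u. u ^ k / exp u) \<longlongrightarrow> (0::real)) at_top" by (rule tendsto_power_div_exp_0)
  then have "((\<lambda>x. (inverse x) ^ k / exp (inverse x)) \<longlongrightarrow> 0) (at_right (0::real))"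
    using filterlim_compose filterlim_inverse_at_top_right by blast
  moreover have "eventually (\<lambda>x. (inverse x) ^ k / exp (inverse x) = flat_power k x) (at_right 0)"
    by (auto simp: eventually_at_filter flat_power_def exp_minus divide_inverse)
  ultimately have "(flat_power k \<longlongrightarrow> 0) (at_right 0)" by (rule Lim_transform_eventually)
  moreover have "(flat_power k \<longlongrightarrow> 0) (at_left 0)"
    by (rule tendsto_eventually) (auto simp: eventually_at_filter flat_power_def)
  ultimately show ?thesis by (simp add: filterlim_split_at)
qed

lemma flat_power_DERIV:
  "(flat_power k has_real_derivative (flat_power (k + 2) x - real k * flat_power (k + 1) x)) (at x)"
proof -
  consider "x > 0" | "x < 0" | "x = 0" by linarith
  then show ?thesis
  proof cases
    case 1
    have "((\<lambda>x. (1 / x) ^ k * exp (- (1 / x))) has_real_derivative (flat_power (k + 2) x - real k * flat_power (k + 1) x)) (at x)"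
    proof (cases k)
      case 0
      then show ?thesis using 1
        by (auto intro!: derivative_eq_intros simp: flat_power_def power2_eq_square)
    next
      case (Suc n)
      have "real n * x ^ n = real n * (x * x ^ (n - Suc 0))" by (cases n) auto
      then show ?thesis using 1 Suc
        by (auto intro!: derivative_eq_intros simp: flat_power_def power2_eq_square field_simps)
    qed
    moreover have "eventually (\<lambda>y. (1 / y) ^ k * exp (- (1 / y)) = flat_power k y) (nhds x)"
      by (rule eventually_mono[OF eventually_nhds_in_open[of "{0<..}"]]) (use 1 in \<open>auto simp: flat_power_def\<close>)
    ultimately show ?thesis by (simp only: DERIV_cong_ev[OF refl _ refl])
  next
    case 2
    have "((\<lambda>x. 0) has_real_derivative 0) (at x)" by simp
    moreover have "eventually (\<lambda>y. 0 = flat_power k y) (nhds x)"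
      by (rule eventually_mono[OF eventually_nhds_in_open[of "{..<0}"]]) (use 2 in \<open>auto simp: flat_power_def\<close>)
    ultimately have "(flat_power k has_real_derivative 0) (at x)" by (simp only: DERIV_cong_ev[OF refl _ refl])
    then show ?thesis using 2 by (simp add: flat_power_def)
  next
    case 3
    have "(\<lambda>h. (flat_power k (0 + h) - flat_power k 0) / h) = flat_power (k + 1)"
      by (auto simp: flat_power_def fun_eq_iff)
    then show ?thesis using flat_power_tendsto_0[of "k+1"] 3 by (simp add: DERIV_def) (simp add: flat_power_def)
  qed
qed

inductive flat_span :: "(real \<Rightarrow> real) \<Rightarrow> bool" where
  base: "flat_span (\<lambda>x. c * flat_power k x)"
| add: "flat_span u \<Longrightarrow> flat_span v \<Longrightarrow> flat_span (\<lambda>x. u x + v x)"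

lemma smooth_flat: "smooth (\<lambda>x. of_real (flat_power 0 x))"
proof (rule smooth_coinduct[where P = "\<lambda>h. \<exists>u. flat_span u \<and> h = (\<lambda>x. of_real (u x))"])
  fix h :: "real \<Rightarrow> complex" assume "\<exists>u. flat_span u \<and> h = (\<lambda>x. of_real (u x))"
  then obtain u where u: "flat_span u" "h = (\<lambda>x. of_real (u x))" by blast
  from u(1) have "\<exists>u'. (\<forall>x. (u has_real_derivative u' x) (at x)) \<and> flat_span u'"
  proof induction
    case (base c k)
    have "((\<lambda>x. c * flat_power k x) has_real_derivative (c * flat_power (k + 2) x + (- c * real k) * flat_power (k + 1) x)) (at x)" for x
      using DERIV_cmult[OF flat_power_DERIV[of k x], of c] by (simp add: algebra_simps)
    moreover have "flat_span (\<lambda>x. c * flat_power (k + 2) x + (- c * real k) * flat_power (k + 1) x)"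
      by (intro flat_span.intros)
    ultimately show ?case
      by (intro exI[of _ "\<lambda>x. c * flat_power (k + 2) x + (- c * real k) * flat_power (k + 1) x"] conjI allI)
  next
    case (add u v)
    then obtain u' v' where *: "\<forall>x. (u has_real_derivative u' x) (at x)" "flat_span u'"
       "\<forall>x. (v has_real_derivative v' x) (at x)" "flat_span v'" by blast
    then show ?case
      by (intro exI[of _ "\<lambda>x. u' x + v' x"] conjI allI DERIV_add flat_span.add) auto
  qed
  then obtain u' where u': "\<And>x. (u has_real_derivative u' x) (at x)" "flat_span u'" by blast
  have "(h has_vector_derivative of_real (u' x)) (at x)" for x
    unfolding u(2) using u'(1)[of x] by (intro has_vector_derivative_of_real) (simp add: has_real_derivative_iff_has_vector_derivative)
  then show "\<exists>g'. (\<forall>x. (h has_vector_derivative g' x) (at x)) \<and> (\<exists>u. flat_span u \<and> g' = (\<lambda>x. of_real (u x)))"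
    by (intro exI[of _ "\<lambda>x. of_real (u' x)"] conjI allI exI[of _ u'] u' refl)
next
  have "flat_span (\<lambda>x. 1 * flat_power 0 x)" by (rule flat_span.base)
  then show "\<exists>u. flat_span u \<and> (\<lambda>x. of_real (flat_power 0 x)) = (\<lambda>x. of_real (u x) :: complex)" by auto
qed

lemma exists_bump:
  assumes "b > 0"
  obtains u :: "real \<Rightarrow> real" where "smooth (\<lambda>x. of_real (u x))" "\<And>x. u x \<ge> 0" "\<And>x. \<bar>x\<bar> < b \<Longrightarrow> u x > 0" "\<And>x. \<bar>x\<bar> \<ge> b \<Longrightarrow> u x = 0"
proof
  let ?u = "\<lambda>x. flat_power 0 (b + 1 * x) * flat_power 0 (b + (-1) * x)"
  have "smooth (\<lambda>x. of_real (flat_power 0 (b + 1 * x)) * of_real (flat_power 0 (b + (-1) * x)))"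
    by (rule smooth_mult[OF smooth_affine[OF smooth_flat] smooth_affine[OF smooth_flat]])
  then show "smooth (\<lambda>x. of_real (?u x))" by simp
  fix x
  show "?u x \<ge> 0" by (auto simp: flat_power_def)
  show "?u x > 0" if "\<bar>x\<bar> < b" using that by (auto simp: flat_power_def)
  show "?u x = 0" if "\<bar>x\<bar> \<ge> b" using that by (auto simp: flat_power_def)
qed

section \<open>Fourier transforms of test functions as entire functions\<close>

definition test_function :: "real \<Rightarrow> (real \<Rightarrow> complex) \<Rightarrow> bool" where
  "test_function a f \<longleftrightarrow> smooth f \<and> (\<exists>b. 0 \<le> b \<and> b < a \<and> (\<forall>x. b < \<bar>x\<bar> \<longrightarrow> f x = 0))"

lemma test_functions_eq:
  assumes "a > 0"
  shows "test_functions a = {f. test_function a f}"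
proof (intro equalityI subsetI; clarify?)
  fix f assume f: "f \<in> test_functions a"
  then have sm: "smooth f" and cl: "closure (support_on UNIV f) \<subseteq> {-a<..<a}" by (auto simp: test_functions_def)
  let ?K = "closure (support_on UNIV f)"
  have "bounded ?K" using cl by (rule bounded_subset[rotated]) simp
  then have K: "compact ?K" by (simp add: compact_eq_bounded_closed)
  show "test_function a f"
  proof (cases "?K = {}")
    case True
    then show ?thesis using sm assms
      by (auto simp: test_function_def support_on_def intro!: exI[of _ 0])
  next
    case False
    have "continuous_on ?K (\<lambda>x. \<bar>x\<bar>)" by (intro continuous_intros)
    then obtain x0 where x0: "x0 \<in> ?K" "\<And>x. x \<in> ?K \<Longrightarrow> \<bar>x\<bar> \<le> \<bar>x0\<bar>"
      using continuous_attains_sup[OF K False] by blast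
    have "f x = 0" if "\<bar>x0\<bar> < \<bar>x\<bar>" for x
    proof (rule ccontr)
      assume "f x \<noteq> 0"
      then have "x \<in> ?K" using closure_subset[of "support_on UNIV f"] by (auto simp: support_on_def)
      then show False using x0(2) that by force
    qed
    moreover have "x0 \<in> {-a<..<a}" using x0(1) cl by blast
    then have "\<bar>x0\<bar> < a" by auto
    ultimately show ?thesis using sm unfolding test_function_def by (intro conjI exI[of _ "\<bar>x0\<bar>"]) auto
  qed
next
  fix f assume "test_function a f"
  then obtain b where b: "smooth f" "0 \<le> b" "b < a" "\<And>x. b < \<bar>x\<bar> \<Longrightarrow> f x = 0" by (auto simp: test_function_def)
  have "support_on UNIV f \<subseteq> {-b..b}"
  proof
    fix x assume "x \<in> support_on UNIV f"
    then have "f x \<noteq> 0" by (simp add: support_on_def)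
    then have "\<not> b < \<bar>x\<bar>" using b(4) by blast
    then have "\<bar>x\<bar> \<le> b" by simp
    then show "x \<in> {-b..b}" by auto
  qed
  then have "closure (support_on UNIV f) \<subseteq> {-b..b}" by (intro closure_minimal) auto
  then show "f \<in> test_functions a" using b by (auto simp: test_functions_def)
qed

definition fourier_laplace :: "(real \<Rightarrow> complex) \<Rightarrow> complex \<Rightarrow> complex" where
  "fourier_laplace f z = (\<integral>x. f x * exp (- \<i> * z * of_real x) \<partial>lborel)"

lemma fourier_transform_eq: "fourier_transform f t = fourier_laplace f (of_real t)"
  by (simp add: fourier_transform_def fourier_laplace_def mult.assoc)

text \<open>Differentiation under the integral sign, integration by parts and the exchange of integrals are
  carried out below for continuous integrands on compact intervals.\<close>

lemma integral_lborel_compact_support: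
  fixes f :: "real \<Rightarrow> complex"
  assumes "continuous_on UNIV f" "\<And>x. x \<notin> {l..u} \<Longrightarrow> f x = 0"
  shows "integrable lborel f" "(\<integral>x. f x \<partial>lborel) = integral {l..u} f"
proof -
  have si: "set_integrable lborel {l..u} f"
    by (rule borel_integrable_atLeastAtMost') (rule continuous_on_subset[OF assms(1)], simp)
  have eq: "(\<lambda>x. indicator {l..u} x *\<^sub>R f x) = f" using assms(2) by (auto simp: indicator_def)
  show "integrable lborel f" using si unfolding set_integrable_def eq .
  show "(\<integral>x. f x \<partial>lborel) = integral {l..u} f"
    using set_borel_integral_eq_integral(2)[OF si] unfolding set_lebesgue_integral_def eq .
qed

lemma fourier_laplace_integral:
  assumes "continuous_on UNIV f" "\<And>x. x \<notin> {l..u} \<Longrightarrow> f x = 0"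
  shows "integrable lborel (\<lambda>x. f x * exp (- \<i> * z * of_real x))"
    and "fourier_laplace f z = integral {l..u} (\<lambda>x. f x * exp (- \<i> * z * of_real x))"
proof -
  have "continuous_on UNIV (\<lambda>x. f x * exp (- \<i> * z * of_real x))"
    using assms(1) by (intro continuous_intros)
  note * = integral_lborel_compact_support[OF this, of l u]
  show "integrable lborel (\<lambda>x. f x * exp (- \<i> * z * of_real x))"
    by (rule *(1)) (simp add: assms(2))
  show "fourier_laplace f z = integral {l..u} (\<lambda>x. f x * exp (- \<i> * z * of_real x))"
    unfolding fourier_laplace_def by (rule *(2)) (simp add: assms(2))
qed

lemma test_functionD:
  assumes "test_function a f"
  shows "\<exists>b. smooth f \<and> 0 \<le> b \<and> b < a \<and> (\<forall>x. b < \<bar>x\<bar> \<longrightarrow> f x = 0) \<and> (\<forall>x. x \<notin> {-b..b} \<longrightarrow> f x = 0)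
    \<and> continuous_on UNIV f"
proof -
  obtain b where b: "smooth f" "0 \<le> b" "b < a" "\<And>x. b < \<bar>x\<bar> \<Longrightarrow> f x = 0"
    using assms by (auto simp: test_function_def)
  moreover have "f x = 0" if "x \<notin> {-b..b}" for x using b(4)[of x] that by auto
  ultimately show ?thesis using smooth_continuous_on by blast
qed

lemma fourier_laplace_integrable:
  assumes "test_function a f"
  shows "integrable lborel (\<lambda>x. f x * exp (- \<i> * z * of_real x))"
proof -
  obtain b where b: "smooth f" "0 \<le> b" "b < a" "\<And>x. b < \<bar>x\<bar> \<Longrightarrow> f x = 0" "\<And>x. x \<notin> {-b..b} \<Longrightarrow> f x = 0"
    "continuous_on UNIV f"
    using test_functionD[OF assms] by blast
  show ?thesis by (rule fourier_laplace_integral(1)[OF b(6,5)])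
qed

lemma fourier_laplace_entire:
  assumes "test_function a f"
  shows "fourier_laplace f holomorphic_on UNIV"
proof -
  obtain b where b: "smooth f" "0 \<le> b" "b < a" "\<And>x. b < \<bar>x\<bar> \<Longrightarrow> f x = 0" "\<And>x. x \<notin> {-b..b} \<Longrightarrow> f x = 0"
    "continuous_on UNIV f"
    using test_functionD[OF assms] by blast
  have f_snd: "continuous_on S (\<lambda>p. f (snd p))" for S :: "(complex \<times> real) set"
    by (rule continuous_on_compose2[OF b(6)]) (auto intro!: continuous_intros)
  have "(\<lambda>z. integral (cbox (-b) b) (\<lambda>x. f x * exp (- \<i> * z * of_real x))) holomorphic_on UNIV"
  proof (rule leibniz_rule_holomorphic[where fx = "\<lambda>z x. f x * (- \<i> * of_real x * exp (- \<i> * z * of_real x))"])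
    show "((\<lambda>z. f t * exp (- \<i> * z * of_real t)) has_field_derivative f t * (- \<i> * of_real t * exp (- \<i> * z * of_real t))) (at z within UNIV)" for z t
      by (auto intro!: derivative_eq_intros)
    show "(\<lambda>x. f x * exp (- \<i> * z * of_real x)) integrable_on cbox (- b) b" for z
      by (intro integrable_continuous continuous_intros continuous_on_subset[OF b(6)]) auto
    show "continuous_on (UNIV \<times> cbox (- b) b) (\<lambda>(z, x). f x * (- \<i> * of_real x * exp (- \<i> * z * of_real x)))"
      unfolding split_beta by (intro continuous_intros f_snd)
  qed auto
  moreover have "fourier_laplace f = (\<lambda>z. integral (cbox (-b) b) (\<lambda>x. f x * exp (- \<i> * z * of_real x)))"
    using fourier_laplace_integral(2)[OF b(6,5)] by auto
  ultimately show ?thesis by simp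
qed

lemma fourier_laplace_growth:
  assumes "test_function a f"
  shows "\<exists>C\<ge>0. \<forall>z. cmod (fourier_laplace f z) \<le> C * exp (a * \<bar>Im z\<bar>)"
proof -
  obtain b where b: "smooth f" "0 \<le> b" "b < a" "\<And>x. b < \<bar>x\<bar> \<Longrightarrow> f x = 0" "\<And>x. x \<notin> {-b..b} \<Longrightarrow> f x = 0"
    "continuous_on UNIV f"
    using test_functionD[OF assms] by blast
  define C where "C = (\<integral>x. cmod (f x) \<partial>lborel)"
  have int: "integrable lborel f" using integral_lborel_compact_support(1)[OF b(6,5)] .
  have "cmod (fourier_laplace f z) \<le> C * exp (a * \<bar>Im z\<bar>)" for z
  proof -
    have "cmod (fourier_laplace f z) \<le> (\<integral>x. cmod (f x * exp (- \<i> * z * of_real x)) \<partial>lborel)"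
      unfolding fourier_laplace_def by (rule integral_norm_bound)
    also have "\<dots> \<le> (\<integral>x. cmod (f x) * exp (a * \<bar>Im z\<bar>) \<partial>lborel)"
    proof (rule integral_mono)
      show "integrable lborel (\<lambda>x. cmod (f x * exp (- \<i> * z * of_real x)))"
        by (intro integrable_norm fourier_laplace_integrable[OF assms])
      show "integrable lborel (\<lambda>x. cmod (f x) * exp (a * \<bar>Im z\<bar>))" using int by simp
      show "cmod (f x * exp (- \<i> * z * of_real x)) \<le> cmod (f x) * exp (a * \<bar>Im z\<bar>)" for x
      proof (cases "f x = 0")
        case False
        then have "\<not> b < \<bar>x\<bar>" using b(4) by blast
        then have "\<bar>x\<bar> \<le> a" using b(3) by linarith
        then have "\<bar>x\<bar> * \<bar>Im z\<bar> \<le> a * \<bar>Im z\<bar>" by (rule mult_right_mono) simp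
        moreover have "x * Im z \<le> \<bar>x\<bar> * \<bar>Im z\<bar>" using abs_ge_self[of "x * Im z"] by (simp add: abs_mult)
        ultimately have "x * Im z \<le> a * \<bar>Im z\<bar>" by linarith
        then show ?thesis by (simp add: norm_mult mult_left_mono mult.commute)
      qed simp
    qed
    also have "\<dots> = C * exp (a * \<bar>Im z\<bar>)" by (simp add: C_def)
    finally show ?thesis .
  qed
  moreover have "C \<ge> 0" by (simp add: C_def)
  ultimately show ?thesis by blast
qed

lemma test_function_mono: "test_function a f \<Longrightarrow> a \<le> a' \<Longrightarrow> test_function a' f"
  by (force simp: test_function_def)

lemma test_function_linear_combination:
  assumes "test_function a f" "test_function a g"
  shows "test_function a (\<lambda>x. c * f x + d * g x)"
    and "fourier_laplace (\<lambda>x. c * f x + d * g x) z = c * fourier_laplace f z + d * fourier_laplace g z"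
proof -
  obtain b where b: "smooth f" "0 \<le> b" "b < a" "\<And>x. b < \<bar>x\<bar> \<Longrightarrow> f x = 0" "\<And>x. x \<notin> {-b..b} \<Longrightarrow> f x = 0"
    "continuous_on UNIV f"
    using test_functionD[OF assms(1)] by blast
  obtain b' where b': "smooth g" "0 \<le> b'" "b' < a" "\<And>x. b' < \<bar>x\<bar> \<Longrightarrow> g x = 0" "\<And>x. x \<notin> {-b'..b'} \<Longrightarrow> g x = 0"
    "continuous_on UNIV g"
    using test_functionD[OF assms(2)] by blast
  show "test_function a (\<lambda>x. c * f x + d * g x)"
    unfolding test_function_def using b b' by (intro conjI smooth_linear_combination exI[of _ "max b b'"]) auto
  show "fourier_laplace (\<lambda>x. c * f x + d * g x) z = c * fourier_laplace f z + d * fourier_laplace g z"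
    using fourier_laplace_integrable[OF assms(1), of z] fourier_laplace_integrable[OF assms(2), of z]
    by (simp add: fourier_laplace_def distrib_right mult.assoc)
qed

lemma test_function_vderiv:
  assumes "test_function a f"
  shows "test_function a (vderiv f)" and "fourier_laplace (vderiv f) z = \<i> * z * fourier_laplace f z"
proof -
  obtain b where b: "smooth f" "0 \<le> b" "b < a" "\<And>x. b < \<bar>x\<bar> \<Longrightarrow> f x = 0" "\<And>x. x \<notin> {-b..b} \<Longrightarrow> f x = 0"
    "continuous_on UNIV f"
    using test_functionD[OF assms] by blast
  have 0: "vderiv f x = 0" if "b < \<bar>x\<bar>" for x
  proof -
    have "(f has_vector_derivative 0) (at x)"
    proof (rule has_vector_derivative_transform_within_open[of "\<lambda>_. 0"])
      show "open {x::real. b < \<bar>x\<bar>}" by (intro open_Collect_less continuous_intros)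
    qed (use that b in auto)
    then show ?thesis by (rule vector_derivative_at)
  qed
  show "test_function a (vderiv f)"
    unfolding test_function_def using b 0 by (intro conjI smooth_vderiv exI[of _ b]) auto
  have c': "continuous_on UNIV (vderiv f)" by (intro smooth_continuous_on smooth_vderiv b)
  define c where "c = b + 1"
  have out: "f x = 0" "vderiv f x = 0" if "x \<notin> {-c..c}" for x
    using b(4)[of x] 0[of x] that b(2) by (auto simp: c_def)
  have "((\<lambda>x. vderiv f x * exp (- \<i> * z * of_real x) + f x * (- \<i> * z * exp (- \<i> * z * of_real x))) has_integral
       (f c * exp (- \<i> * z * of_real c) - f (-c) * exp (- \<i> * z * of_real (-c)))) {-c..c}"
  proof (rule fundamental_theorem_of_calculus)
    show "- c \<le> c" using b by (simp add: c_def)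
    fix x assume "x \<in> {-c..c}"
    have "((\<lambda>x. exp (- \<i> * z * of_real x)) has_vector_derivative (- \<i> * z * exp (- \<i> * z * of_real x))) (at x)"
      by (auto intro!: derivative_eq_intros has_vector_derivative_real_field)
    then have "((\<lambda>x. f x * exp (- \<i> * z * of_real x)) has_vector_derivative
        (f x * (- \<i> * z * exp (- \<i> * z * of_real x)) + vderiv f x * exp (- \<i> * z * of_real x))) (at x)"
      by (intro has_vector_derivative_mult smooth_vector_derivative b)
    then show "((\<lambda>x. f x * exp (- \<i> * z * of_real x)) has_vector_derivative
        (vderiv f x * exp (- \<i> * z * of_real x) + f x * (- \<i> * z * exp (- \<i> * z * of_real x)))) (at x within {-c..c})"
      by (simp add: add.commute has_vector_derivative_at_within)
  qed
  moreover have "f c = 0" "f (-c) = 0" using b by (auto simp: c_def)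
  ultimately have "integral {-c..c} (\<lambda>x. vderiv f x * exp (- \<i> * z * of_real x) + (- \<i> * z) * (f x * exp (- \<i> * z * of_real x))) = 0"
    by (simp add: integral_unique mult_ac)
  moreover have "integral {-c..c} (\<lambda>x. vderiv f x * exp (- \<i> * z * of_real x) + (- \<i> * z) * (f x * exp (- \<i> * z * of_real x)))
     = integral {-c..c} (\<lambda>x. vderiv f x * exp (- \<i> * z * of_real x)) + (- \<i> * z) * integral {-c..c} (\<lambda>x. f x * exp (- \<i> * z * of_real x))"
  proof -
    have i: "(\<lambda>x. vderiv f x * exp (- \<i> * z * of_real x)) integrable_on {-c..c}" "(\<lambda>x. f x * exp (- \<i> * z * of_real x)) integrable_on {-c..c}"
      by (intro integrable_continuous_interval continuous_intros continuous_on_subset[OF b(6)] continuous_on_subset[OF c']; simp)+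
    show ?thesis by (simp only: integral_add[OF i(1) integrable_on_mult_right[OF i(2)]] integral_mult_right)
  qed
  moreover have "fourier_laplace (vderiv f) z = integral {-c..c} (\<lambda>x. vderiv f x * exp (- \<i> * z * of_real x))"
    by (rule fourier_laplace_integral(2)[OF c']) (rule out(2))
  moreover have "fourier_laplace f z = integral {-c..c} (\<lambda>x. f x * exp (- \<i> * z * of_real x))"
    by (rule fourier_laplace_integral(2)[OF b(6)]) (rule out(1))
  ultimately have "fourier_laplace (vderiv f) z + (- \<i> * z) * fourier_laplace f z = 0" by (simp only:)
  then show "fourier_laplace (vderiv f) z = \<i> * z * fourier_laplace f z" by simp
qed

lemma test_function_reflect:
  assumes "test_function a f"
  shows "test_function a (\<lambda>x. cnj (f (- x)))" and "fourier_laplace (\<lambda>x. cnj (f (- x))) z = cnj (fourier_laplace f (cnj z))"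
proof -
  obtain b where b: "smooth f" "0 \<le> b" "b < a" "\<And>x. b < \<bar>x\<bar> \<Longrightarrow> f x = 0" "\<And>x. x \<notin> {-b..b} \<Longrightarrow> f x = 0"
    "continuous_on UNIV f"
    using test_functionD[OF assms] by blast
  show "test_function a (\<lambda>x. cnj (f (- x)))"
    unfolding test_function_def using b by (intro conjI smooth_cnj_reflect exI[of _ b]) auto
  have "fourier_laplace (\<lambda>x. cnj (f (- x))) z = (\<integral>x. cnj (f (- x) * exp (- \<i> * cnj z * of_real (- x))) \<partial>lborel)"
    unfolding fourier_laplace_def by (intro Bochner_Integration.integral_cong) (auto simp: exp_cnj)
  also have "\<dots> = cnj (\<integral>x. f (- x) * exp (- \<i> * cnj z * of_real (- x)) \<partial>lborel)" by (rule Bochner_Integration.integral_cnj)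
  also have "(\<integral>x. f (- x) * exp (- \<i> * cnj z * of_real (- x)) \<partial>lborel) = fourier_laplace f (cnj z)"
    unfolding fourier_laplace_def by (subst (2) lborel_integral_real_affine[where c = "-1" and t = 0]) auto
  finally show "fourier_laplace (\<lambda>x. cnj (f (- x))) z = cnj (fourier_laplace f (cnj z))" .
qed

definition convolution :: "(real \<Rightarrow> complex) \<Rightarrow> (real \<Rightarrow> complex) \<Rightarrow> real \<Rightarrow> complex" where
  "convolution f g x = (\<integral>t. f (x - t) * g t \<partial>lborel)"

lemma smooth_convolution:
  assumes "smooth f" and g: "continuous_on UNIV g" "\<And>x. x \<notin> {-c..c} \<Longrightarrow> g x = 0"
  shows "smooth (convolution f g)"
proof -
  have eq: "convolution f g = (\<lambda>x. integral (cbox (-c) c) (\<lambda>t. f (x - t) * g t))" if "smooth f" for f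
  proof
    fix x
    have "continuous_on UNIV (\<lambda>t. f (x - t) * g t)"
      by (intro continuous_intros continuous_on_compose2[OF smooth_continuous_on[OF that, of UNIV]] g) auto
    then show "convolution f g x = integral (cbox (-c) c) (\<lambda>t. f (x - t) * g t)"
      unfolding convolution_def by (subst integral_lborel_compact_support(2)[of _ "-c" c]) (auto simp: g(2))
  qed
  show ?thesis
  proof (rule smooth_coinduct[where P = "\<lambda>h. \<exists>f. smooth f \<and> h = convolution f g"])
    fix h assume "\<exists>f. smooth f \<and> h = convolution f g"
    then obtain f where f: "smooth f" "h = convolution f g" by blast
    have c2: "continuous_on S (\<lambda>p. u (fst p - snd p))" if "smooth u" for u :: "real \<Rightarrow> complex" and S :: "(real \<times> real) set"
      by (rule continuous_on_compose2[OF smooth_continuous_on[OF that, of UNIV]]) (auto intro!: continuous_intros)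
    have g2: "continuous_on S (\<lambda>p. g (snd p))" for S :: "(real \<times> real) set"
      by (rule continuous_on_compose2[OF g(1)]) (auto intro!: continuous_intros)
    have "((\<lambda>x. integral (cbox (-c) c) (\<lambda>t. f (x - t) * g t)) has_vector_derivative
        integral (cbox (-c) c) (\<lambda>t. vderiv f (x - t) * g t)) (at x within UNIV)" for x
    proof (rule leibniz_rule_vector_derivative)
      show "((\<lambda>x. f (x - t) * g t) has_vector_derivative vderiv f (x - t) * g t) (at x within UNIV)" for x t
      proof -
        have "((f \<circ> (\<lambda>x. x - t)) has_vector_derivative (1 *\<^sub>R vderiv f (x - t))) (at x)"
          by (rule vector_diff_chain_at) (auto intro!: derivative_eq_intros smooth_vector_derivative f simp: has_real_derivative_iff_has_vector_derivative[symmetric])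
        then show ?thesis using has_vector_derivative_mult_left[of "f \<circ> (\<lambda>x. x - t)" _ "at x" "g t"] by (simp add: o_def)
      qed
      show "(\<lambda>t. f (x - t) * g t) integrable_on cbox (- c) c" for x
        by (intro integrable_continuous continuous_on_mult continuous_on_compose2[OF smooth_continuous_on[OF f(1), of UNIV]] continuous_intros continuous_on_subset[OF g(1)]) auto
      show "continuous_on (UNIV \<times> cbox (- c) c) (\<lambda>(x, t). vderiv f (x - t) * g t)"
        unfolding split_beta by (intro continuous_on_mult c2 g2 smooth_vderiv f)
    qed auto
    then have "(h has_vector_derivative convolution (vderiv f) g x) (at x)" for x
      unfolding f(2) eq[OF f(1)] eq[OF smooth_vderiv[OF f(1)]] by simp
    then show "\<exists>g'. (\<forall>x. (h has_vector_derivative g' x) (at x)) \<and> (\<exists>f. smooth f \<and> g' = convolution f g)"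
      by (intro exI[of _ "convolution (vderiv f) g"] conjI allI exI[of _ "vderiv f"] smooth_vderiv f refl)
  qed (intro exI[of _ f] conjI assms refl)
qed

lemma test_function_convolution:
  assumes "test_function a f" "test_function a' g"
  shows "test_function (a + a') (convolution f g)"
    and "fourier_laplace (convolution f g) z = fourier_laplace f z * fourier_laplace g z"
proof -
  obtain b where b: "smooth f" "0 \<le> b" "b < a" "\<And>x. b < \<bar>x\<bar> \<Longrightarrow> f x = 0" "\<And>x. x \<notin> {-b..b} \<Longrightarrow> f x = 0" "continuous_on UNIV f"
    using test_functionD[OF assms(1)] by blast
  obtain c where c: "smooth g" "0 \<le> c" "c < a'" "\<And>x. c < \<bar>x\<bar> \<Longrightarrow> g x = 0" "\<And>x. x \<notin> {-c..c} \<Longrightarrow> g x = 0" "continuous_on UNIV g"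
    using test_functionD[OF assms(2)] by blast
  have sm: "smooth (convolution f g)" by (rule smooth_convolution[OF b(1) c(6,5)])
  have prod0: "f (x - t) * g t = 0" if "b + c < \<bar>x\<bar>" for x t
  proof (cases "c < \<bar>t\<bar>")
    case False
    then have "b < \<bar>x - t\<bar>" using that by linarith
    then show ?thesis using b(4) by simp
  qed (simp add: c(4))
  have out: "convolution f g x = 0" if "b + c < \<bar>x\<bar>" for x
    unfolding convolution_def by (simp add: prod0[OF that])
  show bf: "test_function (a + a') (convolution f g)"
    unfolding test_function_def using sm b c out by (intro conjI exI[of _ "b + c"]) auto
  define M where "M = b + c"
  define e where "e x = exp (- \<i> * z * of_real x)" for x :: real
  have e_add: "e x = e (x - t) * e t" for x t
    unfolding e_def by (simp add: exp_add[symmetric] algebra_simps)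
  have e_c: "continuous_on S e" for S unfolding e_def by (intro continuous_intros)
  have conv_eq: "convolution f g x = integral {-c..c} (\<lambda>t. f (x - t) * g t)" for x
  proof -
    have "continuous_on UNIV (\<lambda>t. f (x - t) * g t)"
      by (intro continuous_intros continuous_on_compose2[OF b(6)] c) auto
    then show ?thesis
      unfolding convolution_def by (subst integral_lborel_compact_support(2)[of _ "-c" c]) (auto simp: c(5))
  qed
  have outM: "convolution f g x = 0" if "x \<notin> {-M..M}" for x
    using out[of x] that by (auto simp: M_def)
  have "fourier_laplace (convolution f g) z = integral {-M..M} (\<lambda>x. convolution f g x * e x)"
    unfolding e_def by (rule fourier_laplace_integral(2)[OF smooth_continuous_on[OF sm] outM])
  also have "\<dots> = integral (cbox (-M) M) (\<lambda>x. integral (cbox (-c) c) (\<lambda>t. f (x - t) * g t * e x))"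
    unfolding conv_eq by (simp add: cbox_interval)
  also have "\<dots> = integral (cbox (-c) c) (\<lambda>t. integral (cbox (-M) M) (\<lambda>x. f (x - t) * g t * e x))"
  proof (rule integral_swap_continuous)
    have "continuous_on S (\<lambda>p. f (fst p - snd p))" "continuous_on S (\<lambda>p. g (snd p))" "continuous_on S (\<lambda>p. e (fst p))"
      for S :: "(real \<times> real) set"
      by (auto intro!: continuous_on_compose2[OF b(6)] continuous_on_compose2[OF c(6)] continuous_on_compose2[OF e_c[of UNIV]] continuous_intros)
    then show "continuous_on (cbox (- M, - c) (M, c)) (\<lambda>(x, t). f (x - t) * g t * e x)"
      unfolding split_beta by (intro continuous_on_mult)
  qed
  also have "\<dots> = integral (cbox (-c) c) (\<lambda>t. g t * e t * fourier_laplace f z)"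
  proof (rule integral_cong)
    fix t assume t: "t \<in> cbox (-c) c"
    have "integral (cbox (-M) M) (\<lambda>x. f (x - t) * g t * e x) = integral (cbox (-M) M) (\<lambda>x. g t * e t * (f (x - t) * e (x - t)))"
      by (rule integral_cong) (subst e_add[of _ t], simp)
    also have "\<dots> = g t * e t * integral {-M..M} (\<lambda>x. f (x - t) * e (x - t))" by (simp add: cbox_interval)
    also have "integral {-M..M} (\<lambda>x. f (x - t) * e (x - t)) = (\<integral>x. f (x - t) * e (x - t) \<partial>lborel)"
    proof (rule integral_lborel_compact_support(2)[symmetric])
      show "continuous_on UNIV (\<lambda>x. f (x - t) * e (x - t))"
        by (intro continuous_on_mult continuous_on_compose2[OF b(6)] continuous_on_compose2[OF e_c[of UNIV]] continuous_intros) auto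
      show "f (x - t) * e (x - t) = 0" if "x \<notin> {-M..M}" for x
      proof -
        have "b < \<bar>x - t\<bar>" using that t by (auto simp: M_def)
        then show ?thesis using b(4) by simp
      qed
    qed
    also have "(\<integral>x. f (x - t) * e (x - t) \<partial>lborel) = fourier_laplace f z"
      unfolding fourier_laplace_def e_def
      by (subst lborel_integral_real_affine[where c = 1 and t = t]) auto
    finally show "integral (cbox (-M) M) (\<lambda>x. f (x - t) * g t * e x) = g t * e t * fourier_laplace f z" .
  qed
  also have "\<dots> = integral {-c..c} (\<lambda>t. g t * e t) * fourier_laplace f z" by (simp add: cbox_interval)
  also have "integral {-c..c} (\<lambda>t. g t * e t) = fourier_laplace g z"
    unfolding e_def by (rule fourier_laplace_integral(2)[OF c(6,5), symmetric])
  finally show "fourier_laplace (convolution f g) z = fourier_laplace f z * fourier_laplace g z" by (simp add: mult.commute)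
qed

text \<open>The primitive of \<open>q(t) exp (- i z t)\<close> that vanishes on the left of the support of \<open>q\<close> also vanishes on
  the right, because its total increment is the value of the transform of \<open>q\<close> at \<open>z\<close>. Multiplying
  it by \<open>i exp (i z x)\<close> gives a compactly supported solution of \<open>k' = i z k + i q\<close>, and the transform turns
  this equation into the division by \<open>w - z\<close>.\<close>

lemma test_function_divide:
  assumes "test_function a q" and zero: "fourier_laplace q z = 0"
  obtains k where "test_function a k" "\<And>w. fourier_laplace q w = (w - z) * fourier_laplace k w"
proof -
  obtain b where b: "smooth q" "0 \<le> b" "b < a" "\<And>x. b < \<bar>x\<bar> \<Longrightarrow> q x = 0" "\<And>x. x \<notin> {-b..b} \<Longrightarrow> q x = 0" "continuous_on UNIV q"
    using test_functionD[OF assms(1)] by blast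
  define e where "e x = exp (- \<i> * z * of_real x)" for x :: real
  have e_c: "continuous_on S e" for S unfolding e_def by (intro continuous_intros)
  have qe_c: "continuous_on S (\<lambda>t. q t * e t)" for S
    by (intro continuous_on_mult e_c continuous_on_subset[OF b(6)]) auto
  \<comment> \<open>Starting one unit to the left of the support makes \<open>I\<close> differentiable at \<open>- b\<close> too.\<close>
  define I where "I x = integral {-(b+1)..x} (\<lambda>t. q t * e t)" for x
  have I_low: "I x = 0" if "x < - b" for x
  proof -
    have "I x = integral {-(b+1)..x} (\<lambda>t. 0)" unfolding I_def
      by (rule integral_cong) (use that b(4) in auto)
    then show ?thesis by simp
  qed
  have I_high: "I x = 0" if "b < x" for x
  proof -
    have "fourier_laplace q z = I x" unfolding I_def e_def
      by (rule fourier_laplace_integral(2)[OF b(6)]) (use that b(2,4) in auto)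
    then show ?thesis using zero by simp
  qed
  have I_deriv: "(I has_vector_derivative (q x * e x)) (at x)" for x
  proof (cases "x < - b")
    case True
    have "(I has_vector_derivative 0) (at x)"
    proof (rule has_vector_derivative_transform_within_open[of "\<lambda>_. 0"])
      show "open {..< - b}" by simp
    qed (use True I_low in auto)
    then show ?thesis using b(4) True b(2) by simp
  next
    case False
    have "(I has_vector_derivative (q x * e x)) (at x within {-(b+1)..x+1})"
      unfolding I_def using False by (intro integral_has_vector_derivative qe_c) auto
    then have "(I has_vector_derivative (q x * e x)) (at x within {-(b+1)<..<x+1})"
      by (rule has_vector_derivative_within_subset) auto
    then show ?thesis using False by (subst (asm) has_vector_derivative_within_open) auto
  qed
  define k where "k x = \<i> * (exp (\<i> * z * of_real x) * I x)" for x :: real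
  have k_deriv: "(k has_vector_derivative (\<i> * z * k x + \<i> * q x)) (at x)" for x
  proof -
    have "((\<lambda>x. exp (\<i> * z * of_real x)) has_vector_derivative (\<i> * z * exp (\<i> * z * of_real x))) (at x)"
      by (auto intro!: derivative_eq_intros has_vector_derivative_real_field)
    then have "(k has_vector_derivative \<i> * (exp (\<i> * z * of_real x) * (q x * e x) + (\<i> * z * exp (\<i> * z * of_real x)) * I x)) (at x)"
      unfolding k_def by (intro has_vector_derivative_mult_right has_vector_derivative_mult I_deriv)
    moreover have "exp (\<i> * z * of_real x) * e x = 1" unfolding e_def by (simp add: exp_add[symmetric])
    then have "exp (\<i> * z * of_real x) * (q x * e x) = q x" by (simp add: mult.left_commute)
    ultimately have "(k has_vector_derivative \<i> * (q x + (\<i> * z * exp (\<i> * z * of_real x)) * I x)) (at x)"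
      by (simp only:)
    then show ?thesis by (simp add: k_def algebra_simps)
  qed
  have k_smooth: "smooth k" by (rule smooth_ODE[OF b(1) k_deriv])
  have k_out: "k x = 0" if "b < \<bar>x\<bar>" for x
    using that I_low I_high by (cases "x < - b") (auto simp: k_def)
  have bk: "test_function a k"
    unfolding test_function_def using k_smooth b k_out by (intro conjI exI[of _ b]) auto
  have "fourier_laplace q w = (w - z) * fourier_laplace k w" for w
  proof -
    have "vderiv k = (\<lambda>x. \<i> * z * k x + \<i> * q x)" using k_deriv by (auto simp: vector_derivative_at)
    then have "\<i> * w * fourier_laplace k w = \<i> * z * fourier_laplace k w + \<i> * fourier_laplace q w"
      using test_function_vderiv(2)[OF bk, of w] test_function_linear_combination(2)[OF bk assms(1), of "\<i> * z" \<i> w] by simp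
    then have "\<i> * fourier_laplace q w = \<i> * ((w - z) * fourier_laplace k w)" by (simp add: algebra_simps)
    then show ?thesis by simp
  qed
  with bk that show ?thesis by blast
qed

text \<open>For a non-negative \<open>f\<close> whose support is so small that \<open>\<bar>t x\<bar> < \<pi> / 2\<close> on it, the real part of the
  transform at \<open>t\<close> is the integral of \<open>f(x) cos (t x) > 0\<close>.\<close>

lemma test_function_nonvanishing:
  assumes "a > 0" "n \<ge> 0"
  obtains f where "test_function a f" "\<And>t. \<bar>t\<bar> \<le> n \<Longrightarrow> fourier_laplace f (of_real t) \<noteq> 0" "fourier_laplace f \<i> \<noteq> 0"
proof -
  define b where "b = min (a / 2) (1 / (n + 1))"
  have b: "b > 0" "b < a" "b * n < 1"
  proof -
    show "b > 0" "b < a" using assms by (auto simp: b_def)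
    have "b * n \<le> 1 / (n + 1) * n" using assms by (intro mult_right_mono) (auto simp: b_def)
    also have "\<dots> < 1" using assms by (simp add: field_simps)
    finally show "b * n < 1" .
  qed
  obtain u where u: "smooth (\<lambda>x. of_real (u x))" "\<And>x. u x \<ge> 0" "\<And>x. \<bar>x\<bar> < b \<Longrightarrow> u x > 0" "\<And>x. \<bar>x\<bar> \<ge> b \<Longrightarrow> u x = 0"
    using exists_bump[OF b(1)] by blast
  define f where "f x = complex_of_real (u x)" for x
  have fu: "smooth f" using u(1) by (simp add: f_def[abs_def])
  have f_c: "continuous_on UNIV f" by (rule smooth_continuous_on[OF fu])
  have f_out: "f x = 0" if "x \<notin> {-b..b}" for x using u(4)[of x] that by (auto simp: f_def)
  have u_c: "continuous_on S u"  for S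
  proof -
    have "continuous_on S (\<lambda>x. Re (f x))" by (intro continuous_intros continuous_on_subset[OF f_c]) auto
    then show ?thesis by (simp add: f_def)
  qed
  have pos: "Re (fourier_laplace f z) > 0" if z: "\<And>x. \<bar>x\<bar> \<le> b \<Longrightarrow> Re (exp (- \<i> * z * of_real x)) > 0" for z
  proof -
    define w where "w x = Re (exp (- \<i> * z * of_real x))" for x :: real
    have w_c: "continuous_on S w" for S unfolding w_def by (intro continuous_intros)
    have int: "(\<lambda>x. f x * exp (- \<i> * z * of_real x)) integrable_on {-b..b}"
      by (intro integrable_continuous_interval continuous_intros continuous_on_subset[OF f_c]) auto
    have "Re (fourier_laplace f z) = Re (integral {-b..b} (\<lambda>x. f x * exp (- \<i> * z * of_real x)))"
      by (simp only: fourier_laplace_integral(2)[OF f_c f_out])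
    also have "\<dots> = integral {-b..b} (\<lambda>x. Re (f x * exp (- \<i> * z * of_real x)))"
      using integral_linear[OF int bounded_linear_Re] by (simp add: o_def)
    also have "\<dots> = integral (cbox (-b) b) (\<lambda>x. u x * w x)"
      by (simp add: f_def w_def cbox_interval)
    finally have eq: "Re (fourier_laplace f z) = integral (cbox (-b) b) (\<lambda>x. u x * w x)" .
    have nn: "0 \<le> u x * w x" if "x \<in> cbox (-b) b" for x
      proof -
      have "\<bar>x\<bar> \<le> b" using that by (auto simp: abs_le_iff)
      then show ?thesis using z[of x] u(2)[of x] by (simp add: w_def)
    qed
    have c: "continuous_on (cbox (-b) b) (\<lambda>x. u x * w x)" by (intro continuous_on_mult u_c w_c)
    have "integral (cbox (-b) b) (\<lambda>x. u x * w x) \<noteq> 0"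
    proof
      assume "integral (cbox (-b) b) (\<lambda>x. u x * w x) = 0"
      then have "\<forall>x\<in>cbox (-b) b. u x * w x = 0"
        using integral_eq_0_iff[OF c[unfolded cbox_interval] _ nn[unfolded cbox_interval]] b unfolding cbox_interval by simp
      then have "u 0 * w 0 = 0" using b by auto
      then show False using u(3)[of 0] z[of 0] b by (auto simp: w_def)
    qed
    moreover have "integral (cbox (-b) b) (\<lambda>x. u x * w x) \<ge> 0"
      by (rule integral_nonneg[OF integrable_continuous[OF c] nn])
    ultimately show ?thesis using eq by simp
  qed
  show ?thesis
  proof
    show "test_function a f" unfolding test_function_def using fu b by (intro conjI exI[of _ b]) (auto simp: f_def u(4))
    show "fourier_laplace f (of_real t) \<noteq> 0" if t: "\<bar>t\<bar> \<le> n" for t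
    proof -
      have "Re (exp (- \<i> * of_real t * of_real x)) > 0" if x: "\<bar>x\<bar> \<le> b" for x
      proof -
        have "\<bar>t * x\<bar> \<le> n * b" unfolding abs_mult using t x assms b by (intro mult_mono) auto
        then have "\<bar>t * x\<bar> < pi / 2" using b(3) pi_gt3 by (simp add: mult.commute)
        then have "cos (- (t * x)) > 0" by (intro cos_gt_zero_pi) (auto simp: abs_less_iff)
        then show ?thesis by (simp add: Re_exp)
      qed
      from pos[OF this] show ?thesis by auto
    qed
    have "Re (fourier_laplace f \<i>) > 0" by (rule pos) (simp add: Re_exp)
    then show "fourier_laplace f \<i> \<noteq> 0" by auto
  qed
qed

text \<open>The entire extensions of the elements of \<open>\<E>(a)\<close>, a space of Paley--Wiener type. The sequel
  relies on the closure and growth properties collected below.\<close>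

definition PW :: "real \<Rightarrow> (complex \<Rightarrow> complex) set" where
  "PW a = fourier_laplace ` {f. test_function a f}"

lemma fourier_space_eq: "a > 0 \<Longrightarrow> fourier_space a = (\<lambda>F t. F (of_real t)) ` PW a"
  unfolding fourier_space_def PW_def image_image test_functions_eq by (intro image_cong refl ext fourier_transform_eq)

lemma PW_entire: "F \<in> PW a \<Longrightarrow> F holomorphic_on UNIV"
  by (auto simp: PW_def fourier_laplace_entire)

lemma PW_growth: "F \<in> PW a \<Longrightarrow> \<exists>C\<ge>0. \<forall>z. cmod (F z) \<le> C * exp (a * \<bar>Im z\<bar>)"
  by (auto simp: PW_def fourier_laplace_growth)

lemma PW_mono: "F \<in> PW a \<Longrightarrow> a \<le> a' \<Longrightarrow> F \<in> PW a'"
  by (auto simp: PW_def intro: test_function_mono)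

lemma PW_linear_combination:
  assumes "F \<in> PW a" "G \<in> PW a"
  shows "(\<lambda>z. c * F z + d * G z) \<in> PW a"
proof -
  obtain f g where fg: "test_function a f" "F = fourier_laplace f" "test_function a g" "G = fourier_laplace g"
    using assms by (auto simp: PW_def)
  have "(\<lambda>z. c * F z + d * G z) = fourier_laplace (\<lambda>x. c * f x + d * g x)"
    using test_function_linear_combination(2)[OF fg(1,3)] fg by auto
  then show ?thesis using test_function_linear_combination(1)[OF fg(1,3)] by (auto simp: PW_def)
qed

lemma PW_scale: "F \<in> PW a \<Longrightarrow> (\<lambda>z. c * F z) \<in> PW a"
  using PW_linear_combination[of F a F c 0] by simp

lemma PW_times_z:
  assumes "F \<in> PW a"
  shows "(\<lambda>z. z * F z) \<in> PW a"
proof -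
  obtain f where f: "test_function a f" "F = fourier_laplace f" using assms by (auto simp: PW_def)
  have "(\<lambda>z. \<i> * z * F z) \<in> PW a"
    using test_function_vderiv[OF f(1)] f(2) by (auto simp: PW_def image_iff intro!: exI[of _ "vderiv f"])
  from PW_scale[OF this, of "- \<i>"] show ?thesis by (simp flip: mult.assoc)
qed

lemma PW_power_times: "F \<in> PW a \<Longrightarrow> (\<lambda>z. z ^ n * F z) \<in> PW a"
proof (induction n)
  case (Suc n)
  then show ?case using PW_times_z[of "\<lambda>z. z ^ n * F z" a] by (simp add: mult.assoc)
qed simp

lemma PW_reflect:
  assumes "F \<in> PW a"
  shows "(\<lambda>z. cnj (F (cnj z))) \<in> PW a"
proof -
  obtain f where f: "test_function a f" "F = fourier_laplace f" using assms by (auto simp: PW_def)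
  have "(\<lambda>z. cnj (F (cnj z))) = fourier_laplace (\<lambda>x. cnj (f (- x)))"
    using test_function_reflect(2)[OF f(1)] f(2) by auto
  then show ?thesis using test_function_reflect(1)[OF f(1)] by (auto simp: PW_def)
qed

lemma PW_mult:
  assumes "F \<in> PW a" "G \<in> PW b"
  shows "(\<lambda>z. F z * G z) \<in> PW (a + b)"
proof -
  obtain f g where fg: "test_function a f" "F = fourier_laplace f" "test_function b g" "G = fourier_laplace g"
    using assms by (auto simp: PW_def)
  have "(\<lambda>z. F z * G z) = fourier_laplace (convolution f g)"
    using test_function_convolution(2)[OF fg(1,3)] fg by auto
  then show ?thesis using test_function_convolution(1)[OF fg(1,3)] by (auto simp: PW_def)
qed

lemma PW_divide:
  assumes "F \<in> PW a" "F z = 0"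
  obtains G where "G \<in> PW a" "\<And>w. F w = (w - z) * G w"
proof -
  obtain f where f: "test_function a f" "F = fourier_laplace f" using assms by (auto simp: PW_def)
  obtain k where "test_function a k" "\<And>w. fourier_laplace f w = (w - z) * fourier_laplace k w"
    using test_function_divide[OF f(1)] assms(2) f(2) by metis
  then show ?thesis using that f(2) by (auto simp: PW_def)
qed

lemma PW_nonvanishing:
  assumes "a > 0" "n \<ge> 0"
  obtains F where "F \<in> PW a" "\<And>t. \<bar>t\<bar> \<le> n \<Longrightarrow> F (of_real t) \<noteq> 0" "F \<i> \<noteq> 0"
proof (rule test_function_nonvanishing[OF assms])
  fix f assume "test_function a f" "\<And>t. \<bar>t\<bar> \<le> n \<Longrightarrow> fourier_laplace f (of_real t) \<noteq> 0" "fourier_laplace f \<i> \<noteq> 0"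
  then show thesis by (intro that[of "fourier_laplace f"]) (auto simp: PW_def)
qed

lemma PW_decay: "F \<in> PW a \<Longrightarrow> \<exists>C\<ge>0. \<forall>t::real. (1 + \<bar>t\<bar>) ^ n * cmod (F (of_real t)) \<le> C"
proof (induction n arbitrary: F)
  case 0
  then obtain C where "C \<ge> 0" "\<And>z. cmod (F z) \<le> C * exp (a * \<bar>Im z\<bar>)" using PW_growth by blast
  from this(1) this(2)[of "of_real _"] show ?case by auto
next
  case (Suc n)
  obtain C where C: "C \<ge> 0" "\<And>t. (1 + \<bar>t\<bar>) ^ n * cmod (F (of_real t)) \<le> C" using Suc by blast
  obtain D where D: "D \<ge> 0" "\<And>t. (1 + \<bar>t\<bar>) ^ n * cmod (of_real t * F (of_real t)) \<le> D"
    using Suc.IH[OF PW_times_z[OF Suc.prems]] by blast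
  have "(1 + \<bar>t\<bar>) ^ Suc n * cmod (F (of_real t)) \<le> C + D" for t
    using C(2)[of t] D(2)[of t] by (simp add: norm_mult algebra_simps)
  then show ?case using C(1) D(1) by (intro exI[of _ "C + D"]) auto
qed

section \<open>A functional annihilating a non-dense subspace\<close>

definition sq_norm :: "real measure \<Rightarrow> (real \<Rightarrow> complex) \<Rightarrow> real" where
  "sq_norm \<mu> k = (\<integral>t. (cmod (k t))\<^sup>2 \<partial>\<mu>)"

definition inner_prod :: "real measure \<Rightarrow> (real \<Rightarrow> complex) \<Rightarrow> (real \<Rightarrow> complex) \<Rightarrow> complex" where
  "inner_prod \<mu> k l = (\<integral>t. k t * cnj (l t) \<partial>\<mu>)"

lemma L2_functions_iff:
  "k \<in> L2_functions \<mu> \<longleftrightarrow> k \<in> borel_measurable \<mu> \<and> integrable \<mu> (\<lambda>t. (cmod (k t))\<^sup>2)"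
  by (auto simp: L2_functions_def integrable_iff_bounded)

lemma nn_integral_sq_norm:
  "k \<in> L2_functions \<mu> \<Longrightarrow> (\<integral>\<^sup>+ t. ennreal ((cmod (k t))\<^sup>2) \<partial>\<mu>) = ennreal (sq_norm \<mu> k)"
  unfolding sq_norm_def by (rule nn_integral_eq_integral) (auto simp: L2_functions_iff)

lemma sq_norm_nonneg: "sq_norm \<mu> k \<ge> 0"
  by (simp add: sq_norm_def)

lemma L2_linear_combination:
  assumes "k \<in> L2_functions \<mu>" "l \<in> L2_functions \<mu>"
  shows "(\<lambda>t. c * k t + d * l t) \<in> L2_functions \<mu>"
proof -
  have [measurable]: "k \<in> borel_measurable \<mu>" "l \<in> borel_measurable \<mu>" using assms by (auto simp: L2_functions_iff)
  have "integrable \<mu> (\<lambda>t. (cmod (c * k t + d * l t))\<^sup>2)"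
  proof (rule Bochner_Integration.integrable_bound)
    show "integrable \<mu> (\<lambda>t. 2 * (cmod c)\<^sup>2 * (cmod (k t))\<^sup>2 + 2 * (cmod d)\<^sup>2 * (cmod (l t))\<^sup>2)"
      using assms by (intro Bochner_Integration.integrable_add integrable_mult_right) (auto simp: L2_functions_iff)
    have "(cmod (c * k t + d * l t))\<^sup>2 \<le> 2 * (cmod c)\<^sup>2 * (cmod (k t))\<^sup>2 + 2 * (cmod d)\<^sup>2 * (cmod (l t))\<^sup>2" for t
    proof -
      have "(cmod (c * k t + d * l t))\<^sup>2 \<le> (cmod (c * k t) + cmod (d * l t))\<^sup>2"
        by (intro power_mono norm_triangle_ineq) auto
      also have "\<dots> \<le> 2 * (cmod (c * k t))\<^sup>2 + 2 * (cmod (d * l t))\<^sup>2"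
        using sum_squares_bound[of "cmod (c * k t)" "cmod (d * l t)"] by (simp add: power2_sum)
      finally show ?thesis by (simp add: norm_mult power_mult_distrib)
    qed
    then show "AE t in \<mu>. norm ((cmod (c * k t + d * l t))\<^sup>2) \<le> norm (2 * (cmod c)\<^sup>2 * (cmod (k t))\<^sup>2 + 2 * (cmod d)\<^sup>2 * (cmod (l t))\<^sup>2)"
      by (auto intro: order_trans[OF _ abs_ge_self])
  qed measurable
  then show ?thesis by (simp add: L2_functions_iff)
qed

lemma L2_diff:
  "k \<in> L2_functions \<mu> \<Longrightarrow> l \<in> L2_functions \<mu> \<Longrightarrow> (\<lambda>t. k t - l t) \<in> L2_functions \<mu>"
  using L2_linear_combination[of k \<mu> l 1 "-1"] by simp

lemma L2_scale: "k \<in> L2_functions \<mu> \<Longrightarrow> (\<lambda>t. c * k t) \<in> L2_functions \<mu>"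
  using L2_linear_combination[of k \<mu> k c 0] by simp

lemma L2_product_integrable:
  assumes "k \<in> L2_functions \<mu>" "l \<in> L2_functions \<mu>"
  shows "integrable \<mu> (\<lambda>t. k t * cnj (l t))"
proof -
  have [measurable]: "k \<in> borel_measurable \<mu>" "l \<in> borel_measurable \<mu>" using assms by (auto simp: L2_functions_iff)
  show ?thesis
  proof (rule Bochner_Integration.integrable_bound)
    show "integrable \<mu> (\<lambda>t. (cmod (k t))\<^sup>2 + (cmod (l t))\<^sup>2)"
      using assms by (intro Bochner_Integration.integrable_add) (auto simp: L2_functions_iff)
    have "cmod (k t * cnj (l t)) \<le> (cmod (k t))\<^sup>2 + (cmod (l t))\<^sup>2" for t
    proof -
      have "0 \<le> cmod (k t) * cmod (l t)" by simp
      then show ?thesis using sum_squares_bound[of "cmod (k t)" "cmod (l t)"]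
        unfolding norm_mult complex_mod_cnj by linarith
    qed
    then show "AE t in \<mu>. norm (k t * cnj (l t)) \<le> norm ((cmod (k t))\<^sup>2 + (cmod (l t))\<^sup>2)" by simp
    have "(\<lambda>t. cnj (l t)) \<in> borel_measurable \<mu>"
      by (rule measurable_compose[OF _ borel_measurable_continuous_onI[OF continuous_on_cnj[OF continuous_on_id]]]) measurable
    then show "(\<lambda>t. k t * cnj (l t)) \<in> borel_measurable \<mu>" by measurable
  qed
qed

lemma inner_prod_linear_left:
  assumes "k \<in> L2_functions \<mu>" "l \<in> L2_functions \<mu>" "m \<in> L2_functions \<mu>"
  shows "inner_prod \<mu> (\<lambda>t. c * k t + d * l t) m = c * inner_prod \<mu> k m + d * inner_prod \<mu> l m"
  unfolding inner_prod_def using L2_product_integrable[OF assms(1,3)] L2_product_integrable[OF assms(2,3)]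
  by (simp add: distrib_right mult.assoc)

lemma inner_prod_diff_right:
  assumes "k \<in> L2_functions \<mu>" "l \<in> L2_functions \<mu>" "m \<in> L2_functions \<mu>"
  shows "inner_prod \<mu> k (\<lambda>t. l t - m t) = inner_prod \<mu> k l - inner_prod \<mu> k m"
  unfolding inner_prod_def using L2_product_integrable[OF assms(1,2)] L2_product_integrable[OF assms(1,3)]
  by (simp add: right_diff_distrib)

lemma discriminant_bound:
  fixes A B C :: real
  assumes "\<And>s. 0 \<le> A - 2 * s * B + s\<^sup>2 * C" "C \<ge> 0"
  shows "B\<^sup>2 \<le> A * C"
proof (cases "C = 0")
  case True
  have "B = 0"
  proof (rule ccontr)
    assume "B \<noteq> 0"
    then show False using assms(1)[of "(A + 1) / (2 * B)"] True by simp
  qed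
  then show ?thesis using True by simp
next
  case False
  then have C: "C > 0" using assms(2) by simp
  have "0 \<le> A - 2 * (B / C) * B + (B / C)\<^sup>2 * C" by (rule assms(1))
  then have "0 \<le> (A - 2 * (B / C) * B + (B / C)\<^sup>2 * C) * C" using C by simp
  also have "\<dots> = A * C - B\<^sup>2" using C by (simp add: field_simps power2_eq_square)
  finally show ?thesis by simp
qed

lemma sq_norm_linear_combination:
  assumes "k \<in> L2_functions \<mu>" "l \<in> L2_functions \<mu>"
  shows "sq_norm \<mu> (\<lambda>t. k t - c * l t) = sq_norm \<mu> k - 2 * Re (cnj c * inner_prod \<mu> k l) + (cmod c)\<^sup>2 * sq_norm \<mu> l"
proof -
  have i: "integrable \<mu> (\<lambda>t. (cmod (k t))\<^sup>2)" "integrable \<mu> (\<lambda>t. (cmod (l t))\<^sup>2)"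
    using assms by (auto simp: L2_functions_iff)
  have p: "integrable \<mu> (\<lambda>t. cnj c * (k t * cnj (l t)))" by (intro integrable_mult_right L2_product_integrable assms)
  have "sq_norm \<mu> (\<lambda>t. k t - c * l t) = (\<integral>t. (cmod (k t))\<^sup>2 - 2 * Re (cnj c * (k t * cnj (l t))) + (cmod c)\<^sup>2 * (cmod (l t))\<^sup>2 \<partial>\<mu>)"
    unfolding sq_norm_def
  proof (intro Bochner_Integration.integral_cong refl)
    fix t
    have "(cmod (x - y))\<^sup>2 = (cmod x)\<^sup>2 - 2 * Re (x * cnj y) + (cmod y)\<^sup>2" for x y :: complex
      unfolding cmod_power2 by (simp add: power2_eq_square algebra_simps)
    from this[of "k t" "c * l t"]
    show "(cmod (k t - c * l t))\<^sup>2 = (cmod (k t))\<^sup>2 - 2 * Re (cnj c * (k t * cnj (l t))) + (cmod c)\<^sup>2 * (cmod (l t))\<^sup>2"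
      by (simp only: complex_cnj_mult norm_mult power_mult_distrib mult.left_commute)
  qed
  also have "\<dots> = sq_norm \<mu> k - 2 * Re (cnj c * inner_prod \<mu> k l) + (cmod c)\<^sup>2 * sq_norm \<mu> l"
  proof -
    have r: "integrable \<mu> (\<lambda>t. 2 * Re (cnj c * (k t * cnj (l t))))" by (intro integrable_mult_right integrable_Re p)
    have "(\<integral>t. 2 * Re (cnj c * (k t * cnj (l t))) \<partial>\<mu>) = 2 * Re (cnj c * inner_prod \<mu> k l)"
      unfolding inner_prod_def by (subst integral_mult_right_zero, subst integral_Re[OF p], subst integral_mult_right_zero) (rule refl)
    then show ?thesis using i r by (simp add: sq_norm_def)
  qed
  finally show ?thesis .
qed

lemma inner_prod_Cauchy_Schwarz:
  assumes "k \<in> L2_functions \<mu>" "l \<in> L2_functions \<mu>"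
  shows "(cmod (inner_prod \<mu> k l))\<^sup>2 \<le> sq_norm \<mu> k * sq_norm \<mu> l"
proof -
  define p where "p = inner_prod \<mu> k l"
  have pp: "cnj p * p = of_real ((cmod p)\<^sup>2)" using complex_norm_square[of p] by (simp add: mult.commute)
  have "((cmod p)\<^sup>2)\<^sup>2 \<le> sq_norm \<mu> k * ((cmod p)\<^sup>2 * sq_norm \<mu> l)"
  proof (rule discriminant_bound)
    fix s :: real
    have "0 \<le> sq_norm \<mu> (\<lambda>t. k t - (of_real s * p) * l t)" by (rule sq_norm_nonneg)
    also have "\<dots> = sq_norm \<mu> k - 2 * Re (cnj (of_real s * p) * p) + (cmod (of_real s * p))\<^sup>2 * sq_norm \<mu> l"
      unfolding p_def by (rule sq_norm_linear_combination[OF assms])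
    also have "Re (cnj (of_real s * p) * p) = s * (cmod p)\<^sup>2"
    proof -
      have "cnj (of_real s * p) * p = of_real (s * (cmod p)\<^sup>2)" using pp by (simp add: mult.assoc)
      then show ?thesis by (simp only: Re_complex_of_real)
    qed
    finally show "0 \<le> sq_norm \<mu> k - 2 * s * (cmod p)\<^sup>2 + s\<^sup>2 * ((cmod p)\<^sup>2 * sq_norm \<mu> l)"
      by (simp add: norm_mult power_mult_distrib mult_ac)
  qed (simp add: sq_norm_nonneg)
  then have "(cmod p)\<^sup>2 * (cmod p)\<^sup>2 \<le> (cmod p)\<^sup>2 * (sq_norm \<mu> k * sq_norm \<mu> l)"
    by (simp add: power2_eq_square mult_ac)
  then have "p \<noteq> 0 \<Longrightarrow> (cmod p)\<^sup>2 \<le> sq_norm \<mu> k * sq_norm \<mu> l"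
    by (subst (asm) mult_le_cancel_left_pos) auto
  then show ?thesis
    by (cases "p = 0") (auto simp: p_def[symmetric] sq_norm_nonneg)
qed

text \<open>This is orthogonal projection without an appeal to completeness. If \<open>v\<^sub>n \<in> V\<close> minimise the distance to
  \<open>g\<close>, the residuals \<open>w\<^sub>n = g - v\<^sub>n\<close> form a Cauchy sequence by the parallelogram law. Hence \<open>\<langle>k, w\<^sub>n\<rangle>\<close>
  converges for every \<open>k\<close>, and its limit is the functional.\<close>

lemma exists_annihilating_functional:
  assumes V: "V \<subseteq> L2_functions \<mu>" "V \<noteq> {}" and lin: "\<And>v w c d. v \<in> V \<Longrightarrow> w \<in> V \<Longrightarrow> (\<lambda>t. c * v t + d * w t) \<in> V"
    and nd: "\<not> dense_in_L2 V \<mu>"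
  obtains L K g where "g \<in> L2_functions \<mu>" "L g \<noteq> 0" "K > 0"
    "\<And>k l c d. k \<in> L2_functions \<mu> \<Longrightarrow> l \<in> L2_functions \<mu> \<Longrightarrow> L (\<lambda>t. c * k t + d * l t) = c * L k + d * L l"
    "\<And>k. k \<in> L2_functions \<mu> \<Longrightarrow> cmod (L k) \<le> K * sqrt (sq_norm \<mu> k)"
    "\<And>v. v \<in> V \<Longrightarrow> L v = (0::complex)"
proof -
  obtain g \<epsilon> where g: "g \<in> L2_functions \<mu>" and e: "\<epsilon> > 0"
    and far: "\<And>h. h \<in> V \<Longrightarrow> \<not> (\<integral>\<^sup>+ t. ennreal ((cmod (g t - h t))\<^sup>2) \<partial>\<mu>) < ennreal (\<epsilon>\<^sup>2)"
    using nd unfolding dense_in_L2_def by blast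
  have VL: "v \<in> L2_functions \<mu>" if "v \<in> V" for v using that V by blast
  define N where "N v = sq_norm \<mu> (\<lambda>t. g t - v t)" for v
  have gd: "(\<lambda>t. g t - v t) \<in> L2_functions \<mu>" if "v \<in> V" for v using L2_diff[OF g VL[OF that]] .
  have Nge: "\<epsilon>\<^sup>2 \<le> N v" if "v \<in> V" for v
    using far[OF that] nn_integral_sq_norm[OF gd[OF that]] e
    by (simp add: N_def not_less ennreal_le_iff sq_norm_nonneg)
  define d where "d = Inf (N ` V)"
  have bdd: "bdd_below (N ` V)" using Nge by (intro bdd_belowI2)
  have dle: "d \<le> N v" if "v \<in> V" for v unfolding d_def using that bdd by (intro cInf_lower) auto
  have d0: "d > 0"
  proof -
    have "\<epsilon>\<^sup>2 \<le> d" unfolding d_def using Nge V(2) by (intro cInf_greatest) auto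
    then show ?thesis using e by (smt (verit) zero_less_power)
  qed
  define \<delta> where "\<delta> n = 1 / real (Suc n)" for n
  have \<delta>: "\<delta> n > 0" "\<delta> n \<le> 1" for n by (auto simp: \<delta>_def)
  have \<delta>lim: "\<delta> \<longlonglongrightarrow> 0" unfolding \<delta>_def by (rule LIMSEQ_Suc[OF lim_1_over_n])
  have "\<exists>v\<in>V. N v < d + \<delta> n" for n
  proof (rule ccontr)
    assume "\<not> ?thesis"
    then have "d + \<delta> n \<le> Inf (N ` V)" using V(2) by (intro cInf_greatest) (auto simp: not_less)
    then have "d + \<delta> n \<le> d" by (simp add: d_def)
    then show False using \<delta>(1)[of n] by simp
  qed
  then obtain v where v: "\<And>n. v n \<in> V" "\<And>n. N (v n) < d + \<delta> n" by metis
  define w where "w n = (\<lambda>t. g t - v n t)" for n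
  have wL: "w n \<in> L2_functions \<mu>" for n unfolding w_def by (rule gd[OF v(1)])
  have Nw: "sq_norm \<mu> (w n) < d + \<delta> n" "d \<le> sq_norm \<mu> (w n)" for n
    using v(2)[of n] dle[OF v(1)[of n]] by (auto simp: N_def w_def)
  have wdL: "(\<lambda>t. w n t - w m t) \<in> L2_functions \<mu>" for n m by (rule L2_diff[OF wL wL])
  have cau: "sq_norm \<mu> (\<lambda>t. w n t - w m t) \<le> 2 * \<delta> n + 2 * \<delta> m" for n m
  proof -
    let ?h = "\<lambda>t. (1/2) * v n t + (1/2) * v m t"
    have h: "?h \<in> V" by (rule lin[OF v(1) v(1)])
    have a: "sq_norm \<mu> (\<lambda>t. w n t - 1 * w m t) = sq_norm \<mu> (w n) - 2 * Re (cnj 1 * inner_prod \<mu> (w n) (w m)) + (cmod 1)\<^sup>2 * sq_norm \<mu> (w m)"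
      by (rule sq_norm_linear_combination[OF wL wL])
    have b: "sq_norm \<mu> (\<lambda>t. w n t - (-1) * w m t) = sq_norm \<mu> (w n) - 2 * Re (cnj (-1) * inner_prod \<mu> (w n) (w m)) + (cmod (-1))\<^sup>2 * sq_norm \<mu> (w m)"
      by (rule sq_norm_linear_combination[OF wL wL])
    have "(\<lambda>t. w n t - (-1) * w m t) = (\<lambda>t. 2 * (g t - ?h t))" by (auto simp: w_def algebra_simps)
    then have "sq_norm \<mu> (\<lambda>t. w n t - (-1) * w m t) = (\<integral>t. (cmod 2)\<^sup>2 * (cmod (g t - ?h t))\<^sup>2 \<partial>\<mu>)"
      by (simp only: sq_norm_def norm_mult power_mult_distrib)
    then have "sq_norm \<mu> (\<lambda>t. w n t - (-1) * w m t) = 4 * N ?h"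
      by (simp only: integral_mult_right_zero sq_norm_def N_def) simp
    then have "sq_norm \<mu> (\<lambda>t. w n t - w m t) = 2 * sq_norm \<mu> (w n) + 2 * sq_norm \<mu> (w m) - 4 * N ?h" using a b by simp
    then show ?thesis using Nw(1)[of n] Nw(1)[of m] dle[OF h] by simp
  qed
  define a where "a k n = inner_prod \<mu> k (w n)" for k n
  have conv: "convergent (a k)" if k: "k \<in> L2_functions \<mu>" for k
  proof -
    have diff: "(cmod (a k n - a k m))\<^sup>2 \<le> sq_norm \<mu> k * (2 * \<delta> n + 2 * \<delta> m)" for n m
    proof -
      have "a k n - a k m = inner_prod \<mu> k (\<lambda>t. w n t - w m t)"
        unfolding a_def by (rule inner_prod_diff_right[OF k wL wL, symmetric])
      then have "(cmod (a k n - a k m))\<^sup>2 \<le> sq_norm \<mu> k * sq_norm \<mu> (\<lambda>t. w n t - w m t)"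
        using inner_prod_Cauchy_Schwarz[OF k wdL] by simp
      also have "\<dots> \<le> sq_norm \<mu> k * (2 * \<delta> n + 2 * \<delta> m)" by (intro mult_left_mono cau sq_norm_nonneg)
      finally show ?thesis .
    qed
    have "Cauchy (a k)"
    proof (rule metric_CauchyI)
      fix r :: real assume r: "r > 0"
      have "(\<lambda>n. sq_norm \<mu> k * (4 * \<delta> n)) \<longlonglongrightarrow> sq_norm \<mu> k * (4 * 0)" by (intro tendsto_intros \<delta>lim)
      then have "eventually (\<lambda>n. sq_norm \<mu> k * (4 * \<delta> n) < r\<^sup>2) sequentially"
        using r by (intro order_tendstoD(2)) auto
      then obtain M where "\<forall>n\<ge>M. sq_norm \<mu> k * (4 * \<delta> n) < r\<^sup>2" unfolding eventually_sequentially ..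
      then have M: "sq_norm \<mu> k * (4 * \<delta> M) < r\<^sup>2" by simp
      have "dist (a k m) (a k n) < r" if "M \<le> m" "M \<le> n" for m n
      proof -
        have "\<delta> m \<le> \<delta> M" "\<delta> n \<le> \<delta> M" using that by (auto simp: \<delta>_def frac_le)
        then have "sq_norm \<mu> k * (2 * \<delta> m + 2 * \<delta> n) \<le> sq_norm \<mu> k * (4 * \<delta> M)"
          by (intro mult_left_mono sq_norm_nonneg) auto
        then have "(cmod (a k m - a k n))\<^sup>2 < r\<^sup>2" using diff[of m n] M by linarith
        then have "cmod (a k m - a k n) < r" using r by (meson less_imp_le power_less_imp_less_base)
        then show ?thesis by (simp add: dist_norm)
      qed
      then show "\<exists>M. \<forall>m\<ge>M. \<forall>n\<ge>M. dist (a k m) (a k n) < r" by (intro exI[of _ M] allI impI)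
    qed
    then show ?thesis by (simp add: Cauchy_convergent_iff)
  qed
  define L where "L k = lim (a k)" for k
  have Llim: "a k \<longlonglongrightarrow> L k" if "k \<in> L2_functions \<mu>" for k
    using conv[OF that] by (simp add: L_def convergent_LIMSEQ_iff)
  have orth: "(cmod (a u n))\<^sup>2 \<le> sq_norm \<mu> u * \<delta> n" if u: "u \<in> V" for u n
  proof -
    define p where "p = inner_prod \<mu> (w n) u"
    have pp: "cnj p * p = of_real ((cmod p)\<^sup>2)" using complex_norm_square[of p] by (simp add: mult.commute)
    have "((cmod p)\<^sup>2)\<^sup>2 \<le> \<delta> n * ((cmod p)\<^sup>2 * sq_norm \<mu> u)"
    proof (rule discriminant_bound)
      fix s :: real
      let ?h = "\<lambda>t. 1 * v n t + (of_real s * p) * u t"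
      have "?h \<in> V" by (rule lin[OF v(1) u])
      from dle[OF this] have "d \<le> N ?h" .
      moreover have "(\<lambda>t. g t - ?h t) = (\<lambda>t. w n t - (of_real s * p) * u t)" by (auto simp: w_def)
      ultimately have "d \<le> sq_norm \<mu> (\<lambda>t. w n t - (of_real s * p) * u t)" by (simp add: N_def)
      also have "\<dots> = sq_norm \<mu> (w n) - 2 * Re (cnj (of_real s * p) * p) + (cmod (of_real s * p))\<^sup>2 * sq_norm \<mu> u"
        unfolding p_def by (rule sq_norm_linear_combination[OF wL VL[OF u]])
      also have "Re (cnj (of_real s * p) * p) = s * (cmod p)\<^sup>2"
      proof -
        have "cnj (of_real s * p) * p = of_real (s * (cmod p)\<^sup>2)" using pp by (simp add: mult.assoc)
        then show ?thesis by (simp only: Re_complex_of_real)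
      qed
      finally show "0 \<le> \<delta> n - 2 * s * (cmod p)\<^sup>2 + s\<^sup>2 * ((cmod p)\<^sup>2 * sq_norm \<mu> u)"
        using Nw(1)[of n] by (simp add: norm_mult power_mult_distrib mult_ac)
    qed (simp add: sq_norm_nonneg)
    then have "(cmod p)\<^sup>2 * (cmod p)\<^sup>2 \<le> (cmod p)\<^sup>2 * (sq_norm \<mu> u * \<delta> n)"
      by (simp add: power2_eq_square mult_ac)
    then have "p \<noteq> 0 \<Longrightarrow> (cmod p)\<^sup>2 \<le> sq_norm \<mu> u * \<delta> n"
      by (subst (asm) mult_le_cancel_left_pos) auto
    then have "(cmod p)\<^sup>2 \<le> sq_norm \<mu> u * \<delta> n"
      using \<delta>(1)[of n] by (cases "p = 0") (auto simp: sq_norm_nonneg)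
    moreover have "a u n = cnj p" unfolding a_def p_def inner_prod_def
      by (simp add: mult.commute flip: Bochner_Integration.integral_cnj)
    ultimately show ?thesis by simp
  qed
  have L_V: "L u = 0" if u: "u \<in> V" for u
  proof -
    have "(\<lambda>n. sq_norm \<mu> u * \<delta> n) \<longlonglongrightarrow> sq_norm \<mu> u * 0" by (intro tendsto_intros \<delta>lim)
    then have "(\<lambda>n. (cmod (a u n))\<^sup>2) \<longlonglongrightarrow> 0"
      using orth[OF u] by (intro Lim_null_comparison[of "\<lambda>n. (cmod (a u n))\<^sup>2" "\<lambda>n. sq_norm \<mu> u * \<delta> n"]) auto
    moreover have "(\<lambda>n. (cmod (a u n))\<^sup>2) \<longlonglongrightarrow> (cmod (L u))\<^sup>2" by (intro tendsto_intros Llim VL u)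
    ultimately have "(cmod (L u))\<^sup>2 = 0" by (rule LIMSEQ_unique[symmetric])
    then show ?thesis by simp
  qed
  have L_lin: "L (\<lambda>t. c * k t + d * l t) = c * L k + d * L l" if k: "k \<in> L2_functions \<mu>" and l: "l \<in> L2_functions \<mu>" for k l c d
  proof (rule LIMSEQ_unique)
    show "a (\<lambda>t. c * k t + d * l t) \<longlonglongrightarrow> L (\<lambda>t. c * k t + d * l t)" by (intro Llim L2_linear_combination k l)
    have "(\<lambda>n. c * a k n + d * a l n) \<longlonglongrightarrow> c * L k + d * L l" by (intro tendsto_intros Llim k l)
    moreover have "a (\<lambda>t. c * k t + d * l t) = (\<lambda>n. c * a k n + d * a l n)"
      by (intro ext) (simp add: a_def inner_prod_linear_left[OF k l wL])
    ultimately show "a (\<lambda>t. c * k t + d * l t) \<longlonglongrightarrow> c * L k + d * L l" by (simp only:)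
  qed
  have L_bd: "cmod (L k) \<le> sqrt (d + 1) * sqrt (sq_norm \<mu> k)" if k: "k \<in> L2_functions \<mu>" for k
  proof (rule LIMSEQ_le_const2)
    show "(\<lambda>n. cmod (a k n)) \<longlonglongrightarrow> cmod (L k)" by (intro tendsto_intros Llim k)
    have "cmod (a k n) \<le> sqrt (d + 1) * sqrt (sq_norm \<mu> k)" for n
    proof (rule power2_le_imp_le)
      have "(cmod (a k n))\<^sup>2 \<le> sq_norm \<mu> k * sq_norm \<mu> (w n)" unfolding a_def by (rule inner_prod_Cauchy_Schwarz[OF k wL])
      also have "\<dots> \<le> sq_norm \<mu> k * (d + 1)" using Nw(1)[of n] \<delta>(2)[of n] by (intro mult_left_mono sq_norm_nonneg) auto
      finally show "(cmod (a k n))\<^sup>2 \<le> (sqrt (d + 1) * sqrt (sq_norm \<mu> k))\<^sup>2"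
        using d0 sq_norm_nonneg[of \<mu> k] by (simp add: power_mult_distrib mult.commute)
    qed (use d0 sq_norm_nonneg in simp)
    then show "\<exists>N. \<forall>n\<ge>N. cmod (a k n) \<le> sqrt (d + 1) * sqrt (sq_norm \<mu> k)" by blast
  qed
  have L_g: "L g \<noteq> 0"
  proof
    assume Lg: "L g = 0"
    define M where "M = 2 * sq_norm \<mu> g + 2 * (d + 1)"
    have vM: "sq_norm \<mu> (v n) \<le> M" for n
    proof -
      have "(\<lambda>t. g t - 1 * w n t) = v n" "(\<lambda>t. g t - (-1) * w n t) = (\<lambda>t. g t + w n t)" by (auto simp: w_def)
      then have "sq_norm \<mu> (v n) = sq_norm \<mu> g - 2 * Re (inner_prod \<mu> g (w n)) + sq_norm \<mu> (w n)"
        "sq_norm \<mu> (\<lambda>t. g t + w n t) = sq_norm \<mu> g + 2 * Re (inner_prod \<mu> g (w n)) + sq_norm \<mu> (w n)"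
        using sq_norm_linear_combination[OF g wL, of 1 n] sq_norm_linear_combination[OF g wL, of "-1" n] by auto
      then show ?thesis using Nw(1)[of n] \<delta>(2)[of n] sq_norm_nonneg[of \<mu> "\<lambda>t. g t + w n t"] by (simp add: M_def)
    qed
    have lb: "d - sqrt (M * \<delta> n) \<le> Re (a g n)" for n
    proof -
      have "w n = (\<lambda>t. 1 * g t + (-1) * v n t)" by (auto simp: w_def)
      then have "inner_prod \<mu> (w n) (w n) = a g n - a (v n) n"
        using inner_prod_linear_left[OF g VL[OF v(1)[of n]] wL[of n], of 1 "-1"] by (simp add: a_def)
      moreover have "inner_prod \<mu> (w n) (w n) = of_real (sq_norm \<mu> (w n))"
      proof -
        have "inner_prod \<mu> (w n) (w n) = (\<integral>t. complex_of_real ((cmod (w n t))\<^sup>2) \<partial>\<mu>)"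
          unfolding inner_prod_def by (intro Bochner_Integration.integral_cong refl complex_norm_square[symmetric])
        then show ?thesis by (simp only: integral_complex_of_real sq_norm_def)
      qed
      ultimately have "a g n = of_real (sq_norm \<mu> (w n)) + a (v n) n" by (simp add: algebra_simps)
      then have "Re (a g n) = sq_norm \<mu> (w n) + Re (a (v n) n)" by simp
      moreover have "cmod (a (v n) n) \<le> sqrt (M * \<delta> n)"
      proof (rule real_le_rsqrt)
        have "(cmod (a (v n) n))\<^sup>2 \<le> sq_norm \<mu> (v n) * \<delta> n" by (rule orth[OF v(1)])
        also have "\<dots> \<le> M * \<delta> n" using \<delta>(1)[of n] by (intro mult_right_mono vM) auto
        finally show "(cmod (a (v n) n))\<^sup>2 \<le> M * \<delta> n" .
      qed
      moreover have "- cmod (a (v n) n) \<le> Re (a (v n) n)" using abs_Re_le_cmod[of "a (v n) n"] by linarith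
      ultimately show ?thesis using Nw(2)[of n] by linarith
    qed
    have "(\<lambda>n. d - sqrt (M * \<delta> n)) \<longlonglongrightarrow> d - sqrt (M * 0)" by (intro tendsto_intros \<delta>lim)
    moreover have "(\<lambda>n. Re (a g n)) \<longlonglongrightarrow> Re (L g)" by (intro tendsto_intros Llim g)
    ultimately have "d - sqrt (M * 0) \<le> Re (L g)" using lb by (intro LIMSEQ_le) auto
    then show False using Lg d0 by simp
  qed
  show ?thesis by (rule that[OF g L_g _ L_lin L_bd L_V]) (use d0 in auto)
qed

section \<open>Quotients of bounded analytic functions\<close>

lemma holomorphic_divide_out_zero:
  fixes g :: "complex \<Rightarrow> complex"
  assumes g: "g holomorphic_on S" and S: "open S" "connected S" "w \<in> S" and nz: "\<exists>z\<in>S. g z \<noteq> 0"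
  obtains n h where "h holomorphic_on S" "h w \<noteq> 0" "\<And>z. z \<in> S \<Longrightarrow> g z = (z - w) ^ n * h z"
proof -
  define n where "n = nat (zorder g w)"
  define p where "p = zor_poly g w"
  obtain r where r: "r > 0" "cball w r \<subseteq> S" "p holomorphic_on cball w r"
      "\<And>z. z \<in> cball w r \<Longrightarrow> g z = p z * (z - w) ^ n \<and> p z \<noteq> 0"
    using zorder_exist_zero[OF g S nz] unfolding n_def p_def by blast
  define h where "h z = (if z = w then p w else g z / (z - w) ^ n)" for z
  have 1: "h holomorphic_on (S - {w})"
  proof -
    have "(\<lambda>z. g z / (z - w) ^ n) holomorphic_on (S - {w})"
      using holomorphic_on_subset[OF g] by (intro holomorphic_intros) auto
    then show ?thesis by (rule holomorphic_transform) (auto simp: h_def)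
  qed
  have 2: "h holomorphic_on ball w r"
  proof -
    have "p holomorphic_on ball w r" using holomorphic_on_subset[OF r(3)] by auto
    then show ?thesis
    proof (rule holomorphic_transform)
      fix z assume "z \<in> ball w r"
      then have "z \<in> cball w r" by auto
      from r(4)[OF this] show "p z = h z" by (auto simp: h_def)
    qed
  qed
  have "h holomorphic_on ((S - {w}) \<union> ball w r)"
    using 1 2 S by (intro holomorphic_on_Un) auto
  moreover have "(S - {w}) \<union> ball w r = S" using r S by auto
  ultimately have hol: "h holomorphic_on S" by simp
  have hw: "h w \<noteq> 0" using r(4)[of w] r(1) by (auto simp: h_def)
  have "g z = (z - w) ^ n * h z" if "z \<in> S" for z
    using r(4)[of w] r(1) by (cases "z = w") (auto simp: h_def)
  with hol hw that show ?thesis by blast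
qed

text \<open>With \<open>g = exp q\<close> this is Harnack's inequality for the non-negative harmonic function \<open>- Re q\<close>,
  obtained from the Schwarz lemma for the Cayley transform \<open>s\<close> of \<open>- q\<close>. Adding \<open>e > 0\<close> makes the real
  part strictly positive, as needed for \<open>\<bar>s\<bar> < 1\<close>.\<close>

lemma Harnack_disc:
  fixes g :: "complex \<Rightarrow> complex"
  assumes g: "g holomorphic_on ball 0 1" and nz: "\<And>z. cmod z < 1 \<Longrightarrow> g z \<noteq> 0"
    and le: "\<And>z. cmod z < 1 \<Longrightarrow> cmod (g z) \<le> 1" and k: "exp (- k) \<le> cmod (g 0)" and z: "cmod \<zeta> < 1"
  shows "exp (- (k * ((1 + cmod \<zeta>) / (1 - cmod \<zeta>)))) \<le> cmod (g \<zeta>)"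
proof -
  obtain q where q: "q holomorphic_on ball 0 1" "\<And>z. z \<in> ball 0 1 \<Longrightarrow> g z = exp (q z)"
  proof (rule contractible_imp_holomorphic_log[OF g convex_imp_contractible])
    show "convex (ball (0::complex) 1)" by simp
    show "g z \<noteq> 0" if "z \<in> ball 0 1" for z using nz that by simp
  qed blast
  define H where "H = (1 + cmod \<zeta>) / (1 - cmod \<zeta>)"
  have H: "H > 0" using z by (auto simp: H_def divide_simps add_pos_nonneg)
  have Re_q: "Re (q z) \<le> 0" if "cmod z < 1" for z
    using le[OF that] q(2)[of z] that by auto
  have k0: "- k \<le> Re (q 0)" using k q(2)[of 0] by simp
  have main: "- Re (q \<zeta>) + e \<le> H * (- Re (q 0) + e)" if e: "e > 0" for e
  proof -
    define p where "p z = of_real e - q z" for z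
    define s where "s z = (p z - p 0) / (p z + cnj (p 0))" for z
    have Rp: "Re (p z) > 0" if "cmod z < 1" for z
      using Re_q[OF that] e by (auto simp: p_def)
    have den: "p z + cnj (p 0) \<noteq> 0" if "cmod z < 1" for z
    proof -
      have "Re (p z + cnj (p 0)) > 0" using Rp[OF that] Rp[of 0] by simp
      then show ?thesis by (metis less_irrefl zero_complex.simps(1))
    qed
    have hs: "s holomorphic_on ball 0 1"
      unfolding s_def p_def using den q(1)
      by (intro holomorphic_intros) (auto simp: p_def)
    have s0: "s 0 = 0" by (simp add: s_def)
    have sq: "(cmod (p z + cnj (p 0)))\<^sup>2 - (cmod (p z - p 0))\<^sup>2 = 4 * Re (p z) * Re (p 0)" for z
      unfolding cmod_power2 by (simp add: power2_eq_square algebra_simps)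
    have s1: "cmod (s z) < 1" if "cmod z < 1" for z
    proof -
      have "(cmod (p z - p 0))\<^sup>2 < (cmod (p z + cnj (p 0)))\<^sup>2"
        using sq[of z] Rp[OF that] Rp[of 0] by (simp add: mult_pos_pos algebra_simps)
      then have "cmod (p z - p 0) < cmod (p z + cnj (p 0))" by (rule power_less_imp_less_base) simp
      then show ?thesis using den[OF that] by (simp add: s_def norm_divide)
    qed
    have "cmod (s \<zeta>) \<le> cmod \<zeta>" using Schwarz_Lemma(1)[OF hs s0 s1 z] by simp
    then have a: "cmod (p \<zeta> - p 0) \<le> cmod \<zeta> * cmod (p \<zeta> + cnj (p 0))"
      using den[OF z] by (simp add: s_def norm_divide divide_simps)
    define X A Y r where "X = Re (p \<zeta>)" and "A = Re (p 0)" and "Y = Im (p \<zeta>) - Im (p 0)" and "r = cmod \<zeta>"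
    have XA: "X > 0" "A > 0" "0 \<le> r" "r < 1" using Rp[OF z] Rp[of 0] z by (auto simp: X_def A_def r_def)
    have "(cmod (p \<zeta> - p 0))\<^sup>2 \<le> (r * cmod (p \<zeta> + cnj (p 0)))\<^sup>2"
      using a by (intro power_mono) (auto simp: r_def)
    then have "(X - A)\<^sup>2 + Y\<^sup>2 \<le> r\<^sup>2 * ((X + A)\<^sup>2 + Y\<^sup>2)"
      by (simp add: cmod_power2 X_def A_def Y_def power_mult_distrib)
    moreover have "r\<^sup>2 * Y\<^sup>2 \<le> Y\<^sup>2" using XA by (simp add: mult_left_le_one_le power_le_one)
    ultimately have "(X - A)\<^sup>2 \<le> (r * (X + A))\<^sup>2" unfolding power_mult_distrib by (simp add: distrib_left)
    then have "X - A \<le> r * (X + A)" using XA by (intro power2_le_imp_le[of "X - A"]) auto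
    then have "X \<le> H * A" using XA by (simp add: H_def r_def[symmetric] field_simps)
    then show ?thesis by (simp add: X_def A_def p_def)
  qed
  have "- Re (q \<zeta>) \<le> H * (- Re (q 0))"
  proof (rule field_le_epsilon)
    fix e :: real assume e: "e > 0"
    have "- Re (q \<zeta>) \<le> H * (- Re (q 0) + e / H)" using main[of "e / H"] e H by (smt (verit) divide_pos_pos)
    also have "\<dots> = H * (- Re (q 0)) + e" using H by (simp add: right_diff_distrib)
    finally show "- Re (q \<zeta>) \<le> H * (- Re (q 0)) + e" .
  qed
  also have "\<dots> \<le> H * k" using k0 H by (intro mult_left_mono) auto
  finally have "- (k * H) \<le> Re (q \<zeta>)" by (simp add: mult.commute)
  then show ?thesis using q(2)[of \<zeta>] z by (simp add: H_def)
qed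

text \<open>If \<open>g\<close> has no zeros, Harnack's inequality bounds \<open>g\<close> from below, and \<open>\<bar>f g\<bar> \<le> 1\<close> does the rest.
  A zero of \<open>g\<close> is removed by division by the corresponding Blaschke factor: this keeps the moduli on the
  unit circle, hence both bounds by the maximum principle, and can only increase \<open>\<bar>g(0)\<bar>\<close>.\<close>

lemma quotient_bound_closed_disc:
  fixes f g :: "complex \<Rightarrow> complex"
  assumes R: "R > 1" and f: "f holomorphic_on ball 0 R" and g: "g holomorphic_on ball 0 R"
    and "\<And>z. cmod z \<le> 1 \<Longrightarrow> cmod (g z) \<le> 1"
    and "\<And>z. cmod z \<le> 1 \<Longrightarrow> cmod (f z * g z) \<le> 1"
    and "exp (- k) \<le> cmod (g 0)" and z: "cmod \<zeta> < 1"
  shows "cmod (f \<zeta>) \<le> exp (k * ((1 + cmod \<zeta>) / (1 - cmod \<zeta>)))"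
  using g assms(4-6)
proof (induction "card {z \<in> ball 0 1. g z = 0}" arbitrary: g rule: less_induct)
  case (less g)
  let ?Z = "{z \<in> ball 0 1. g z = 0}"
  have g0: "g 0 \<noteq> 0" using less.prems(4) by auto
  have fin': "finite {z \<in> cball 0 1. g z = 0}"
  proof (cases "g constant_on ball 0 R")
    case True
    then have "g z \<noteq> 0" if "z \<in> cball 0 1" for z
    proof -
      obtain c where "\<And>z. z \<in> ball 0 R \<Longrightarrow> g z = c" using True unfolding constant_on_def by auto
      then show ?thesis using g0 that R by auto
    qed
    then show ?thesis by (metis (mono_tags, lifting) Collect_empty_eq finite.emptyI)
  next
    case False
    show ?thesis
      by (rule holomorphic_compact_finite_zeros[OF less.prems(1)]) (use R False in auto)
  qed
  have fin: "finite ?Z" by (rule finite_subset[OF _ fin']) auto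
  show ?case
  proof (cases "?Z = {}")
    case True
    define H where "H = (1 + cmod \<zeta>) / (1 - cmod \<zeta>)"
    have nz: "g z \<noteq> 0" if "cmod z < 1" for z using True that by auto
    have gh: "g holomorphic_on ball 0 1"
      using less.prems(1) by (rule holomorphic_on_subset) (use R in auto)
    have "exp (- (k * H)) \<le> cmod (g \<zeta>)" unfolding H_def
      by (rule Harnack_disc[OF gh nz _ less.prems(4) z]) (use less.prems(2) in auto)
    then have "cmod (f \<zeta>) * exp (- (k * H)) \<le> cmod (f \<zeta>) * cmod (g \<zeta>)"
      by (intro mult_left_mono) auto
    also have "\<dots> \<le> 1" using less.prems(3)[of \<zeta>] z by (simp add: norm_mult)
    finally show ?thesis by (simp add: H_def[symmetric] exp_minus field_simps)
  next
    case False
    then obtain w where w: "cmod w < 1" "g w = 0" by auto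
    obtain n h where h: "h holomorphic_on ball 0 R" "h w \<noteq> 0" "\<And>z. z \<in> ball 0 R \<Longrightarrow> g z = (z - w) ^ n * h z"
    proof (rule holomorphic_divide_out_zero[OF less.prems(1), of w])
      show "\<exists>z\<in>ball 0 R. g z \<noteq> 0" using g0 R by (intro bexI[of _ 0]) auto
    qed (use R w in auto)
    \<comment> \<open>Replacing the factor \<open>z - w\<close> by \<open>1 - cnj w * z\<close>, which has the same modulus on the unit circle,
      divides out a Blaschke factor.\<close>
    define g1 where "g1 z = (1 - cnj w * z) ^ n * h z" for z
    have hol1: "g1 holomorphic_on ball 0 R" unfolding g1_def by (intro holomorphic_intros h)
    have Bl: "cmod (1 - cnj w * z) = cmod (z - w)" if "cmod z = 1" for z
    proof -
      have "z * cnj z = 1" using that complex_norm_square[of z] by simp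
      then have "1 - cnj w * z = z * cnj (z - w)" by (simp add: algebra_simps)
      then have "cmod (1 - cnj w * z) = cmod z * cmod (cnj (z - w))" by (simp only: norm_mult)
      then show ?thesis using that by (simp only: complex_mod_cnj mult_1)
    qed
    have eq: "cmod (g1 z) = cmod (g z)" if "cmod z = 1" for z
      using h(3)[of z] that R Bl[OF that] by (simp add: g1_def norm_mult norm_power)
    have max: "cmod (u z) \<le> 1" if "u holomorphic_on ball 0 R" "\<And>z. cmod z = 1 \<Longrightarrow> cmod (u z) \<le> 1" "cmod z \<le> 1" for u z
    proof (rule maximum_modulus_frontier[of u "cball 0 1"])
      show "u holomorphic_on interior (cball 0 1)" "continuous_on (closure (cball 0 1)) u"
        using holomorphic_on_subset[OF that(1)] R
        by (auto intro!: holomorphic_on_imp_continuous_on simp: subset_eq)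
    qed (use that in auto)
    have a: "cmod (g1 z) \<le> 1" if "cmod z \<le> 1" for z
      by (rule max[OF hol1 _ that]) (use eq less.prems(2) in auto)
    have b: "cmod (f z * g1 z) \<le> 1" if "cmod z \<le> 1" for z
    proof (rule max[OF _ _ that])
      show "(\<lambda>z. f z * g1 z) holomorphic_on ball 0 R" by (intro holomorphic_intros f hol1)
      show "cmod (f z * g1 z) \<le> 1" if "cmod z = 1" for z
        using less.prems(3)[of z] eq[OF that] that by (simp add: norm_mult)
    qed
    have "cmod (g 0) \<le> cmod (g1 0)"
    proof -
      have "cmod (g 0) = cmod w ^ n * cmod (h 0)" using h(3)[of 0] R by (simp add: norm_mult norm_power)
      also have "\<dots> \<le> 1 * cmod (h 0)" using w by (intro mult_right_mono power_le_one) auto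
      finally show ?thesis by (simp add: g1_def)
    qed
    then have c: "exp (- k) \<le> cmod (g1 0)" using less.prems(4) by linarith
    have nz1: "1 - cnj w * z \<noteq> 0" if "cmod z < 1" for z
    proof
      assume "1 - cnj w * z = 0"
      then have "cmod (cnj w * z) = 1" by simp
      then have "cmod w * cmod z = 1" by (simp add: norm_mult)
      moreover have "cmod w * cmod z < 1 * 1" by (rule mult_strict_mono) (use w that in auto)
      ultimately show False by simp
    qed
    have "{z \<in> ball 0 1. g1 z = 0} \<subset> ?Z"
    proof
      show "{z \<in> ball 0 1. g1 z = 0} \<subseteq> ?Z"
        using nz1 h(3) R by (auto simp: g1_def)
      have "w \<notin> {z \<in> ball 0 1. g1 z = 0}" using nz1[of w] w h(2) by (auto simp: g1_def)
      then show "{z \<in> ball 0 1. g1 z = 0} \<noteq> ?Z" using w by auto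
    qed
    then have "card {z \<in> ball 0 1. g1 z = 0} < card ?Z" by (rule psubset_card_mono[OF fin])
    then show ?thesis by (rule less.hyps[OF _ hol1 a b c])
  qed
qed

text \<open>Dilation by \<open>t < 1\<close> makes both functions holomorphic beyond the closed disc; then \<open>t\<close> tends to 1.\<close>

lemma quotient_bound_disc:
  fixes f g :: "complex \<Rightarrow> complex"
  assumes f: "f holomorphic_on ball 0 1" and g: "g holomorphic_on ball 0 1"
    and le: "\<And>z. cmod z < 1 \<Longrightarrow> cmod (g z) \<le> 1"
    and fg: "\<And>z. cmod z < 1 \<Longrightarrow> cmod (f z * g z) \<le> 1"
    and k: "exp (- k) \<le> cmod (g 0)" and z: "cmod \<zeta> < 1"
  shows "cmod (f \<zeta>) \<le> exp (k * ((1 + cmod \<zeta>) / (1 - cmod \<zeta>)))"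
proof -
  have *: "cmod (f \<zeta>) \<le> exp (k * ((1 + cmod \<zeta> / t) / (1 - cmod \<zeta> / t)))" if t: "cmod \<zeta> < t" "t < 1" for t
  proof -
    have t0: "t > 0" using t by (smt (verit) norm_ge_zero)
    have img: "(\<lambda>z. of_real t * z) ` ball 0 (1 / t) \<subseteq> ball (0::complex) 1"
      using t0 by (auto simp: norm_mult field_simps)
    have small: "cmod (of_real t * z) < 1" if "cmod z \<le> 1" for z :: complex
    proof -
      have "t * cmod z \<le> t" using that t0 by (simp add: mult_left_le)
      then have "t * cmod z < 1" using t(2) by linarith
      then show ?thesis using t0 by (simp add: norm_mult)
    qed
    have "cmod ((f \<circ> (\<lambda>z. of_real t * z)) (\<zeta> / of_real t)) \<le>
       exp (k * ((1 + cmod (\<zeta> / of_real t)) / (1 - cmod (\<zeta> / of_real t))))"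
    proof (rule quotient_bound_closed_disc[where R = "1 / t" and g = "g \<circ> (\<lambda>z. of_real t * z)"])
      show "f \<circ> (\<lambda>z. of_real t * z) holomorphic_on ball 0 (1 / t)"
        "g \<circ> (\<lambda>z. of_real t * z) holomorphic_on ball 0 (1 / t)"
        by (intro holomorphic_on_compose_gen[OF _ _ img] holomorphic_intros f g)+
    qed (use t t0 le[OF small] fg[OF small] k in \<open>auto simp: norm_divide\<close>)
    then show ?thesis using t0 by (simp add: norm_divide)
  qed
  have "((\<lambda>t. exp (k * ((1 + cmod \<zeta> / t) / (1 - cmod \<zeta> / t)))) \<longlongrightarrow> exp (k * ((1 + cmod \<zeta> / 1) / (1 - cmod \<zeta> / 1)))) (at_left 1)"
    by (intro tendsto_intros) (use z in auto)
  moreover have "eventually (\<lambda>t. cmod (f \<zeta>) \<le> exp (k * ((1 + cmod \<zeta> / t) / (1 - cmod \<zeta> / t)))) (at_left 1)"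
    using eventually_at_left_real[OF z] by eventually_elim (use * in auto)
  ultimately have "cmod (f \<zeta>) \<le> exp (k * ((1 + cmod \<zeta> / 1) / (1 - cmod \<zeta> / 1)))"
    by (rule tendsto_lowerbound) auto
  then show ?thesis by simp
qed

text \<open>The Cayley map \<open>m\<close> takes the disc to the half-plane and 0 to \<open>z0\<close>; \<open>\<zeta>\<close> is the preimage of \<open>z\<close>, and
  \<open>(1 + \<bar>\<zeta>\<bar>) / (1 - \<bar>\<zeta>\<bar>) \<le> 4 / (1 - \<bar>\<zeta>\<bar>\<^sup>2)\<close> is a rational expression in \<open>z\<close> and \<open>z0\<close>.\<close>

lemma quotient_bound_half_plane:
  fixes f g :: "complex \<Rightarrow> complex"
  assumes f: "f holomorphic_on {z. Im z > s}" and g: "g holomorphic_on {z. Im z > s}"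
    and le: "\<And>z. Im z > s \<Longrightarrow> cmod (g z) \<le> 1"
    and fg: "\<And>z. Im z > s \<Longrightarrow> cmod (f z * g z) \<le> A" and A: "A > 0"
    and k: "exp (- k) \<le> cmod (g z0)" "k \<ge> 0" and z0: "Im z0 > s" and z: "Im z > s" and s: "s \<ge> 0"
  shows "cmod (f z) \<le> A * exp (k * ((cmod z + cmod z0)\<^sup>2 / ((Im z - s) * (Im z0 - s))))"
proof -
  define b where "b = Im z0 - s"
  define c where "c = Complex (Re z0) s"
  have b: "b > 0" using z0 by (simp add: b_def)
  define m where "m \<zeta> = c + \<i> * of_real b * (1 + \<zeta>) / (1 - \<zeta>)" for \<zeta>
  define w where "w = Complex (Re z0) (Im z0 - 2 * s)"
  have ne1: "1 - \<zeta> \<noteq> 0" if "cmod \<zeta> < 1" for \<zeta> using that by auto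
  have Imm: "Im (m \<zeta>) > s" if "cmod \<zeta> < 1" for \<zeta>
  proof -
    have pos: "(cmod (1 - \<zeta>))\<^sup>2 > 0" using ne1[OF that] by simp
    have "Re ((1 + \<zeta>) / (1 - \<zeta>)) = (1 - (cmod \<zeta>)\<^sup>2) / (cmod (1 - \<zeta>))\<^sup>2"
    proof -
      have "(cmod (1 - \<zeta>))\<^sup>2 = (1 - Re \<zeta>)\<^sup>2 + (Im \<zeta>)\<^sup>2" by (simp add: cmod_power2)
      moreover have "(cmod \<zeta>)\<^sup>2 = (Re \<zeta>)\<^sup>2 + (Im \<zeta>)\<^sup>2" by (simp add: cmod_power2)
      ultimately show ?thesis by (simp add: Re_divide power2_eq_square algebra_simps)
    qed
    also have "\<dots> > 0" using pos that by (intro divide_pos_pos) (auto simp: power_less_one_iff)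
    finally have "b * Re ((1 + \<zeta>) / (1 - \<zeta>)) > 0" using b by simp
    moreover have "Im (m \<zeta>) = s + b * Re ((1 + \<zeta>) / (1 - \<zeta>))"
    proof -
      have "m \<zeta> = c + \<i> * (of_real b * ((1 + \<zeta>) / (1 - \<zeta>)))" by (simp add: m_def)
      then show ?thesis by (simp only: plus_complex.simps Im_i_times Re_complex_of_real c_def complex.sel times_complex.simps Im_complex_of_real) simp
    qed
    ultimately show ?thesis by simp
  qed
  have m_hol: "m holomorphic_on ball 0 1"
    unfolding m_def using ne1 by (intro holomorphic_intros) auto
  have img: "m ` ball 0 1 \<subseteq> {z. Im z > s}" using Imm by auto
  define \<zeta> where "\<zeta> = (z - z0) / (z - cnj w)"
  have w: "cnj w = c - \<i> * of_real b" "z0 = c + \<i> * of_real b"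
    by (auto simp: w_def c_def b_def complex_eq_iff)
  have den: "z - cnj w \<noteq> 0"
  proof -
    have "Im (z - cnj w) > 0" using z z0 by (simp add: w_def)
    then show ?thesis by (metis less_irrefl zero_complex.simps(2))
  qed
  have sq: "(cmod (z - cnj w))\<^sup>2 - (cmod (z - z0))\<^sup>2 = 4 * (Im z - s) * b"
    unfolding cmod_power2 by (simp add: w_def b_def power2_eq_square algebra_simps)
  have \<zeta>1: "cmod \<zeta> < 1"
  proof -
    have "(cmod (z - z0))\<^sup>2 < (cmod (z - cnj w))\<^sup>2" proof -
      have "0 < 4 * (Im z - s) * b" using z b by (intro mult_pos_pos) auto
      then show ?thesis using sq by linarith
    qed
    then have "cmod (z - z0) < cmod (z - cnj w)" by (rule power_less_imp_less_base) simp
    then show ?thesis using den by (simp add: \<zeta>_def norm_divide)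
  qed
  have mz: "m \<zeta> = z"
  proof -
    have "1 + \<zeta> = 2 * (z - c) / (z - cnj w)" "1 - \<zeta> = 2 * (\<i> * of_real b) / (z - cnj w)"
      using den by (auto simp: \<zeta>_def w field_simps)
    then have "m \<zeta> = c + \<i> * of_real b * (2 * (z - c) / (z - cnj w)) / (2 * (\<i> * of_real b) / (z - cnj w))"
      by (simp only: m_def)
    also have "\<dots> = c + (z - c)" using den b by (simp add: field_simps)
    finally show ?thesis by simp
  qed
  have m0: "m 0 = z0" by (simp add: m_def w)
  have "cmod (((\<lambda>z. f z / of_real A) \<circ> m) \<zeta>) \<le> exp (k * ((1 + cmod \<zeta>) / (1 - cmod \<zeta>)))"
  proof (rule quotient_bound_disc[where g = "g \<circ> m"])
    show "((\<lambda>z. f z / of_real A) \<circ> m) holomorphic_on ball 0 1" "(g \<circ> m) holomorphic_on ball 0 1"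
      using A by (intro holomorphic_on_compose_gen[OF m_hol _ img] holomorphic_intros f g; simp)+
    show "exp (- k) \<le> cmod ((g \<circ> m) 0)" using k m0 by simp
  qed (use Imm le fg A \<zeta>1 in \<open>auto simp: norm_mult norm_divide\<close>)
  then have "cmod (f z) \<le> A * exp (k * ((1 + cmod \<zeta>) / (1 - cmod \<zeta>)))"
    using A mz by (simp add: norm_divide field_simps)
  also have "(1 + cmod \<zeta>) / (1 - cmod \<zeta>) \<le> (cmod z + cmod z0)\<^sup>2 / ((Im z - s) * (Im z0 - s))"
  proof -
    have "1 - (cmod \<zeta>)\<^sup>2 = 4 * (Im z - s) * b / (cmod (z - cnj w))\<^sup>2"
      using sq den by (simp add: \<zeta>_def norm_divide power_divide field_simps)
    moreover have "(1 + cmod \<zeta>) / (1 - cmod \<zeta>) = (1 + cmod \<zeta>)\<^sup>2 / (1 - (cmod \<zeta>)\<^sup>2)"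
    proof -
      have "1 - (cmod \<zeta>)\<^sup>2 = (1 - cmod \<zeta>) * (1 + cmod \<zeta>)" by (simp add: power2_eq_square algebra_simps)
      moreover have "1 + cmod \<zeta> \<noteq> 0" by (smt (verit) norm_ge_zero)
      ultimately show ?thesis by (simp add: power2_eq_square)
    qed
    moreover have "(1 + cmod \<zeta>)\<^sup>2 \<le> 2\<^sup>2" using \<zeta>1 by (intro power_mono) auto
    ultimately have "(1 + cmod \<zeta>) / (1 - cmod \<zeta>) \<le> 4 / (4 * (Im z - s) * b / (cmod (z - cnj w))\<^sup>2)"
      using z b by (auto intro!: divide_right_mono mult_right_mono)
    also have "\<dots> = (cmod (z - cnj w))\<^sup>2 / ((Im z - s) * b)" using z b by (simp add: field_simps)
    also have "\<dots> \<le> (cmod z + cmod z0)\<^sup>2 / ((Im z - s) * b)"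
    proof -
      have "cmod w \<le> cmod z0"
      proof (rule power2_le_imp_le)
        have "(Im z0 - 2 * s)\<^sup>2 \<le> (Im z0)\<^sup>2"
        proof -
          have "0 \<le> 4 * s * (Im z0 - s)" using s z0 by simp
          then show ?thesis by (simp add: power2_eq_square algebra_simps)
        qed
        then show "(cmod w)\<^sup>2 \<le> (cmod z0)\<^sup>2" by (simp add: cmod_power2 w_def)
      qed auto
      then have "cmod (z - cnj w) \<le> cmod z + cmod z0" using norm_triangle_ineq4[of z "cnj w"] by simp
      then show ?thesis using z b by (intro divide_right_mono power_mono) auto
    qed
    finally show ?thesis by (simp add: b_def)
  qed
  finally show ?thesis using k A by (auto simp: mult_left_mono)
qed

section \<open>Crossing the real axis\<close>

text \<open>The cone \<open>2 \<bar>Im w\<bar> \<le> Re w\<close> has half-angle \<open>arctan (1 / 2) < \<pi> / 4\<close>, so both \<open>1 / w\<close> and \<open>1 / w\<^sup>2\<close> have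
  non-negative real parts there. This is why the rhombi below have sides of slope one half.\<close>

lemma Re_inverse_cone:
  assumes "2 * \<bar>Im w\<bar> \<le> Re w" "w \<noteq> 0"
  shows "0 \<le> Re (1 / w)" and "3 / (5 * (cmod w)\<^sup>2) \<le> Re (1 / w\<^sup>2)"
proof -
  have n: "(cmod w)\<^sup>2 = (Re w)\<^sup>2 + (Im w)\<^sup>2" by (simp add: cmod_power2)
  have pos: "(Re w)\<^sup>2 + (Im w)\<^sup>2 > 0" using assms(2) n by (metis zero_less_norm_iff zero_less_power)
  show "0 \<le> Re (1 / w)" using assms by (simp add: Re_divide)
  have sq: "4 * (Im w)\<^sup>2 \<le> (Re w)\<^sup>2"
  proof -
    have "(2 * \<bar>Im w\<bar>)\<^sup>2 \<le> (Re w)\<^sup>2" using assms by (intro power_mono) auto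
    then show ?thesis by (simp add: power_mult_distrib)
  qed
  have "Re (1 / w\<^sup>2) = ((Re w)\<^sup>2 - (Im w)\<^sup>2) / ((cmod w)\<^sup>2)\<^sup>2"
  proof -
    have "1 / w\<^sup>2 = cnj (w\<^sup>2) / ((cmod w)\<^sup>2)\<^sup>2"
    proof -
      have "w\<^sup>2 * cnj (w\<^sup>2) = of_real (((cmod w)\<^sup>2)\<^sup>2)"
        using complex_norm_square[of "w\<^sup>2"] by (simp only: norm_power)
      then show ?thesis using assms(2) by (simp add: field_simps)
    qed
    then have "Re (1 / w\<^sup>2) = Re (cnj (w\<^sup>2)) / ((cmod w)\<^sup>2)\<^sup>2"
      by (metis Re_divide_of_real of_real_power)
    then show ?thesis by (simp add: power2_eq_square)
  qed
  also have "\<dots> \<ge> (3 / 5 * (cmod w)\<^sup>2) / ((cmod w)\<^sup>2)\<^sup>2"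
    using sq n by (intro divide_right_mono) auto
  finally show "3 / (5 * (cmod w)\<^sup>2) \<le> Re (1 / w\<^sup>2)"
    using assms(2) by (simp add: power2_eq_square)
qed

lemma Re_inverse_cone_boundary:
  assumes "Re w = 2 * \<bar>Im w\<bar>" "Im w \<noteq> 0"
  shows "Re (1 / w) = 2 / (5 * \<bar>Im w\<bar>)" and "3 / (25 * (Im w)\<^sup>2) \<le> Re (1 / w\<^sup>2)"
proof -
  have n: "(cmod w)\<^sup>2 = 5 * (Im w)\<^sup>2" using assms by (simp add: cmod_power2 power_mult_distrib)
  have "Re (1 / w) = Re w / (cmod w)\<^sup>2" by (simp add: Re_divide cmod_power2)
  also have "\<dots> = 2 * \<bar>Im w\<bar> / (5 * (\<bar>Im w\<bar> * \<bar>Im w\<bar>))" using n assms by (simp add: power2_eq_square)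
  also have "\<dots> = 2 / (5 * \<bar>Im w\<bar>)" using assms(2) by (simp add: divide_simps)
  finally show "Re (1 / w) = 2 / (5 * \<bar>Im w\<bar>)" .
  have "w \<noteq> 0" using assms by auto
  then show "3 / (25 * (Im w)\<^sup>2) \<le> Re (1 / w\<^sup>2)"
    using Re_inverse_cone(2)[of w] assms n by simp
qed

text \<open>On the sides of the rhombus the assumed bound explodes only at the vertices \<open>p\<close> and \<open>q\<close> on the real axis.
  The exponent \<open>e\<close> has poles of orders one and two there, with residue constants \<open>M1\<close> and \<open>M2\<close> chosen such that
  \<open>Re (e z)\<close> is at least \<open>K1 / \<bar>Im z\<bar> + K2 / (Im z)\<^sup>2\<close> on the sides. The product \<open>F exp (- e)\<close> tends to zero
  at the vertices, so the maximum principle applies to it, while near the centre \<open>e\<close> is of size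
  \<open>K1 / r + K2 / r\<^sup>2\<close>.\<close>

lemma rhombus_bound:
  fixes F :: "complex \<Rightarrow> complex"
  assumes F: "F holomorphic_on UNIV" and r: "r > 0" and K: "K1 \<ge> 0" "K2 > 0" and A: "A \<ge> 0"
    and bd: "\<And>z. \<bar>Re z - x\<bar> + 2 * \<bar>Im z\<bar> = r \<Longrightarrow> Im z \<noteq> 0 \<Longrightarrow>
               cmod (F z) \<le> A * exp (K1 / \<bar>Im z\<bar> + K2 / (Im z)\<^sup>2)"
    and z: "cmod (z - of_real x) \<le> r / 4"
  shows "cmod (F z) \<le> A * exp (7 * K1 / r + 30 * K2 / r\<^sup>2)"
proof -
  define p q :: complex where "p = of_real (x + r)" and "q = of_real (x - r)"
  \<comment> \<open>The reciprocals of the constants in \<open>Re_inverse_cone_boundary\<close>.\<close>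
  define M1 M2 where "M1 = 5 * K1 / 2" and "M2 = 25 * K2 / 3"
  have M: "M1 \<ge> 0" "M2 > 0" using K by (auto simp: M1_def M2_def)
  define e where "e z = of_real M1 * (1 / (p - z) + 1 / (z - q)) + of_real M2 * (1 / (p - z)\<^sup>2 + 1 / (z - q)\<^sup>2)" for z
  define G where "G z = (if z = p \<or> z = q then 0 else F z * exp (- e z))" for z
  define S where "S = {z. \<bar>Re z - x\<bar> + 2 * \<bar>Im z\<bar> \<le> r}"
  have Re_e: "Re (e z) = M1 * (Re (1 / (p - z)) + Re (1 / (z - q))) + M2 * (Re (1 / (p - z)\<^sup>2) + Re (1 / (z - q)\<^sup>2))" for z
    by (simp add: e_def Re_divide_of_real)
  have cone: "2 * \<bar>Im (p - z)\<bar> \<le> Re (p - z)" "2 * \<bar>Im (z - q)\<bar> \<le> Re (z - q)" if "z \<in> S" for z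
    using that by (auto simp: S_def p_def q_def)
  have bS: "bounded S"
  proof (rule boundedI)
    fix z assume "z \<in> S"
    then show "norm z \<le> \<bar>x\<bar> + 2 * r" using cmod_le[of z] by (auto simp: S_def)
  qed
  have cS: "closed S" unfolding S_def by (intro closed_Collect_le continuous_intros)
  have comp: "compact S" using bS cS by (simp add: compact_eq_bounded_closed)
  obtain B where B: "B > 0" "\<And>z. z \<in> S \<Longrightarrow> cmod (F z) \<le> B"
  proof -
    have "bounded (F ` S)"
      using compact_continuous_image[OF holomorphic_on_imp_continuous_on[OF holomorphic_on_subset[OF F]] comp]
      by (simp add: compact_imp_bounded)
    then show ?thesis using that unfolding bounded_pos by auto
  qed
  have nonneg: "0 \<le> Re (1 / (p - z))" "0 \<le> Re (1 / (z - q))" "0 \<le> Re (1 / (p - z)\<^sup>2)" "0 \<le> Re (1 / (z - q)\<^sup>2)"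
    if "z \<in> S" "z \<noteq> p" "z \<noteq> q" for z
  proof -
    have "p - z \<noteq> 0" "z - q \<noteq> 0" using that by auto
    note * = Re_inverse_cone[OF cone(1)[OF that(1)] this(1)] Re_inverse_cone[OF cone(2)[OF that(1)] this(2)]
    have "0 \<le> 3 / (5 * (cmod (p - z))\<^sup>2)" "0 \<le> 3 / (5 * (cmod (z - q))\<^sup>2)" by auto
    with * show "0 \<le> Re (1 / (p - z))" "0 \<le> Re (1 / (z - q))" "0 \<le> Re (1 / (p - z)\<^sup>2)" "0 \<le> Re (1 / (z - q)\<^sup>2)"
      by linarith+
  qed
  have small: "cmod (G z) \<le> B * (5 / (3 * M2)) * (cmod (z - v))\<^sup>2" if "z \<in> S" "v = p \<or> v = q" for z v
  proof (cases "z = p \<or> z = q")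
    case True then show ?thesis using B(1) M by (auto simp: G_def)
  next
    case False
    then have ne: "p - z \<noteq> 0" "z - q \<noteq> 0" "z \<noteq> v" using that by auto
    note * = Re_inverse_cone[OF cone(1)[OF that(1)] ne(1)] Re_inverse_cone[OF cone(2)[OF that(1)] ne(2)]
    note nn = nonneg[OF that(1)] 
    have "3 / (5 * (cmod (z - v))\<^sup>2) \<le> Re (1 / (p - z)\<^sup>2) + Re (1 / (z - q)\<^sup>2)"
      using * nn False that(2) by (auto simp: norm_minus_commute)
    then have "M2 * (3 / (5 * (cmod (z - v))\<^sup>2)) \<le> M2 * (Re (1 / (p - z)\<^sup>2) + Re (1 / (z - q)\<^sup>2))"
      using M by (intro mult_left_mono) auto
    moreover have "0 \<le> M1 * (Re (1 / (p - z)) + Re (1 / (z - q)))" using M nn False by simp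
    ultimately have t: "M2 * (3 / (5 * (cmod (z - v))\<^sup>2)) \<le> Re (e z)" unfolding Re_e by linarith
    define t where "t = M2 * (3 / (5 * (cmod (z - v))\<^sup>2))"
    have t0: "t > 0" using M ne(3) by (simp add: t_def)
    have "exp (- Re (e z)) \<le> exp (- t)" using t by (simp add: t_def)
    also have "\<dots> \<le> 1 / t"
    proof -
      have "t \<le> exp t" using exp_ge_add_one_self[of t] by linarith
      then show ?thesis using t0 by (simp add: exp_minus field_simps)
    qed
    also have "\<dots> = 5 / (3 * M2) * (cmod (z - v))\<^sup>2" using M ne(3) by (simp add: t_def field_simps)
    finally have "cmod (F z) * exp (- Re (e z)) \<le> B * (5 / (3 * M2) * (cmod (z - v))\<^sup>2)"
      using B(1) B(2)[OF that(1)] by (intro mult_mono) auto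
    then show ?thesis using False by (simp add: G_def norm_mult mult.assoc)
  qed
  have hol': "(\<lambda>z. F z * exp (- e z)) holomorphic_on - {p, q}"
    unfolding e_def by (intro holomorphic_intros holomorphic_on_subset[OF F]) auto
  have cont: "continuous_on S G"
    unfolding continuous_on_def
  proof
    fix v assume v: "v \<in> S"
    show "(G \<longlongrightarrow> G v) (at v within S)"
    proof (cases "v = p \<or> v = q")
      case True
      have "((\<lambda>z. B * (5 / (3 * M2)) * (cmod (z - v))\<^sup>2) \<longlongrightarrow> B * (5 / (3 * M2)) * (cmod (v - v))\<^sup>2) (at v within S)"
        by (intro tendsto_intros)
      then have "(G \<longlongrightarrow> 0) (at v within S)"
        using small True by (intro Lim_null_comparison[of G]) (auto simp: eventually_at_filter)
      then show ?thesis using True by (auto simp: G_def)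
    next
      case False
      have "((\<lambda>z. F z * exp (- e z)) has_field_derivative deriv (\<lambda>z. F z * exp (- e z)) v) (at v)"
        by (rule holomorphic_derivI[OF hol']) (use False in auto)
      then have "(\<lambda>z. F z * exp (- e z)) \<midarrow>v\<rightarrow> F v * exp (- e v)"
        using DERIV_isCont isCont_def by blast
      moreover have "eventually (\<lambda>z. F z * exp (- e z) = G z) (at v)"
      proof -
        have "eventually (\<lambda>z. z \<in> - {p, q}) (at v)"
          by (rule eventually_at_in_open') (use False in auto)
        then show ?thesis by eventually_elim (auto simp: G_def)
      qed
      ultimately have "G \<midarrow>v\<rightarrow> F v * exp (- e v)" using Lim_transform_eventually by blast
      then show ?thesis using False by (auto simp: G_def intro: tendsto_within_subset)
    qed
  qed
  have hol: "G holomorphic_on interior S"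
  proof -
    have "interior S \<subseteq> - {p, q}"
    proof
      fix v assume "v \<in> interior S"
      then obtain d where d: "d > 0" "ball v d \<subseteq> S" by (meson mem_interior)
      have "v + of_real (d / 2) \<in> S" "v - of_real (d / 2) \<in> S" 
        using d by (auto intro!: subsetD[OF d(2)] simp: dist_norm norm_divide)
      then show "v \<in> - {p, q}" using d(1) by (auto simp: S_def p_def q_def)
    qed
    then have "(\<lambda>z. F z * exp (- e z)) holomorphic_on interior S" "interior S \<subseteq> - {p, q}"
      using holomorphic_on_subset[OF hol'] by auto
    then show ?thesis by (elim holomorphic_transform) (auto simp: G_def)
  qed
  have "cmod (G z) \<le> A"
  proof (rule maximum_modulus_frontier[OF hol _ bS])
    show "continuous_on (closure S) G" using cont cS by simp
    show "z \<in> S"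
    proof -
      have "\<bar>Re z - x\<bar> \<le> r / 4" "\<bar>Im z\<bar> \<le> r / 4"
        using abs_Re_le_cmod[of "z - of_real x"] abs_Im_le_cmod[of "z - of_real x"] z by auto
      then show ?thesis using r by (auto simp: S_def)
    qed
    fix v assume v: "v \<in> frontier S"
    have "open {z. \<bar>Re z - x\<bar> + 2 * \<bar>Im z\<bar> < r}" by (intro open_Collect_less continuous_intros)
    then have "{z. \<bar>Re z - x\<bar> + 2 * \<bar>Im z\<bar> < r} \<subseteq> interior S" by (intro interior_maximal) (auto simp: S_def)
    moreover have vS: "v \<in> S" and "v \<notin> interior S" using v cS by (auto simp: frontier_def)
    ultimately have "\<not> \<bar>Re v - x\<bar> + 2 * \<bar>Im v\<bar> < r" by blast
    with vS have vr: "\<bar>Re v - x\<bar> + 2 * \<bar>Im v\<bar> = r" by (simp add: S_def)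
    show "cmod (G v) \<le> A"
    proof (cases "Im v = 0")
      case True
      then have "v = p \<or> v = q" using vr by (auto simp: p_def q_def complex_eq_iff abs_if split: if_splits)
      then show ?thesis using A by (auto simp: G_def)
    next
      case False
      then have ne: "v \<noteq> p" "v \<noteq> q" by (auto simp: p_def q_def)
      note nn = nonneg[OF vS ne]
      have "2 / (5 * \<bar>Im v\<bar>) \<le> Re (1 / (p - v)) + Re (1 / (v - q)) \<and>
            3 / (25 * (Im v)\<^sup>2) \<le> Re (1 / (p - v)\<^sup>2) + Re (1 / (v - q)\<^sup>2)"
      proof (cases "Re v \<ge> x")
        case True
        have "Re (p - v) = 2 * \<bar>Im (p - v)\<bar>" "Im (p - v) \<noteq> 0" using True vr False by (auto simp: p_def)
        from Re_inverse_cone_boundary[OF this] show ?thesis using nn by (simp add: p_def)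
      next
        case F: False
        have "Re (v - q) = 2 * \<bar>Im (v - q)\<bar>" "Im (v - q) \<noteq> 0" using F vr False by (auto simp: q_def)
        from Re_inverse_cone_boundary[OF this] show ?thesis using nn by (simp add: q_def)
      qed
      then have "M1 * (2 / (5 * \<bar>Im v\<bar>)) + M2 * (3 / (25 * (Im v)\<^sup>2)) \<le> Re (e v)"
        unfolding Re_e using M by (intro add_mono mult_left_mono) auto
      moreover have "M1 * (2 / (5 * \<bar>Im v\<bar>)) = K1 / \<bar>Im v\<bar>" "M2 * (3 / (25 * (Im v)\<^sup>2)) = K2 / (Im v)\<^sup>2"
        by (simp_all add: M1_def M2_def field_simps)
      ultimately have le: "K1 / \<bar>Im v\<bar> + K2 / (Im v)\<^sup>2 \<le> Re (e v)" by linarith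
      have "cmod (G v) = cmod (F v) * exp (- Re (e v))" using ne by (simp add: G_def norm_mult)
      also have "\<dots> \<le> (A * exp (K1 / \<bar>Im v\<bar> + K2 / (Im v)\<^sup>2)) * exp (- (K1 / \<bar>Im v\<bar> + K2 / (Im v)\<^sup>2))"
        using bd[OF vr False] le A by (intro mult_mono) auto
      also have "\<dots> = A" by (simp only: exp_minus mult.assoc) (simp add: exp_not_eq_zero del: minus_add_distrib)
      finally show ?thesis .
    qed
  qed
  moreover have pz: "cmod (p - z) \<ge> r * (3/4)" "cmod (z - q) \<ge> r * (3/4)"
  proof -
    have "cmod (p - of_real x) = r" "cmod (of_real x - q) = r" using r by (auto simp: p_def q_def simp flip: of_real_diff)
    moreover have "cmod (p - of_real x) \<le> cmod (p - z) + cmod (z - of_real x)"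
      using norm_triangle_ineq[of "p - z" "z - of_real x"] by simp
    moreover have "cmod (of_real x - q) \<le> cmod (of_real x - z) + cmod (z - q)"
      using norm_triangle_ineq[of "of_real x - z" "z - q"] by simp
    moreover have "cmod (of_real x - z) = cmod (z - of_real x)" by (rule norm_minus_commute)
    ultimately show "cmod (p - z) \<ge> r * (3/4)" "cmod (z - q) \<ge> r * (3/4)" using z by linarith+
  qed
  ultimately have "cmod (F z) * exp (- Re (e z)) \<le> A" using r
    by (cases "z = p \<or> z = q") (auto simp: G_def norm_mult)
  then have 1: "cmod (F z) \<le> A * exp (Re (e z))" by (simp add: exp_minus field_simps)
  have inv: "Re (1 / w) \<le> 4 / (3 * r)" "Re (1 / w\<^sup>2) \<le> 16 / (9 * r\<^sup>2)" if "cmod w \<ge> r * (3/4)" for w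
  proof -
    have "Re (1 / w) \<le> 1 / cmod w" using complex_Re_le_cmod[of "1 / w"] by (simp add: norm_divide)
    have w0: "cmod w > 0" using that r by (smt (verit) mult_pos_pos zero_less_divide_iff)
    note \<open>Re (1 / w) \<le> 1 / cmod w\<close>
    also have "1 / cmod w \<le> 1 / (r * (3/4))" using that r w0 by (intro divide_left_mono) (auto intro!: mult_pos_pos intro: less_le_trans[of 0 "r*(3/4)"])
    finally show "Re (1 / w) \<le> 4 / (3 * r)" by simp
    have "Re (1 / w\<^sup>2) \<le> 1 / (cmod w)\<^sup>2" using complex_Re_le_cmod[of "1 / w\<^sup>2"] by (simp add: norm_divide norm_power)
    also have "\<dots> \<le> 1 / (r * (3/4))\<^sup>2"
    proof (rule divide_left_mono)
      show "(r * (3/4))\<^sup>2 \<le> (cmod w)\<^sup>2" using that r by (intro power_mono) auto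
      have "cmod w > 0" using that r by (smt (verit) mult_pos_pos zero_less_divide_iff)
      then show "0 < (cmod w)\<^sup>2 * (r * (3/4))\<^sup>2" using r by simp
    qed simp
    finally show "Re (1 / w\<^sup>2) \<le> 16 / (9 * r\<^sup>2)" by (simp add: power_mult_distrib power2_eq_square)
  qed
  have "Re (e z) \<le> M1 * (4 / (3 * r) + 4 / (3 * r)) + M2 * (16 / (9 * r\<^sup>2) + 16 / (9 * r\<^sup>2))"
    unfolding Re_e using M inv[OF pz(1)] inv[OF pz(2)] by (intro add_mono mult_left_mono) auto
  also have "\<dots> = (20 / 3) * (K1 / r) + (800 / 27) * (K2 / r\<^sup>2)" by (simp add: M1_def M2_def field_simps)
  also have "\<dots> \<le> 7 * (K1 / r) + 30 * (K2 / r\<^sup>2)"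
    using K r by (intro add_mono mult_right_mono) auto
  finally have "Re (e z) \<le> 7 * K1 / r + 30 * K2 / r\<^sup>2" by simp
  with 1 A show ?thesis by (smt (verit) exp_le_cancel_iff mult_left_mono)
qed

abbreviation off_axis_exponent :: "real \<Rightarrow> real \<Rightarrow> real \<Rightarrow> complex \<Rightarrow> real" where
  "off_axis_exponent B \<eta> D z \<equiv> B * \<bar>Im z\<bar> + \<eta> * (1 + cmod z)\<^sup>2 / \<bar>Im z\<bar> + D * (1 + cmod z)\<^sup>2 / (Im z)\<^sup>2"

lemma near_axis_bound:
  fixes F :: "complex \<Rightarrow> complex"
  assumes F: "F holomorphic_on UNIV" and r: "r > 0" and pos: "B \<ge> 0" "\<eta> \<ge> 0" "D > 0" "N \<ge> 0"
    and bd: "\<And>z. Im z \<noteq> 0 \<Longrightarrow> cmod (F z) \<le> N * exp (off_axis_exponent B \<eta> D z)"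
    and z: "cmod (z - of_real x) \<le> r / 4"
  shows "cmod (F z) \<le> N * exp (B * r / 2 + 7 * \<eta> * (1 + \<bar>x\<bar> + r)\<^sup>2 / r + 30 * D * (1 + \<bar>x\<bar> + r)\<^sup>2 / r\<^sup>2)"
proof -
  define R where "R = 1 + \<bar>x\<bar> + r"
  have R: "R > 0" using r by (simp add: R_def)
  have "cmod (F z) \<le> N * exp (B * r / 2) * exp (7 * (\<eta> * R\<^sup>2) / r + 30 * (D * R\<^sup>2) / r\<^sup>2)"
  proof (rule rhombus_bound[OF F r])
    fix v assume v: "\<bar>Re v - x\<bar> + 2 * \<bar>Im v\<bar> = r" "Im v \<noteq> 0"
    have "cmod v \<le> \<bar>x\<bar> + r" using cmod_le[of v] v by linarith
    then have "(1 + cmod v)\<^sup>2 \<le> R\<^sup>2" by (intro power_mono) (auto simp: R_def)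
    then have "\<eta> * (1 + cmod v)\<^sup>2 / \<bar>Im v\<bar> \<le> \<eta> * R\<^sup>2 / \<bar>Im v\<bar>" "D * (1 + cmod v)\<^sup>2 / (Im v)\<^sup>2 \<le> D * R\<^sup>2 / (Im v)\<^sup>2"
      using pos by (auto intro!: divide_right_mono mult_left_mono)
    moreover have "B * \<bar>Im v\<bar> \<le> B * (r / 2)" using v pos by (intro mult_left_mono) auto
    ultimately have "exp (off_axis_exponent B \<eta> D v)
       \<le> exp (B * r / 2 + (\<eta> * R\<^sup>2 / \<bar>Im v\<bar> + D * R\<^sup>2 / (Im v)\<^sup>2))" by simp
    then have "N * exp (off_axis_exponent B \<eta> D v)
       \<le> N * exp (B * r / 2 + (\<eta> * R\<^sup>2 / \<bar>Im v\<bar> + D * R\<^sup>2 / (Im v)\<^sup>2))" using pos by (intro mult_left_mono)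
    then show "cmod (F v) \<le> N * exp (B * r / 2) * exp (\<eta> * R\<^sup>2 / \<bar>Im v\<bar> + D * R\<^sup>2 / (Im v)\<^sup>2)"
      using bd[OF v(2)] by (simp add: exp_add mult.assoc)
  qed (use pos R z in auto)
  then show ?thesis by (simp add: R_def exp_add mult.assoc add.assoc)
qed

section \<open>The Cauchy transforms of an annihilating functional\<close>

text \<open>An integer exponent fits the decay of the transforms, which is obtained from powers of \<open>z\<close>.\<close>

lemma polynomial_growth_weight:
  assumes "sets \<mu> = sets borel" "polynomial_growth \<mu>"
  shows "\<exists>n::nat. integrable \<mu> (\<lambda>t. 1 / (1 + \<bar>t\<bar>) ^ n)"
proof -
  have meas: "f \<in> borel_measurable borel \<Longrightarrow> f \<in> borel_measurable \<mu>" for f :: "real \<Rightarrow> real"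
    using measurable_cong_sets[OF assms(1) refl] by blast
  obtain s where s: "0 \<le> s" "(\<integral>\<^sup>+ t. ennreal (1 / (1 + \<bar>t\<bar> powr (2 * s))) \<partial>\<mu>) < \<infinity>"
    using assms(2) unfolding polynomial_growth_def by blast
  define n where "n = nat \<lceil>2 * s\<rceil>"
  have n: "2 * s \<le> real n" unfolding n_def by linarith
  have int: "integrable \<mu> (\<lambda>t. 1 / (1 + \<bar>t\<bar> powr (2 * s)))"
    using s(2) by (intro integrableI_bounded meas) (auto simp: abs_of_nonneg)
  have "integrable \<mu> (\<lambda>t. 1 / (1 + \<bar>t\<bar>) ^ n)"
  proof (rule Bochner_Integration.integrable_bound)
    show "integrable \<mu> (\<lambda>t. 2 * (1 / (1 + \<bar>t\<bar> powr (2 * s))))" by (intro integrable_mult_right int)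
    show "(\<lambda>t. 1 / (1 + \<bar>t\<bar>) ^ n) \<in> borel_measurable \<mu>" by (intro meas) measurable
    have "1 / (1 + \<bar>t\<bar>) ^ n \<le> 2 * (1 / (1 + \<bar>t\<bar> powr (2 * s)))" for t :: real
    proof -
      have "\<bar>t\<bar> powr (2 * s) \<le> (1 + \<bar>t\<bar>) powr (2 * s)" using s(1) by (intro powr_mono2) auto
      also have "\<dots> \<le> (1 + \<bar>t\<bar>) powr (real n)" using n by (intro powr_mono) auto
      also have "\<dots> = (1 + \<bar>t\<bar>) ^ n" by (intro powr_realpow) auto
      finally have "\<bar>t\<bar> powr (2 * s) \<le> (1 + \<bar>t\<bar>) ^ n" .
      moreover have "1 \<le> (1 + \<bar>t\<bar>) ^ n" by (rule one_le_power) simp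
      ultimately have "1 + \<bar>t\<bar> powr (2 * s) \<le> 2 * (1 + \<bar>t\<bar>) ^ n" by linarith
      moreover have "(1 + \<bar>t\<bar>) ^ n > 0" "1 + \<bar>t\<bar> powr (2 * s) > 0" by (auto intro: add_pos_nonneg)
      ultimately show ?thesis by (simp add: field_simps)
    qed
    then show "AE t in \<mu>. norm (1 / (1 + \<bar>t\<bar>) ^ n) \<le> norm (2 * (1 / (1 + \<bar>t\<bar> powr (2 * s))))"
      by (auto intro: order_trans[OF _ abs_ge_self])
  qed
  then show ?thesis by blast
qed

lemma PW_continuous_on_real: "F \<in> PW a \<Longrightarrow> continuous_on UNIV (\<lambda>t::real. F (of_real t))"
  by (rule continuous_on_compose2[OF holomorphic_on_imp_continuous_on[OF PW_entire]]) (auto intro!: continuous_intros)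

lemma PW_measurable: "F \<in> PW a \<Longrightarrow> sets \<mu> = sets borel \<Longrightarrow> (\<lambda>t::real. F (of_real t)) \<in> borel_measurable \<mu>"
  using borel_measurable_continuous_onI[OF PW_continuous_on_real] measurable_cong_sets[of \<mu> borel] by blast

lemma PW_in_L2:
  assumes "sets \<mu> = sets borel" "polynomial_growth \<mu>" "F \<in> PW a"
  shows "(\<lambda>t. F (of_real t)) \<in> L2_functions \<mu>"
proof -
  obtain n where n: "integrable \<mu> (\<lambda>t. 1 / (1 + \<bar>t\<bar>) ^ n)" using polynomial_growth_weight[OF assms(1,2)] by blast
  obtain C where C: "C \<ge> 0" "\<And>t::real. (1 + \<bar>t\<bar>) ^ n * cmod (F (of_real t)) \<le> C" using PW_decay[OF assms(3), of n] by blast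
  obtain D where D: "D \<ge> 0" "\<And>t::real. (1 + \<bar>t\<bar>) ^ 0 * cmod (F (of_real t)) \<le> D" using PW_decay[OF assms(3), of 0] by blast
  have [measurable]: "(\<lambda>t::real. F (of_real t)) \<in> borel_measurable \<mu>" by (rule PW_measurable[OF assms(3,1)])
  have "integrable \<mu> (\<lambda>t. (cmod (F (of_real t)))\<^sup>2)"
  proof (rule Bochner_Integration.integrable_bound)
    show "integrable \<mu> (\<lambda>t. C * D * (1 / (1 + \<bar>t\<bar>) ^ n))" by (intro integrable_mult_right n)
    have "(cmod (F (of_real t)))\<^sup>2 \<le> C * D * (1 / (1 + \<bar>t\<bar>) ^ n)" for t :: real
    proof -
      have p: "(1 + \<bar>t\<bar>) ^ n > 0" by simp
      have "cmod (F (of_real t)) \<le> C / (1 + \<bar>t\<bar>) ^ n" using C(2)[of t] p by (simp add: pos_le_divide_eq mult.commute)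
      then have "cmod (F (of_real t)) * cmod (F (of_real t)) \<le> C / (1 + \<bar>t\<bar>) ^ n * D"
        using D(2)[of t] C(1) by (intro mult_mono) auto
      then show ?thesis by (simp add: power2_eq_square)
    qed
    then show "AE t in \<mu>. norm ((cmod (F (of_real t)))\<^sup>2) \<le> norm (C * D * (1 / (1 + \<bar>t\<bar>) ^ n))"
      using C(1) D(1) by (intro AE_I2) (simp add: abs_mult)
  qed measurable
  then show ?thesis by (simp add: L2_functions_iff)
qed

lemma L2_bounded_mult:
  assumes "k \<in> L2_functions \<mu>" "m \<in> borel_measurable \<mu>" "\<And>t. cmod (m t) \<le> c"
  shows "(\<lambda>t. m t * k t) \<in> L2_functions \<mu>" and "sq_norm \<mu> (\<lambda>t. m t * k t) \<le> c\<^sup>2 * sq_norm \<mu> k"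
proof -
  have [measurable]: "k \<in> borel_measurable \<mu>" "m \<in> borel_measurable \<mu>" using assms by (auto simp: L2_functions_iff)
  have i: "integrable \<mu> (\<lambda>t. c\<^sup>2 * (cmod (k t))\<^sup>2)" using assms(1) by (intro integrable_mult_right) (simp add: L2_functions_iff)
  have le: "(cmod (m t * k t))\<^sup>2 \<le> c\<^sup>2 * (cmod (k t))\<^sup>2" for t
    using assms(3)[of t] by (auto simp: norm_mult power_mult_distrib intro!: mult_right_mono power_mono)
  have j: "integrable \<mu> (\<lambda>t. (cmod (m t * k t))\<^sup>2)"
    by (rule Bochner_Integration.integrable_bound[OF i]) (use le in \<open>auto intro!: AE_I2\<close>)
  then show "(\<lambda>t. m t * k t) \<in> L2_functions \<mu>" by (simp add: L2_functions_iff)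
  have "sq_norm \<mu> (\<lambda>t. m t * k t) \<le> (\<integral>t. c\<^sup>2 * (cmod (k t))\<^sup>2 \<partial>\<mu>)" unfolding sq_norm_def
    using i j le by (intro integral_mono) auto
  then show "sq_norm \<mu> (\<lambda>t. m t * k t) \<le> c\<^sup>2 * sq_norm \<mu> k" by (simp add: sq_norm_def)
qed

definition PW_norm :: "real measure \<Rightarrow> (complex \<Rightarrow> complex) \<Rightarrow> real" where
  "PW_norm \<mu> F = sqrt (sq_norm \<mu> (\<lambda>t. F (of_real t)))"

lemma PW_norm_nonneg: "PW_norm \<mu> F \<ge> 0"
  by (simp add: PW_norm_def sq_norm_nonneg)

locale annihilating_functional =
  fixes \<mu> :: "real measure" and a :: real and L :: "(real \<Rightarrow> complex) \<Rightarrow> complex" and K :: real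
  assumes sets_\<mu>: "sets \<mu> = sets borel" and growth: "polynomial_growth \<mu>" and a_pos: "a > 0"
    and L_lin: "\<And>k l c d. k \<in> L2_functions \<mu> \<Longrightarrow> l \<in> L2_functions \<mu> \<Longrightarrow> L (\<lambda>t. c * k t + d * l t) = c * L k + d * L l"
    and L_bound: "\<And>k. k \<in> L2_functions \<mu> \<Longrightarrow> cmod (L k) \<le> K * sqrt (sq_norm \<mu> k)"
    and K_pos: "K > 0"
    and L_PW: "\<And>F. F \<in> PW a \<Longrightarrow> L (\<lambda>t. F (of_real t)) = 0"
begin

lemma meas: "f \<in> borel_measurable borel \<Longrightarrow> f \<in> borel_measurable \<mu>"
  using measurable_cong_sets[OF sets_\<mu> refl] by blast

abbreviation nrm :: "(complex \<Rightarrow> complex) \<Rightarrow> real" where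
  "nrm \<equiv> PW_norm \<mu>"

lemma PW_L2: "F \<in> PW a \<Longrightarrow> (\<lambda>t. F (of_real t)) \<in> L2_functions \<mu>"
  by (rule PW_in_L2[OF sets_\<mu> growth])

lemma L_scale: "k \<in> L2_functions \<mu> \<Longrightarrow> L (\<lambda>t. c * k t) = c * L k"
  using L_lin[of k k c 0] by simp

lemma L_diff: "k \<in> L2_functions \<mu> \<Longrightarrow> l \<in> L2_functions \<mu> \<Longrightarrow> L (\<lambda>t. k t - l t) = L k - L l"
  using L_lin[of k l 1 "-1"] by simp

lemma L_bounded_mult:
  assumes "k \<in> L2_functions \<mu>" "m \<in> borel_measurable borel" "\<And>t. cmod (m t) \<le> c" "c \<ge> 0"
  shows "cmod (L (\<lambda>t. m t * k t)) \<le> c * (K * sqrt (sq_norm \<mu> k))"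
proof -
  note * = L2_bounded_mult[OF assms(1) meas[OF assms(2)] assms(3)]
  have "cmod (L (\<lambda>t. m t * k t)) \<le> K * sqrt (sq_norm \<mu> (\<lambda>t. m t * k t))" by (rule L_bound[OF *(1)])
  also have "\<dots> \<le> K * sqrt (c\<^sup>2 * sq_norm \<mu> k)" using K_pos *(2) by (intro mult_left_mono) auto
  finally show ?thesis using assms(4) by (simp add: real_sqrt_mult mult_ac)
qed

lemma L_dominated_limit:
  assumes k: "k \<in> L2_functions \<mu>" and m: "\<And>n. m n \<in> borel_measurable borel" "\<And>n t. cmod (m n t) \<le> c"
    and lim: "\<And>t. (\<lambda>n. m n t) \<longlonglongrightarrow> m' t"
  shows "(\<lambda>n. L (\<lambda>t. m n t * k t)) \<longlonglongrightarrow> L (\<lambda>t. m' t * k t)"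
proof -
  have m': "m' \<in> borel_measurable borel" by (rule borel_measurable_LIMSEQ_metric[OF m(1) lim])
  have m'c: "cmod (m' t) \<le> c" for t
    by (rule LIMSEQ_le_const2[OF tendsto_norm[OF lim]]) (use m(2) in blast)
  have [measurable]: "k \<in> borel_measurable \<mu>" "m n \<in> borel_measurable \<mu>" "m' \<in> borel_measurable \<mu>" for n
    using k m(1) m' by (auto simp: L2_functions_iff intro: meas)
  note L2 = L2_bounded_mult(1)[OF k meas[OF m(1)] m(2)] L2_bounded_mult(1)[OF k meas[OF m'] m'c]
  have "(\<lambda>n. sq_norm \<mu> (\<lambda>t. m n t * k t - m' t * k t)) \<longlonglongrightarrow> (\<integral>t. 0 \<partial>\<mu>)"
    unfolding sq_norm_def
  proof (rule integral_dominated_convergence[where w = "\<lambda>t. (2 * c)\<^sup>2 * (cmod (k t))\<^sup>2"])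
    show "integrable \<mu> (\<lambda>t. (2 * c)\<^sup>2 * (cmod (k t))\<^sup>2)"
      using k by (intro integrable_mult_right) (simp add: L2_functions_iff)
    show "AE t in \<mu>. (\<lambda>n. (cmod (m n t * k t - m' t * k t))\<^sup>2) \<longlonglongrightarrow> 0"
    proof (rule AE_I2)
      fix t
      have "(\<lambda>n. (cmod (m n t * k t - m' t * k t))\<^sup>2) \<longlonglongrightarrow> (cmod (m' t * k t - m' t * k t))\<^sup>2"
        by (intro tendsto_intros lim)
      then show "(\<lambda>n. (cmod (m n t * k t - m' t * k t))\<^sup>2) \<longlonglongrightarrow> 0" by simp
    qed
    show "AE t in \<mu>. norm ((cmod (m n t * k t - m' t * k t))\<^sup>2) \<le> (2 * c)\<^sup>2 * (cmod (k t))\<^sup>2" for n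
    proof (rule AE_I2)
      fix t
      have "cmod (m n t - m' t) \<le> 2 * c" using norm_triangle_ineq4[of "m n t" "m' t"] m(2)[of n t] m'c[of t] by linarith
      then have "cmod (m n t * k t - m' t * k t) \<le> (2 * c) * cmod (k t)"
        by (metis left_diff_distrib mult_right_mono norm_ge_zero norm_mult)
      then have "(cmod (m n t * k t - m' t * k t))\<^sup>2 \<le> ((2 * c) * cmod (k t))\<^sup>2" by (intro power_mono) auto
      then show "norm ((cmod (m n t * k t - m' t * k t))\<^sup>2) \<le> (2 * c)\<^sup>2 * (cmod (k t))\<^sup>2" by (simp add: power_mult_distrib)
    qed
  qed measurable
  then have "(\<lambda>n. K * sqrt (sq_norm \<mu> (\<lambda>t. m n t * k t - m' t * k t))) \<longlonglongrightarrow> K * sqrt 0"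
    by (intro tendsto_intros) simp
  then have "(\<lambda>n. L (\<lambda>t. m n t * k t) - L (\<lambda>t. m' t * k t)) \<longlonglongrightarrow> 0"
  proof (intro Lim_null_comparison[of "\<lambda>n. L (\<lambda>t. m n t * k t) - L (\<lambda>t. m' t * k t)" "\<lambda>n. K * sqrt (sq_norm \<mu> (\<lambda>t. m n t * k t - m' t * k t))"] always_eventually allI)
    fix n
    have "L (\<lambda>t. m n t * k t) - L (\<lambda>t. m' t * k t) = L (\<lambda>t. m n t * k t - m' t * k t)"
      by (rule L_diff[OF L2, symmetric])
    then show "norm (L (\<lambda>t. m n t * k t) - L (\<lambda>t. m' t * k t)) \<le> K * sqrt (sq_norm \<mu> (\<lambda>t. m n t * k t - m' t * k t))"
      using L_bound[OF L2_diff[OF L2]] by simp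
  qed simp
  then show ?thesis by (rule LIM_zero_cancel)
qed

text \<open>For \<open>L k = \<integral> k \<phi> d\<mu>\<close> this is the Cauchy transform of the measure \<open>F \<phi> d\<mu>\<close>.\<close>

definition cauchy_transform :: "(complex \<Rightarrow> complex) \<Rightarrow> complex \<Rightarrow> complex" where
  "cauchy_transform F z = L (\<lambda>t. 1 / (of_real t - z) * F (of_real t))"

lemma kernel:
  assumes "Im z \<noteq> 0"
  shows "(\<lambda>t. 1 / (of_real t - z)) \<in> borel_measurable borel" and "cmod (1 / (of_real t - z)) \<le> 1 / \<bar>Im z\<bar>"
    and "of_real t - z \<noteq> 0"
proof -
  have "Im (of_real t - z) \<noteq> 0" for t using assms by simp
  then have ne: "of_real t - z \<noteq> 0" for t :: real by (metis zero_complex.simps(2))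
  then show "of_real t - z \<noteq> 0" .
  show "(\<lambda>t. 1 / (of_real t - z)) \<in> borel_measurable borel"
    by (intro borel_measurable_continuous_onI continuous_intros ballI ne)
  have "\<bar>Im z\<bar> \<le> cmod (of_real t - z)" using abs_Im_le_cmod[of "of_real t - z"] by simp
  then show "cmod (1 / (of_real t - z)) \<le> 1 / \<bar>Im z\<bar>"
    using assms by (simp add: norm_divide frac_le)
qed

lemma kernel_L2:
  assumes "Im z \<noteq> 0" "k \<in> L2_functions \<mu>"
  shows "(\<lambda>t. 1 / (of_real t - z) * k t) \<in> L2_functions \<mu>"
  by (rule L2_bounded_mult(1)[OF assms(2) meas[OF kernel(1)[OF assms(1)]] kernel(2)[OF assms(1)]])

lemma cauchy_transform_bound:
  assumes "F \<in> PW a" "Im z \<noteq> 0"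
  shows "cmod (cauchy_transform F z) \<le> K * nrm F / \<bar>Im z\<bar>"
  using L_bounded_mult[OF PW_L2[OF assms(1)] kernel(1,2)[OF assms(2)]] by (simp add: cauchy_transform_def PW_norm_def)

text \<open>The function \<open>F z * h - h z * F\<close> vanishes at \<open>z\<close>, so its quotient by \<open>w - z\<close> belongs to the space and is
  annihilated by \<open>L\<close>.\<close>

lemma cauchy_transform_swap:
  assumes F: "F \<in> PW a" and h: "h \<in> PW a" and z: "Im z \<noteq> 0"
  shows "F z * cauchy_transform h z = h z * cauchy_transform F z"
proof -
  have "(\<lambda>w. F z * h w + (- h z) * F w) \<in> PW a" by (rule PW_linear_combination[OF h F])
  then obtain G where G: "G \<in> PW a" "\<And>w. F z * h w + (- h z) * F w = (w - z) * G w"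
    using PW_divide[of "\<lambda>w. F z * h w + (- h z) * F w" a z] by auto
  have "(\<lambda>t. F z * (1 / (of_real t - z) * h (of_real t)) + (- h z) * (1 / (of_real t - z) * F (of_real t))) = (\<lambda>t. G (of_real t))"
  proof
    fix t :: real
    have "F z * (1 / (of_real t - z) * h (of_real t)) + (- h z) * (1 / (of_real t - z) * F (of_real t))
      = (F z * h (of_real t) + (- h z) * F (of_real t)) / (of_real t - z)"
      by (simp add: diff_divide_distrib)
    also have "\<dots> = G (of_real t)" unfolding G(2) using kernel(3)[OF z] by simp
    finally show "F z * (1 / (of_real t - z) * h (of_real t)) + (- h z) * (1 / (of_real t - z) * F (of_real t)) = G (of_real t)" .
  qed
  then have "F z * cauchy_transform h z + (- h z) * cauchy_transform F z = 0"
    using L_lin[OF kernel_L2[OF z PW_L2[OF h]] kernel_L2[OF z PW_L2[OF F]], of "F z" "- h z"] L_PW[OF G(1)]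
    by (simp add: cauchy_transform_def)
  then show ?thesis by simp
qed

text \<open>By the resolvent identity the difference quotients of the kernel converge uniformly in \<open>t\<close>, so the
  derivative can be taken inside \<open>L\<close>.\<close>

lemma cauchy_transform_holomorphic:
  assumes h: "h \<in> PW a"
  shows "cauchy_transform h holomorphic_on {z. Im z > 0}"
proof (rule holomorphic_onI)
  fix z assume "z \<in> {z. Im z > 0}"
  then have y: "Im z > 0" by simp
  define k where "k t = h (of_real t)" for t :: real
  have k: "k \<in> L2_functions \<mu>" unfolding k_def by (rule PW_L2[OF h])
  define D where "D = L (\<lambda>t. 1 / (of_real t - z) * (1 / (of_real t - z) * k t))"
  define M where "M = 2 / Im z * (1 / Im z) * (1 / Im z) * (K * sqrt (sq_norm \<mu> k))"
  have L2z: "(\<lambda>t. 1 / (of_real t - z) * (1 / (of_real t - z) * k t)) \<in> L2_functions \<mu>"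
    using y by (intro kernel_L2 k) auto
  have bound: "cmod ((cauchy_transform h w - cauchy_transform h z) / (w - z) - D) \<le> cmod (w - z) * M"
    if w: "cmod (w - z) < Im z / 2" "w \<noteq> z" for w
  proof -
    have yw: "Im w \<ge> Im z / 2" using abs_Im_le_cmod[of "w - z"] w by auto
    then have yw0: "Im w \<noteq> 0" "Im w > 0" using y by auto
    define m where "m t = (1 / (of_real t - w)) * (1 / (of_real t - z)) * (1 / (of_real t - z))" for t :: real
    have m: "m \<in> borel_measurable borel" unfolding m_def using kernel(1)[of w] kernel(1)[of z] yw0 y
      by (intro borel_measurable_times) auto
    have mb: "cmod (m t) \<le> 2 / Im z * (1 / Im z) * (1 / Im z)" for t
    proof -
      have "cmod (1 / (of_real t - w)) \<le> 1 / \<bar>Im w\<bar>" using kernel(2)[OF yw0(1)] .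
      also have "\<dots> \<le> 2 / Im z" using yw yw0 y by (simp add: field_simps)
      finally have "cmod (1 / (of_real t - w)) \<le> 2 / Im z" .
      moreover have "cmod (1 / (of_real t - z)) \<le> 1 / Im z" using kernel(2)[of z t] y by simp
      ultimately show ?thesis unfolding m_def norm_mult using y by (intro mult_mono) auto
    qed
    have eq: "(\<lambda>t. (1 / (w - z)) * (1 / (of_real t - w) * k t - 1 / (of_real t - z) * k t) - 1 / (of_real t - z) * (1 / (of_real t - z) * k t))
      = (\<lambda>t. (w - z) * (m t * k t))"
    proof
      fix t :: real
      have ne: "of_real t - w \<noteq> 0" "of_real t - z \<noteq> 0" "w - z \<noteq> 0" using kernel(3)[of w t] kernel(3)[of z t] yw0 y w(2) by auto
      have "1 / (of_real t - w) - 1 / (of_real t - z) = (w - z) * (1 / (of_real t - w) * (1 / (of_real t - z)))"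
        using ne by (simp add: field_simps)
      have alg: "(1 / e) * (P * x - Q * x) = P * Q * x" if "P - Q = e * (P * Q)" "e \<noteq> 0" for P Q e x :: complex
      proof -
        have "P * x - Q * x = e * (P * Q) * x" using that(1) by (simp flip: left_diff_distrib)
        then show ?thesis using that(2) by simp
      qed
      have "(1 / (w - z)) * (1 / (of_real t - w) * k t - 1 / (of_real t - z) * k t) = 1 / (of_real t - w) * (1 / (of_real t - z)) * k t"
        by (rule alg) fact+
      moreover have "1 / (of_real t - w) * (1 / (of_real t - z)) * k t - 1 / (of_real t - z) * (1 / (of_real t - z) * k t)
         = (1 / (of_real t - w) - 1 / (of_real t - z)) * (1 / (of_real t - z)) * k t" by (simp add: algebra_simps)
      moreover have "\<dots> = (w - z) * (m t * k t)" 
        unfolding \<open>1 / (of_real t - w) - 1 / (of_real t - z) = _\<close> m_def by (simp only: mult.assoc)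
      ultimately show "(1 / (w - z)) * (1 / (of_real t - w) * k t - 1 / (of_real t - z) * k t) - 1 / (of_real t - z) * (1 / (of_real t - z) * k t)
        = (w - z) * (m t * k t)" by simp
    qed
    have kw: "(\<lambda>t. 1 / (of_real t - w) * k t) \<in> L2_functions \<mu>" "(\<lambda>t. 1 / (of_real t - z) * k t) \<in> L2_functions \<mu>"
      by (rule kernel_L2[OF yw0(1) k], rule kernel_L2[OF _ k]) (use y in simp)
    have "(cauchy_transform h w - cauchy_transform h z) / (w - z) - D
      = L (\<lambda>t. (1 / (w - z)) * (1 / (of_real t - w) * k t - 1 / (of_real t - z) * k t) - 1 / (of_real t - z) * (1 / (of_real t - z) * k t))"
      by (subst L_diff[OF L2_scale[OF L2_diff[OF kw]] L2z], subst L_scale[OF L2_diff[OF kw]], subst L_diff[OF kw])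
        (simp add: cauchy_transform_def k_def D_def)
    also have "\<dots> = (w - z) * L (\<lambda>t. m t * k t)" unfolding eq
      by (rule L_scale[OF L2_bounded_mult(1)[OF k meas[OF m] mb]])
    finally have "cmod ((cauchy_transform h w - cauchy_transform h z) / (w - z) - D) = cmod (w - z) * cmod (L (\<lambda>t. m t * k t))"
      by (simp only: norm_mult)
    also have "\<dots> \<le> cmod (w - z) * M"
      unfolding M_def by (intro mult_left_mono L_bounded_mult[OF k m mb]) (use y in auto)
    finally show ?thesis .
  qed
  have "((\<lambda>w. (cauchy_transform h w - cauchy_transform h z) / (w - z) - D) \<longlongrightarrow> 0) (at z)"
  proof (rule Lim_null_comparison)
    have "((\<lambda>w. cmod (w - z) * M) \<longlongrightarrow> cmod (z - z) * M) (at z)" by (intro tendsto_intros)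
    then show "((\<lambda>w. cmod (w - z) * M) \<longlongrightarrow> 0) (at z)" by simp
    show "\<forall>\<^sub>F w in at z. norm ((cauchy_transform h w - cauchy_transform h z) / (w - z) - D) \<le> cmod (w - z) * M"
      unfolding eventually_at using bound y by (intro exI[of _ "Im z / 2"]) (auto simp: dist_norm)
  qed
  then have "((\<lambda>w. (cauchy_transform h w - cauchy_transform h z) / (w - z)) \<longlongrightarrow> D) (at z)" by (rule LIM_zero_cancel)
  then have "(cauchy_transform h has_field_derivative D) (at z)" by (simp add: has_field_derivative_iff)
  then show "cauchy_transform h field_differentiable at z within {z. Im z > 0}"
    by (meson field_differentiable_at_within field_differentiable_def)
qed

end

section \<open>Non-triviality of the Cauchy transforms\<close>

text \<open>The point is the uniformity in \<open>x\<close>: it permits differentiating \<open>L (arctan ((b - t) / y) h)\<close> with respect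
  to \<open>b\<close>.\<close>

lemma arctan_taylor_bound: "\<bar>arctan (x + s) - arctan x - s / (1 + x\<^sup>2)\<bar> \<le> s\<^sup>2" for x s :: real
proof -
  have key: "\<exists>\<xi>. \<bar>\<xi> - x\<bar> \<le> \<bar>s\<bar> \<and> arctan (x + s) - arctan x = s / (1 + \<xi>\<^sup>2)"
  proof -
    consider "s > 0" | "s < 0" | "s = 0" by linarith
    then show ?thesis
    proof cases
      case 1
      then obtain \<xi> where "x < \<xi>" "\<xi> < x + s" "arctan (x + s) - arctan x = (x + s - x) * inverse (1 + \<xi>\<^sup>2)"
        using MVT2[of x "x + s" arctan "\<lambda>x. inverse (1 + x\<^sup>2)"] by (auto intro: DERIV_arctan)
      then show ?thesis by (intro exI[of _ \<xi>]) (auto simp: divide_inverse)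
    next
      case 2
      then obtain \<xi> where "x + s < \<xi>" "\<xi> < x" "arctan x - arctan (x + s) = (x - (x + s)) * inverse (1 + \<xi>\<^sup>2)"
        using MVT2[of "x + s" x arctan "\<lambda>x. inverse (1 + x\<^sup>2)"] by (auto intro: DERIV_arctan)
      then show ?thesis by (intro exI[of _ \<xi>]) (auto simp: divide_inverse)
    qed (intro exI[of _ x], simp)
  qed
  then obtain \<xi> where \<xi>: "\<bar>\<xi> - x\<bar> \<le> \<bar>s\<bar>" "arctan (x + s) - arctan x = s / (1 + \<xi>\<^sup>2)" by blast
  have pos: "1 + \<xi>\<^sup>2 > 0" "1 + x\<^sup>2 > 0" by (auto intro: add_pos_nonneg)
  have "1 / (1 + \<xi>\<^sup>2) - 1 / (1 + x\<^sup>2) = (x - \<xi>) * (x + \<xi>) / ((1 + \<xi>\<^sup>2) * (1 + x\<^sup>2))"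
    using pos by (simp add: field_simps power2_eq_square)
  also have "\<bar>\<dots>\<bar> = \<bar>x - \<xi>\<bar> * (\<bar>x + \<xi>\<bar> / ((1 + \<xi>\<^sup>2) * (1 + x\<^sup>2)))"
    using pos by (simp add: abs_mult)
  also have "\<dots> \<le> \<bar>s\<bar> * 1"
  proof (rule mult_mono)
    have "\<bar>x + \<xi>\<bar> \<le> (1 + \<xi>\<^sup>2) * (1 + x\<^sup>2)"
    proof -
      have "\<bar>x\<bar> \<le> (1 + x\<^sup>2) / 2" "\<bar>\<xi>\<bar> \<le> (1 + \<xi>\<^sup>2) / 2"
        using sum_squares_bound[of "\<bar>x\<bar>" 1] sum_squares_bound[of "\<bar>\<xi>\<bar>" 1] by auto
      then have "\<bar>x + \<xi>\<bar> \<le> 1 + x\<^sup>2 / 2 + \<xi>\<^sup>2 / 2"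
        using abs_triangle_ineq[of x \<xi>] by (simp add: field_simps)
      also have "\<dots> \<le> (1 + \<xi>\<^sup>2) * (1 + x\<^sup>2)"
      proof -
        have "0 \<le> x\<^sup>2" "0 \<le> \<xi>\<^sup>2" "0 \<le> \<xi>\<^sup>2 * x\<^sup>2" by auto
        moreover have "(1 + \<xi>\<^sup>2) * (1 + x\<^sup>2) = 1 + x\<^sup>2 + \<xi>\<^sup>2 + \<xi>\<^sup>2 * x\<^sup>2" by (simp add: algebra_simps)
        ultimately show ?thesis by linarith
      qed
      finally show ?thesis .
    qed
    then show "\<bar>x + \<xi>\<bar> / ((1 + \<xi>\<^sup>2) * (1 + x\<^sup>2)) \<le> 1" using pos by (subst divide_le_eq_1_pos) auto
    show "\<bar>x - \<xi>\<bar> \<le> \<bar>s\<bar>" using \<xi>(1) by simp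
  qed (use pos in auto)
  finally have d: "\<bar>1 / (1 + \<xi>\<^sup>2) - 1 / (1 + x\<^sup>2)\<bar> \<le> \<bar>s\<bar>" by simp
  have "arctan (x + s) - arctan x - s / (1 + x\<^sup>2) = s * (1 / (1 + \<xi>\<^sup>2) - 1 / (1 + x\<^sup>2))"
    using \<xi>(2) by (simp add: right_diff_distrib)
  then have "\<bar>arctan (x + s) - arctan x - s / (1 + x\<^sup>2)\<bar> = \<bar>s\<bar> * \<bar>1 / (1 + \<xi>\<^sup>2) - 1 / (1 + x\<^sup>2)\<bar>" by (simp add: abs_mult)
  also have "\<dots> \<le> \<bar>s\<bar> * \<bar>s\<bar>" by (intro mult_left_mono d) auto
  finally show ?thesis by (simp add: power2_eq_square)
qed

context annihilating_functional
begin

text \<open>The derivative of \<open>arctan ((b - t) / y)\<close> in \<open>b\<close> is the Poisson kernel, a combination of \<open>1 / (t - z)\<close> and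
  \<open>1 / (t - cnj z)\<close> with \<open>z = b + i y\<close>.\<close>

lemma L_arctan_const:
  assumes h: "h \<in> PW a" and zero: "\<And>z. Im z \<noteq> 0 \<Longrightarrow> cauchy_transform h z = 0" and y: "y > 0"
  shows "\<exists>c. \<forall>b. L (\<lambda>t. of_real (arctan ((b - t) / y)) * h (of_real t)) = c"
proof -
  define k where "k t = h (of_real t)" for t :: real
  have k: "k \<in> L2_functions \<mu>" unfolding k_def by (rule PW_L2[OF h])
  define A where "A b t = complex_of_real (arctan ((b - t) / y))" for b t :: real
  have A_m: "A b \<in> borel_measurable borel" for b
  proof -
    have "continuous_on UNIV (A b)" unfolding A_def using y by (intro continuous_intros) auto
    then show ?thesis by (rule borel_measurable_continuous_onI)
  qed
  have A_b: "cmod (A b t) \<le> 2" for b t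
  proof -
    have "\<bar>arctan ((b - t) / y)\<bar> \<le> 2"
      using arctan_lbound[of "(b - t) / y"] arctan_ubound[of "(b - t) / y"] pi_less_4 by linarith
    then show ?thesis by (simp add: A_def)
  qed
  define P where "P b t = complex_of_real (y / ((b - t)\<^sup>2 + y\<^sup>2))" for b t :: real
  have posd: "(b - t)\<^sup>2 + y\<^sup>2 > 0" for b t using y by (simp add: add_nonneg_pos)
  have P_m: "P b \<in> borel_measurable borel" for b
  proof -
    have "continuous_on UNIV (P b)" unfolding P_def using posd by (intro continuous_intros) (auto simp: less_le)
    then show ?thesis by (rule borel_measurable_continuous_onI)
  qed
  have P_b: "cmod (P b t) \<le> 1 / y" for b t
  proof -
    have "y / ((b - t)\<^sup>2 + y\<^sup>2) \<le> y / y\<^sup>2" using y by (intro divide_left_mono mult_pos_pos posd) auto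
    then show ?thesis unfolding P_def norm_of_real using y posd[of b t] by (simp add: power2_eq_square abs_of_nonneg less_imp_le)
  qed
  have LP: "L (\<lambda>t. P b t * k t) = 0" for b
  proof -
    define z where "z = Complex b y"
    have zi: "Im z \<noteq> 0" "Im (cnj z) \<noteq> 0" using y by (auto simp: z_def)
    have eq: "(\<lambda>t. P b t * k t) = (\<lambda>t. (1 / (2 * \<i>)) * (1 / (of_real t - z) * k t) + (- (1 / (2 * \<i>))) * (1 / (of_real t - cnj z) * k t))"
    proof
      fix t :: real
      have ne: "of_real t - z \<noteq> 0" "of_real t - cnj z \<noteq> 0" using kernel(3)[OF zi(1)] kernel(3)[OF zi(2)] by auto
      have "(of_real t - z) * (of_real t - cnj z) = of_real ((b - t)\<^sup>2 + y\<^sup>2)"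
        by (simp add: z_def complex_eq_iff power2_eq_square algebra_simps)
      moreover have "1 / (of_real t - z) - 1 / (of_real t - cnj z) = (z - cnj z) / ((of_real t - z) * (of_real t - cnj z))"
        using ne by (simp add: field_simps)
      moreover have "z - cnj z = 2 * \<i> * of_real y" by (simp add: z_def complex_eq_iff)
      ultimately have e: "1 / (of_real t - z) - 1 / (of_real t - cnj z) = 2 * \<i> * P b t" by (simp add: P_def)
      have "(1 / (2 * \<i>)) * (1 / (of_real t - z) * k t) + (- (1 / (2 * \<i>))) * (1 / (of_real t - cnj z) * k t)
        = (1 / (2 * \<i>)) * (1 / (of_real t - z) - 1 / (of_real t - cnj z)) * k t" by (simp add: algebra_simps)
      then show "P b t * k t = (1 / (2 * \<i>)) * (1 / (of_real t - z) * k t) + (- (1 / (2 * \<i>))) * (1 / (of_real t - cnj z) * k t)"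
        unfolding e by simp
    qed
    show ?thesis unfolding eq using zero[OF zi(1)] zero[OF zi(2)]
      by (subst L_lin[OF kernel_L2[OF zi(1) k] kernel_L2[OF zi(2) k]]) (simp add: cauchy_transform_def k_def)
  qed
  define D where "D b = L (\<lambda>t. A b t * k t)" for b
  define M where "M = K * sqrt (sq_norm \<mu> k) / y\<^sup>2"
  have D_quad: "cmod (D b' - D b) \<le> (b' - b)\<^sup>2 * M" for b b'
  proof -
    define m where "m t = 1 * (A b' t + (-1) * A b t) + of_real (b - b') * P b t" for t
    have m: "m \<in> borel_measurable borel" unfolding m_def using A_m P_m by measurable
    have mb: "cmod (m t) \<le> (b' - b)\<^sup>2 / y\<^sup>2" for t
    proof -
      define x s where "x = (b - t) / y" and "s = (b' - b) / y"
      have "x + s = (b' - t) / y" using y by (simp add: x_def s_def field_simps)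
      moreover have "s / (1 + x\<^sup>2) = (b' - b) * (y / ((b - t)\<^sup>2 + y\<^sup>2))"
      proof -
        have "((b' - b) / y) / (Q / y\<^sup>2) = (b' - b) * (y / Q)" if "Q > 0" for Q
          using y that by (simp add: field_simps power2_eq_square)
        moreover have "1 + x\<^sup>2 = ((b - t)\<^sup>2 + y\<^sup>2) / y\<^sup>2" using y by (simp add: x_def power_divide add_divide_distrib)
        ultimately show ?thesis using posd[of b t] by (simp add: s_def)
      qed
      moreover have "1 * (complex_of_real \<alpha> + (-1) * of_real \<beta>) + of_real (b - b') * of_real p = of_real (\<alpha> - \<beta> - (b' - b) * p)" for \<alpha> \<beta> p
        by (simp add: algebra_simps)
      ultimately have "m t = of_real (arctan (x + s) - arctan x - s / (1 + x\<^sup>2))"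
        by (simp only: m_def A_def P_def x_def)
      then have "cmod (m t) \<le> s\<^sup>2" using arctan_taylor_bound[of x s] by (simp only: norm_of_real)
      then show ?thesis by (simp add: s_def power_divide)
    qed
    have L2s: "(\<lambda>t. A b t * k t) \<in> L2_functions \<mu>" "(\<lambda>t. P b t * k t) \<in> L2_functions \<mu>" for b
      by (auto intro!: L2_bounded_mult(1)[OF k meas[OF A_m] A_b] L2_bounded_mult(1)[OF k meas[OF P_m] P_b])
    have eq: "(\<lambda>t. 1 * (A b' t * k t - A b t * k t) + of_real (b - b') * (P b t * k t)) = (\<lambda>t. m t * k t)"
      by (auto simp: m_def algebra_simps)
    have "L (\<lambda>t. m t * k t) = D b' - D b" unfolding eq[symmetric]
      by (subst L_lin[OF L2_diff[OF L2s(1) L2s(1)] L2s(2)], subst L_diff[OF L2s(1) L2s(1)]) (simp add: LP D_def)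
    then have "cmod (D b' - D b) \<le> (b' - b)\<^sup>2 / y\<^sup>2 * (K * sqrt (sq_norm \<mu> k))"
      using L_bounded_mult[OF k m mb] by simp
    then show ?thesis by (simp add: M_def)
  qed
  have "(D has_derivative (\<lambda>h. 0)) (at b within UNIV)" for b
  proof -
    have "((\<lambda>x. norm (x - b) * M) \<longlongrightarrow> norm (b - b) * M) (at b)" by (intro tendsto_intros)
    then have t: "((\<lambda>x. norm (x - b) * M) \<longlongrightarrow> 0) (at b)" by simp
    have "((\<lambda>x. (1 / norm (x - b)) *\<^sub>R (D x - (D b + 0))) \<longlongrightarrow> 0) (at b)"
    proof (rule Lim_null_comparison[OF _ t])
      have "norm ((1 / norm (x - b)) *\<^sub>R (D x - (D b + 0))) \<le> norm (x - b) * M" if "x \<noteq> b" for x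
      proof -
        have "norm ((1 / norm (x - b)) *\<^sub>R (D x - (D b + 0))) = cmod (D x - D b) / \<bar>x - b\<bar>" by simp
        also have "\<dots> \<le> (x - b)\<^sup>2 * M / \<bar>x - b\<bar>" by (intro divide_right_mono D_quad) auto
        also have "(x - b)\<^sup>2 = \<bar>x - b\<bar> * \<bar>x - b\<bar>" by (simp add: power2_eq_square)
        also have "\<bar>x - b\<bar> * \<bar>x - b\<bar> * M / \<bar>x - b\<bar> = norm (x - b) * M"
          using that by (simp del: abs_mult_self_eq)
        finally show ?thesis .
      qed
      then show "\<forall>\<^sub>F x in at b. norm ((1 / norm (x - b)) *\<^sub>R (D x - (D b + 0))) \<le> norm (x - b) * M"
        by (auto simp: eventually_at_filter)
    qed
    then show ?thesis by (simp add: has_derivative_within)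
  qed
  then obtain c where "\<And>b. D b = c" using has_derivative_zero_constant[of UNIV D] by auto
  then show ?thesis by (auto simp: D_def A_def k_def)
qed

text \<open>As \<open>y\<close> tends to zero, the arctangents tend to \<open>\<pi> / 2\<close> times the sign function. The resulting
  constant is found by letting \<open>b\<close> tend to \<open>- \<infinity>\<close>, where the sign becomes \<open>- 1\<close> and \<open>L h = 0\<close>.\<close>

lemma L_sgn:
  assumes h: "h \<in> PW a" and zero: "\<And>z. Im z \<noteq> 0 \<Longrightarrow> cauchy_transform h z = 0"
  shows "L (\<lambda>t. of_real (sgn (b - t)) * h (of_real t)) = 0"
proof -
  have h2: "(\<lambda>t. h (of_real t)) \<in> L2_functions \<mu>" by (rule PW_L2[OF h])
  define A where "A n b t = complex_of_real (arctan ((b - t) / (1 / real (Suc n))))" for n and b t :: real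
  have A_m: "A n b \<in> borel_measurable borel" for n b
  proof -
    have "continuous_on UNIV (A n b)" unfolding A_def by (intro continuous_intros) auto
    then show ?thesis by (rule borel_measurable_continuous_onI)
  qed
  have A_b: "cmod (A n b t) \<le> 2" for n b t
  proof -
    have "\<bar>arctan ((b - t) / (1 / real (Suc n)))\<bar> \<le> 2"
      using arctan_lbound[of "(b - t) / (1 / real (Suc n))"] arctan_ubound[of "(b - t) / (1 / real (Suc n))"] pi_less_4 by linarith
    then show ?thesis by (simp add: A_def)
  qed
  have A_lim: "(\<lambda>n. A n b t) \<longlonglongrightarrow> of_real (pi / 2 * sgn (b - t))" for b t
  proof -
    have lin: "filterlim (\<lambda>n. c * real (Suc n)) at_top sequentially" if "c > 0" for c
      using filterlim_tendsto_pos_mult_at_top[OF tendsto_const that filterlim_compose[OF filterlim_real_sequentially filterlim_Suc]] .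
    have "(\<lambda>n. arctan ((b - t) * real (Suc n))) \<longlonglongrightarrow> pi / 2 * sgn (b - t)"
    proof -
      consider "b - t > 0" | "b - t < 0" | "b - t = 0" by linarith
      then show ?thesis
      proof cases
        case 1
        then show ?thesis using filterlim_compose[OF tendsto_arctan_at_top lin[OF 1]] by simp
      next
        case 2
        then have "t - b > 0" by simp
        from filterlim_compose[OF tendsto_arctan_at_top lin[OF this]]
        have "(\<lambda>n. - arctan ((t - b) * real (Suc n))) \<longlonglongrightarrow> - (pi / 2)" by (rule tendsto_minus)
        moreover have "- arctan ((t - b) * real (Suc n)) = arctan ((b - t) * real (Suc n))" for n
          by (simp only: arctan_minus[symmetric]) (simp add: algebra_simps)
        ultimately show ?thesis using 2 by simp
      qed simp
    qed
    then show ?thesis unfolding A_def by (intro tendsto_of_real) simp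
  qed
  define S where "S b = L (\<lambda>t. of_real (pi / 2 * sgn (b - t)) * h (of_real t))" for b
  have S_lim: "(\<lambda>n. L (\<lambda>t. A n b t * h (of_real t))) \<longlonglongrightarrow> S b" for b
    unfolding S_def by (rule L_dominated_limit[OF h2 A_m A_b A_lim])
  have S_const: "S b = S b'" for b b'
  proof -
    have "L (\<lambda>t. A n b t * h (of_real t)) = L (\<lambda>t. A n b' t * h (of_real t))" for n
    proof -
      obtain c where "\<And>b. L (\<lambda>t. A n b t * h (of_real t)) = c"
        using L_arctan_const[OF h zero, of "1 / real (Suc n)"] unfolding A_def by auto
      then show ?thesis by simp
    qed
    then have "(\<lambda>n. L (\<lambda>t. A n b t * h (of_real t))) \<longlonglongrightarrow> S b'" using S_lim[of b'] by simp
    then show ?thesis using S_lim[of b] LIMSEQ_unique by blast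
  qed
  have sg_m: "(\<lambda>t. complex_of_real (pi / 2 * sgn (b - t))) \<in> borel_measurable borel" for b by measurable
  have sg_b: "cmod (complex_of_real (pi / 2 * sgn (b - t))) \<le> 2" for b t :: real
    using pi_less_4 by (simp add: abs_mult sgn_if)
  have "(\<lambda>n. S (- real n)) \<longlonglongrightarrow> L (\<lambda>t. of_real (- pi / 2) * h (of_real t))"
    unfolding S_def
  proof (rule L_dominated_limit[OF h2 sg_m sg_b])
    fix t :: real
    have "eventually (\<lambda>n. complex_of_real (pi / 2 * sgn (- real n - t)) = of_real (- pi / 2)) sequentially"
      using eventually_gt_at_top[of "nat \<lceil>\<bar>t\<bar>\<rceil>"]
    proof eventually_elim
      case (elim n)
      then have "- real n - t < 0" by linarith
      then show ?case by simp
    qed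
    then show "(\<lambda>n. complex_of_real (pi / 2 * sgn (- real n - t))) \<longlonglongrightarrow> of_real (- pi / 2)"
      by (rule tendsto_eventually)
  qed
  moreover have "L (\<lambda>t. of_real (- pi / 2) * h (of_real t)) = 0"
    by (subst L_scale[OF h2]) (simp add: L_PW[OF h])
  ultimately have "(\<lambda>n. S (- real n)) \<longlonglongrightarrow> 0" by simp
  moreover have "S (- real n) = S b" for n by (rule S_const)
  ultimately have "(\<lambda>n::nat. S b) \<longlonglongrightarrow> 0" by simp
  then have "S b = 0" by (simp add: LIMSEQ_const_iff)
  moreover have "S b = of_real (pi / 2) * L (\<lambda>t. of_real (sgn (b - t)) * h (of_real t))"
  proof -
    have "(\<lambda>t. complex_of_real (sgn (b - t)) * h (of_real t)) \<in> L2_functions \<mu>"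
      by (rule L2_bounded_mult(1)[OF h2 meas, of _ 1]) (auto simp: sgn_if)
    from L_scale[OF this, of "of_real (pi / 2)"] show ?thesis by (simp add: S_def mult.assoc)
  qed
  ultimately show ?thesis by simp
qed

lemma L_indicator_atMost:
  assumes h: "h \<in> PW a" and zero: "\<And>z. Im z \<noteq> 0 \<Longrightarrow> cauchy_transform h z = 0"
  shows "L (\<lambda>t. indicator {..b} t * h (of_real t)) = 0"
proof -
  have h2: "(\<lambda>t. h (of_real t)) \<in> L2_functions \<mu>" by (rule PW_L2[OF h])
  \<comment> \<open>Approaching \<open>b\<close> from the right gives the point \<open>t = b\<close> the limit value 1.\<close>
  have "(\<lambda>n. L (\<lambda>t. of_real (sgn (b + 1 / real (Suc n) - t)) * h (of_real t))) \<longlonglongrightarrow>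
      L (\<lambda>t. (2 * indicator {..b} t - 1) * h (of_real t))"
  proof (rule L_dominated_limit[OF h2, of _ 1])
    show "(\<lambda>t. complex_of_real (sgn (b + 1 / real (Suc n) - t))) \<in> borel_measurable borel" for n by measurable
    show "cmod (complex_of_real (sgn (b + 1 / real (Suc n) - t))) \<le> 1" for n t by (simp add: sgn_if)
    fix t :: real
    show "(\<lambda>n. complex_of_real (sgn (b + 1 / real (Suc n) - t))) \<longlonglongrightarrow> 2 * indicator {..b} t - 1"
    proof (cases "t \<le> b")
      case True
      have "b + 1 / real (Suc n) - t > 0" for n using True by (simp add: add_pos_nonneg add_nonneg_pos algebra_simps le_less_trans)
      then show ?thesis using True by simp
    next
      case False
      have "(\<lambda>n. 1 / real (Suc n)) \<longlonglongrightarrow> 0" by (rule LIMSEQ_Suc[OF lim_1_over_n])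
      then have "eventually (\<lambda>n. 1 / real (Suc n) < t - b) sequentially" using False by (intro order_tendstoD(2)) auto
      then have "eventually (\<lambda>n. complex_of_real (sgn (b + 1 / real (Suc n) - t)) = - 1) sequentially"
        by eventually_elim simp
      then show ?thesis using False by (intro tendsto_eventually) simp
    qed
  qed
  moreover have "L (\<lambda>t. of_real (sgn (b + 1 / real (Suc n) - t)) * h (of_real t)) = 0" for n
    by (rule L_sgn[OF h zero])
  ultimately have "(\<lambda>n. 0) \<longlonglongrightarrow> L (\<lambda>t. (2 * indicator {..b} t - 1) * h (of_real t))" by (simp only:)
  then have "L (\<lambda>t. (2 * indicator {..b} t - 1) * h (of_real t)) = 0" by (simp add: LIMSEQ_const_iff)
  moreover have i2: "(\<lambda>t. indicator {..b} t * h (of_real t)) \<in> L2_functions \<mu>"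
    by (rule L2_bounded_mult(1)[OF h2 meas, of _ 1]) (auto simp: indicator_def)
  moreover have "(\<lambda>t. (2 * indicator {..b} t - 1) * h (of_real t)) = (\<lambda>t. 2 * (indicator {..b} t * h (of_real t)) + (-1) * h (of_real t))"
    by (auto simp: algebra_simps)
  ultimately show ?thesis using L_lin[OF i2 h2, of 2 "-1"] L_PW[OF h] by simp
qed

lemma L_indicator_borel:
  assumes h: "h \<in> PW a" and zero: "\<And>z. Im z \<noteq> 0 \<Longrightarrow> cauchy_transform h z = 0" and A: "A \<in> sets borel"
  shows "L (\<lambda>t. indicator A t * h (of_real t)) = 0"
proof -
  have h2: "(\<lambda>t. h (of_real t)) \<in> L2_functions \<mu>" by (rule PW_L2[OF h])
  have i2: "(\<lambda>t. indicator A t * h (of_real t)) \<in> L2_functions \<mu>" if "A \<in> sets borel" for A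
    using that by (intro L2_bounded_mult(1)[OF h2 meas, of _ 1]) (auto simp: indicator_def)
  have A': "A \<in> sigma_sets UNIV (range atMost)" using A by (simp add: borel_eq_atMost)
  have sets: "sigma_sets UNIV (range (atMost :: real \<Rightarrow> _)) = sets borel" by (simp add: borel_eq_atMost)
  show ?thesis
  proof (rule sigma_sets_induct_disjoint[OF _ _ A', where P = "\<lambda>A. L (\<lambda>t. indicator A t * h (of_real t)) = 0"])
    show "Int_stable (range (atMost :: real \<Rightarrow> _))" by (auto simp: Int_stable_def intro: rangeI[of _ "min _ _"])
    show "L (\<lambda>t. indicator A t * h (of_real t)) = 0" if "A \<in> range atMost" for A :: "real set"
      using that L_indicator_atMost[OF h zero] by auto
    show "L (\<lambda>t. indicator {} t * h (of_real t)) = 0"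
      using L_scale[OF h2, of 0] by simp
  next
    fix B assume B: "B \<in> sigma_sets UNIV (range (atMost :: real \<Rightarrow> _))" "L (\<lambda>t. indicator B t * h (of_real t)) = 0"
    have "(\<lambda>t. indicator (UNIV - B) t * h (of_real t)) = (\<lambda>t. h (of_real t) - indicator B t * h (of_real t))"
      by (auto simp: indicator_def)
    then show "L (\<lambda>t. indicator (UNIV - B) t * h (of_real t)) = 0"
      using L_diff[OF h2 i2, of B] B L_PW[OF h] sets by simp
  next
    fix B :: "nat \<Rightarrow> real set"
    assume B: "disjoint_family B" "range B \<subseteq> sigma_sets UNIV (range atMost)" "\<And>i. L (\<lambda>t. indicator (B i) t * h (of_real t)) = 0"
    have Bm: "B i \<in> sets borel" for i using B(2) sets by auto
    have part: "L (\<lambda>t. indicator (\<Union>i<n. B i) t * h (of_real t)) = 0" for n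
    proof (induction n)
      case 0
      then show ?case using L_scale[OF h2, of 0] by simp
    next
      case (Suc n)
      have "B i \<inter> B n = {}" if "i < n" for i using B(1) that by (simp add: disjoint_family_on_def)
      then have "(\<Union>i<n. B i) \<inter> B n = {}" by blast
      then have "(\<lambda>t. indicator (\<Union>i<Suc n. B i) t * h (of_real t)) = (\<lambda>t. 1 * (indicator (\<Union>i<n. B i) t * h (of_real t)) + 1 * (indicator (B n) t * h (of_real t)))"
        by (auto simp: fun_eq_iff indicator_def lessThan_Suc)
      then show ?case using L_lin[OF i2 i2, of "\<Union>i<n. B i" "B n" 1 1] Bm Suc B(3) by auto
    qed
    have "(\<lambda>n. L (\<lambda>t. indicator (\<Union>i<n. B i) t * h (of_real t))) \<longlonglongrightarrow> L (\<lambda>t. indicator (\<Union>i. B i) t * h (of_real t))"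
    proof (rule L_dominated_limit[OF h2, of _ 1])
      show "indicator (\<Union>i<n. B i) \<in> borel_measurable borel" for n using Bm by (intro borel_measurable_indicator) auto
      show "(\<lambda>n. indicator (\<Union>i<n. B i) t :: complex) \<longlonglongrightarrow> indicator (\<Union>i. B i) t" for t
        by (rule LIMSEQ_indicator_UN)
    qed (simp add: indicator_def)
    then show "L (\<lambda>t. indicator (\<Union>i. B i) t * h (of_real t)) = 0" using part by (simp add: LIMSEQ_const_iff)
  qed auto
qed

lemma L_bounded_measurable:
  assumes h: "h \<in> PW a" and zero: "\<And>z. Im z \<noteq> 0 \<Longrightarrow> cauchy_transform h z = 0"
    and m: "m \<in> borel_measurable borel" "\<And>t. cmod (m t) \<le> c"
  shows "L (\<lambda>t. m t * h (of_real t)) = 0"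
proof -
  have h2: "(\<lambda>t. h (of_real t)) \<in> L2_functions \<mu>" by (rule PW_L2[OF h])
  obtain s where s: "\<And>i. simple_function borel (s i)" "\<And>t. (\<lambda>i. s i t) \<longlonglongrightarrow> m t" "\<And>i t. cmod (s i t) \<le> 2 * cmod (m t)"
    using borel_measurable_implies_sequence_metric[OF m(1), of 0] by (auto simp: dist_norm)
  have sb: "cmod (s i t) \<le> 2 * c" for i t using s(3)[of i t] m(2)[of t] by linarith
  have sm: "s i \<in> borel_measurable borel" for i by (rule borel_measurable_simple_function[OF s(1)])
  have "L (\<lambda>t. s i t * h (of_real t)) = 0" for i
  proof -
    have fin: "finite (range (s i))" using simple_functionD(1)[OF s(1)[of i]] by simp
    have Am: "s i -` {y} \<in> sets borel" for y using simple_functionD(2)[OF s(1)[of i], of "{y}"] by simp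
    have i2: "(\<lambda>t. indicator A t * h (of_real t)) \<in> L2_functions \<mu>" if "A \<in> sets borel" for A
      using that by (intro L2_bounded_mult(1)[OF h2 meas, of _ 1]) (auto simp: indicator_def)
    have "(\<lambda>t. (\<Sum>y\<in>Y. y * (indicator (s i -` {y}) t * h (of_real t)))) \<in> L2_functions \<mu> \<and>
        L (\<lambda>t. (\<Sum>y\<in>Y. y * (indicator (s i -` {y}) t * h (of_real t)))) = 0" if "finite Y" for Y
      using that
    proof induction
      case empty
      then show ?case using L_scale[OF h2, of 0] L2_scale[OF h2, of 0] by simp
    next
      case (insert y Y)
      then show ?case
        using L_lin[OF i2[OF Am[of y]] conjunct1[OF insert.IH], of y 1] L2_linear_combination[OF i2[OF Am[of y]] conjunct1[OF insert.IH], of y 1]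
          L_indicator_borel[OF h zero Am[of y]] by simp
    qed
    from conjunct2[OF this[OF fin]]
    have "L (\<lambda>t. (\<Sum>y\<in>range (s i). y * (indicator (s i -` {y}) t * h (of_real t)))) = 0" .
    moreover have "(\<Sum>y\<in>range (s i). y * (indicator (s i -` {y}) t * h (of_real t))) = s i t * h (of_real t)" for t
    proof -
      have "(\<Sum>y\<in>range (s i). y * (indicator (s i -` {y}) t * h (of_real t))) = (\<Sum>y\<in>range (s i). if y = s i t then s i t * h (of_real t) else 0)"
        by (intro sum.cong) (auto simp: indicator_def)
      then show ?thesis using fin by simp
    qed
    ultimately show ?thesis by simp
  qed
  then have "(\<lambda>i. 0) \<longlonglongrightarrow> L (\<lambda>t. m t * h (of_real t))"
    using L_dominated_limit[OF h2 sm sb s(2)] by simp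
  then show ?thesis by (simp add: LIMSEQ_const_iff)
qed

text \<open>Otherwise \<open>L\<close> would vanish on \<open>m h\<close> for every bounded Borel function \<open>m\<close>. Choosing \<open>h\<close> without
  zeros on \<open>[- n, n]\<close>, one can write truncations of \<open>g\<close> in this form, and \<open>L g\<close> would be zero.\<close>

theorem cauchy_transform_nontrivial:
  assumes g: "g \<in> L2_functions \<mu>" "L g \<noteq> 0"
  shows "\<exists>h\<in>PW a. \<exists>z. Im z \<noteq> 0 \<and> cauchy_transform h z \<noteq> 0"
proof (rule ccontr)
  assume "\<not> ?thesis"
  then have zero: "cauchy_transform h z = 0" if "h \<in> PW a" "Im z \<noteq> 0" for h z using that by blast
  have gm: "g \<in> borel_measurable borel" using g(1) measurable_cong_sets[OF sets_\<mu> refl] by (auto simp: L2_functions_iff)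
  have "L (\<lambda>t. indicator {- real n..real n} t * g t) = 0" for n
  proof -
    obtain h where h: "h \<in> PW a" "\<And>t. \<bar>t\<bar> \<le> real n \<Longrightarrow> h (of_real t) \<noteq> 0" using PW_nonvanishing[OF a_pos, of "real n"] by auto
    have hm: "(\<lambda>t::real. h (of_real t)) \<in> borel_measurable borel" by (rule PW_measurable[OF h(1) refl])
    define B where "B j = {t. cmod (g t) \<le> real j * cmod (h (of_real t))} \<inter> {- real n..real n}" for j
    have Bm: "B j \<in> sets borel" for j
    proof -
      have "{t \<in> space borel. cmod (g t) \<le> real j * cmod (h (of_real t))} \<in> sets borel" using gm hm by measurable
      then show ?thesis by (auto simp: B_def)
    qed
    have "L (\<lambda>t. indicator (B j) t * g t) = 0" for j
    proof -
      have eq: "(\<lambda>t. indicator (B j) t * g t) = (\<lambda>t. (indicator (B j) t * g t / h (of_real t)) * h (of_real t))"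
      proof
        fix t
        have "h (of_real t) \<noteq> 0" if "t \<in> B j" using h(2)[of t] that by (auto simp: B_def abs_le_iff)
        then show "indicator (B j) t * g t = (indicator (B j) t * g t / h (of_real t)) * h (of_real t)"
          by (cases "t \<in> B j") auto
      qed
      show ?thesis unfolding eq
      proof (rule L_bounded_measurable[OF h(1) zero[OF h(1)]])
        show "(\<lambda>t. indicator (B j) t * g t / h (of_real t)) \<in> borel_measurable borel" using Bm gm hm by measurable
        show "cmod (indicator (B j) t * g t / h (of_real t)) \<le> real j" for t
        proof (cases "t \<in> B j")
          case True
          then have "cmod (g t) \<le> real j * cmod (h (of_real t))" "h (of_real t) \<noteq> 0" using h(2)[of t] by (auto simp: B_def abs_le_iff)
          then show ?thesis using True by (simp add: norm_divide divide_le_eq)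
        qed simp
      qed
    qed
    moreover have "(\<lambda>j. L (\<lambda>t. indicator (B j) t * g t)) \<longlonglongrightarrow> L (\<lambda>t. indicator {- real n..real n} t * g t)"
    proof (rule L_dominated_limit[OF g(1), of _ 1])
      show "indicator (B j) \<in> borel_measurable borel" for j using Bm by (intro borel_measurable_indicator)
      fix t :: real
      show "(\<lambda>j. indicator (B j) t :: complex) \<longlonglongrightarrow> indicator {- real n..real n} t"
      proof (cases "t \<in> {- real n..real n}")
        case True
        then have ht: "cmod (h (of_real t)) > 0" using h(2)[of t] by (auto simp: abs_le_iff)
        obtain J where J: "cmod (g t) / cmod (h (of_real t)) \<le> real J" using real_arch_simple by blast
        have "eventually (\<lambda>j. t \<in> B j) sequentially"
          using eventually_ge_at_top[of J]
        proof eventually_elim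
          case (elim j)
          then have "cmod (g t) / cmod (h (of_real t)) \<le> real j" using J by linarith
          then show ?case using ht True by (simp add: B_def pos_divide_le_eq)
        qed
        then have "eventually (\<lambda>j. (indicator (B j) t :: complex) = indicator {- real n..real n} t) sequentially"
          by eventually_elim (use True in simp)
        then show ?thesis by (rule tendsto_eventually)
      qed (simp add: B_def)
    qed (simp add: indicator_def)
    ultimately have "(\<lambda>j::nat. 0) \<longlonglongrightarrow> L (\<lambda>t. indicator {- real n..real n} t * g t)" by simp
    then show ?thesis by (simp add: LIMSEQ_const_iff)
  qed
  moreover have "(\<lambda>n. L (\<lambda>t. indicator {- real n..real n} t * g t)) \<longlonglongrightarrow> L (\<lambda>t. 1 * g t)"
  proof (rule L_dominated_limit[OF g(1), of _ 1])
    fix t :: real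
    have "eventually (\<lambda>n. (indicator {- real n..real n} t :: complex) = 1) sequentially"
      using eventually_ge_at_top[of "nat \<lceil>\<bar>t\<bar>\<rceil>"] by eventually_elim (simp add: indicator_def, linarith)
    then show "(\<lambda>n. indicator {- real n..real n} t :: complex) \<longlonglongrightarrow> 1" by (rule tendsto_eventually)
  qed (auto simp: indicator_def)
  ultimately have "(\<lambda>n::nat. 0) \<longlonglongrightarrow> L g" by simp
  then show False using g(2) by (simp add: LIMSEQ_const_iff)
qed

end

section \<open>Growth of transforms when density fails\<close>

context annihilating_functional
begin

lemma nrm_reflect: "nrm (\<lambda>z. cnj (F (cnj z))) = nrm F"
  by (simp add: PW_norm_def sq_norm_def)

text \<open>Let \<open>\<Phi>\<close> be the Cauchy transform of \<open>h\<close>. The number \<open>cs\<close> is the largest \<open>c\<close> with \<open>\<bar>\<Phi>(z)\<bar> \<le> M exp (- c (Im z - 1))\<close>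
  for \<open>Im z \<ge> 1\<close>. By maximality, \<open>\<Phi>(z) exp (- i cs (z - i)) / M\<close>, which is bounded by 1, exceeds
  \<open>exp (- e (Im z0 - 1))\<close> in modulus at some \<open>z0\<close>, for any given \<open>e > 0\<close>; this smallness of \<open>e\<close> becomes the factor \<open>\<eta>\<close>.
  Then \<open>f(z) = F(z) exp (i B z)\<close> is estimated by \<open>quotient_bound_half_plane\<close> with this function as denominator.
  For \<open>Im z \<ge> 2\<close> the half-plane \<open>Im z > 1\<close> is used. For smaller \<open>Im z\<close> it is \<open>Im z > s\<close> with \<open>s = Im z / 2\<close>,
  where the bound \<open>\<bar>\<Phi>\<bar> \<le> M / s\<close> costs an additional \<open>- ln s\<close>, absorbed by the term with \<open>D\<close>. It is
  essential that \<open>B\<close> does not depend on \<open>\<eta>\<close>.\<close>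

lemma growth_off_axis:
  assumes h: "h \<in> PW a" and z1: "Im z1 > 0" "cauchy_transform h z1 \<noteq> 0"
  shows "\<exists>B C1. B \<ge> 0 \<and> C1 > 0 \<and> (\<forall>\<eta>>0. \<exists>D>0. \<forall>F\<in>PW a. \<forall>z. Im z \<noteq> 0 \<longrightarrow>
     cmod (F z) \<le> (C1 * nrm F) * exp (off_axis_exponent B \<eta> D z))"
proof -
  define \<Phi> where "\<Phi> = cauchy_transform h"
  have \<Phi>_hol: "\<Phi> holomorphic_on {z. Im z > 0}" unfolding \<Phi>_def by (rule cauchy_transform_holomorphic[OF h])
  define M where "M = K * nrm h + 1"
  have M: "M > 0" using K_pos PW_norm_nonneg[of \<mu> h] by (simp add: M_def add_nonneg_pos)
  have \<Phi>_le: "cmod (\<Phi> z) \<le> M / Im z" if "Im z > 0" for z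
  proof -
    have "cmod (\<Phi> z) \<le> K * nrm h / Im z" unfolding \<Phi>_def using cauchy_transform_bound[OF h, of z] that by simp
    also have "\<dots> \<le> M / Im z" using that by (intro divide_right_mono) (auto simp: M_def)
    finally show ?thesis .
  qed
  have "\<exists>z2. Im z2 > 1 \<and> \<Phi> z2 \<noteq> 0"
  proof (rule ccontr)
    assume "\<not> ?thesis"
    then have z: "\<Phi> z = 0" if "Im z > 1" for z using that by blast
    have "\<Phi> z1 = 0"
    proof (rule analytic_continuation[OF \<Phi>_hol, where U = "{z. Im z > 1}" and \<xi> = "2 * \<i>"])
      show "open {z. 0 < Im z}" by (rule open_halfspace_Im_gt)
      show "connected {z. 0 < Im z}" by (intro convex_connected convex_halfspace_Im_gt)
      show "2 * \<i> islimpt {z. 1 < Im z}"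
        by (rule open_imp_islimpt[OF open_halfspace_Im_gt]) auto
    qed (use z z1 in auto)
    then show False using z1(2) by (simp add: \<Phi>_def)
  qed
  then obtain z2 where z2: "Im z2 > 1" "\<Phi> z2 \<noteq> 0" by blast
  define S where "S = {c. c \<ge> 0 \<and> (\<forall>z. Im z \<ge> 1 \<longrightarrow> cmod (\<Phi> z) \<le> M * exp (- c * (Im z - 1)))}"
  have S0: "0 \<in> S"
  proof -
    have "cmod (\<Phi> z) \<le> M" if "Im z \<ge> 1" for z
    proof -
      have "M / Im z \<le> M / 1" using that M by (intro divide_left_mono) auto
      then show ?thesis using \<Phi>_le[of z] that by simp
    qed
    then show ?thesis by (simp add: S_def)
  qed
  have S_bdd: "bdd_above S"
  proof (rule bdd_aboveI)
    fix c assume "c \<in> S"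
    then have "cmod (\<Phi> z2) \<le> M * exp (- c * (Im z2 - 1))" using z2 by (auto simp: S_def)
    moreover have "exp (- c * (Im z2 - 1)) = inverse (exp (c * (Im z2 - 1)))" by (simp only: mult_minus_left exp_minus)
    ultimately have "cmod (\<Phi> z2) \<le> M / exp (c * (Im z2 - 1))" by (simp add: divide_inverse)
    then have "cmod (\<Phi> z2) * exp (c * (Im z2 - 1)) \<le> M" by (simp only: pos_le_divide_eq exp_gt_zero)
    then have "exp (c * (Im z2 - 1)) \<le> M / cmod (\<Phi> z2)" using z2 by (simp add: field_simps)
    moreover have "c * (Im z2 - 1) \<le> exp (c * (Im z2 - 1))" using exp_ge_add_one_self[of "c * (Im z2 - 1)"] by linarith
    ultimately show "c \<le> (M / cmod (\<Phi> z2)) / (Im z2 - 1)" using z2 by (subst pos_le_divide_eq) auto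
  qed
  define cs where "cs = Sup S"
  have cs0: "cs \<ge> 0" unfolding cs_def by (rule cSup_upper[OF S0 S_bdd])
  have csS: "cmod (\<Phi> z) \<le> M * exp (- cs * (Im z - 1))" if z: "Im z \<ge> 1" for z
  proof (rule ccontr)
    assume neg: "\<not> ?thesis"
    then have pos: "cmod (\<Phi> z) > 0" using M by (smt (verit) exp_gt_zero mult_pos_pos)
    have y: "Im z > 1"
    proof (rule ccontr)
      assume "\<not> Im z > 1"
      then have "Im z = 1" using z by simp
      then show False using neg S0 by (auto simp: S_def)
    qed
    define c where "c = ln (M / cmod (\<Phi> z)) / (Im z - 1)"
    have ec: "M * exp (- c * (Im z - 1)) = cmod (\<Phi> z)"
    proof -
      have "- c * (Im z - 1) = - ln (M / cmod (\<Phi> z))" using y by (simp add: c_def)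
      then show ?thesis using M pos by (simp add: exp_minus)
    qed
    have "exp (- cs * (Im z - 1)) < exp (- c * (Im z - 1))" using neg ec M by (smt (verit) mult_le_cancel_left_pos)
    then have "c < cs" using y by simp
    then obtain c' where c': "c' \<in> S" "c < c'" unfolding cs_def using less_cSup_iff[OF _ S_bdd] S0 by blast
    then have "cmod (\<Phi> z) \<le> M * exp (- c' * (Im z - 1))" using z by (auto simp: S_def)
    also have "\<dots> < M * exp (- c * (Im z - 1))" using c' y M by simp
    finally show False using ec by simp
  qed
  obtain Ch where Ch: "Ch \<ge> 0" "\<And>z. cmod (h z) \<le> Ch * exp (a * \<bar>Im z\<bar>)" using PW_growth[OF h] by blast
  define B where "B = a + cs"
  define C1 where "C1 = (Ch + 1) * K / M"
  have C1: "C1 > 0" using Ch K_pos M by (simp add: C1_def)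
  have B: "B \<ge> 0" using a_pos cs0 by (simp add: B_def)
  \<comment> \<open>The function \<open>\<Phi> z0 * exp (- i cs (z0 - i))\<close> is to be bounded below by \<open>M exp (- \<kappa>)\<close>; \<open>s\<close> is the height of the half-plane.\<close>
  have half: "cmod (F z) \<le> (C1 * nrm F) * exp (B * Im z + (\<kappa> - ln s) * ((cmod z + cmod z0)\<^sup>2 / ((Im z - s) * (Im z0 - s))))"
    if F: "F \<in> PW a" and s: "0 < s" "s \<le> 1" and z: "Im z > s" and z0: "Im z0 > s" and \<kappa>: "\<kappa> \<ge> 0"
      and low: "M * exp (- \<kappa>) \<le> cmod (\<Phi> z0 * exp (- \<i> * of_real cs * (z0 - \<i>)))" for F s z z0 \<kappa>
  proof -
    define f where "f z = F z * exp (\<i> * of_real B * z)" for z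
    define g where "g z = of_real (s / M) * (\<Phi> z * exp (- \<i> * of_real cs * (z - \<i>)))" for z
    have ncs: "cmod (exp (- \<i> * of_real cs * (w - \<i>))) = exp (cs * (Im w - 1))" for w by (simp add: algebra_simps)
    have nB: "cmod (exp (\<i> * of_real B * w)) = exp (- B * Im w)" for w by simp
    have g_le: "cmod (g w) \<le> 1" if w: "Im w > s" for w
    proof (cases "Im w \<ge> 1")
      case True
      have "cmod (\<Phi> w) * exp (cs * (Im w - 1)) \<le> M * exp (- cs * (Im w - 1)) * exp (cs * (Im w - 1))"
        using csS[OF True] by (intro mult_right_mono) auto
      also have "\<dots> = M" by (simp add: exp_minus)
      finally have "s / M * (cmod (\<Phi> w) * exp (cs * (Im w - 1))) \<le> s / M * M" using s M by (intro mult_left_mono) auto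
      moreover have "s / M * M = s" using M by simp
      ultimately have "s / M * (cmod (\<Phi> w) * exp (cs * (Im w - 1))) \<le> 1" using s by linarith
      then show ?thesis unfolding g_def norm_mult ncs norm_of_real using s M by simp
    next
      case False
      have "cmod (\<Phi> w) * exp (cs * (Im w - 1)) \<le> M / Im w * 1"
        using \<Phi>_le[of w] w s M False cs0 by (intro mult_mono) (auto simp: mult_nonneg_nonpos)
      then have "s / M * (cmod (\<Phi> w) * exp (cs * (Im w - 1))) \<le> s / M * (M / Im w)" using s M by (intro mult_left_mono) auto
      also have "\<dots> = s / Im w" using M by simp
      also have "\<dots> \<le> 1" using w s by simp
      finally show ?thesis unfolding g_def norm_mult ncs norm_of_real using s M by simp
    qed
    have fg: "cmod (f w * g w) \<le> C1 * nrm F" if w: "Im w > s" for w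
    proof -
      have w0: "Im w > 0" using w s by simp
      have "cmod (F w) * cmod (\<Phi> w) = cmod (h w) * cmod (cauchy_transform F w)"
        using arg_cong[OF cauchy_transform_swap[OF F h, of w], of cmod] w0 by (simp add: \<Phi>_def norm_mult)
      also have "\<dots> \<le> (Ch * exp (a * Im w)) * (K * nrm F / Im w)"
        using Ch(2)[of w] cauchy_transform_bound[OF F, of w] w0 Ch(1) by (intro mult_mono) auto
      finally have 1: "cmod (F w) * cmod (\<Phi> w) \<le> Ch * exp (a * Im w) * (K * nrm F / Im w)" .
      have "cmod (f w * g w) = (cmod (F w) * cmod (\<Phi> w)) * (s / M * exp (cs * (Im w - 1) - B * Im w))"
        unfolding f_def g_def norm_mult ncs nB norm_of_real using s M
        by (simp add: exp_diff[of "cs * (Im w - 1)"] exp_minus divide_inverse mult_ac)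
      also have "\<dots> \<le> (Ch * exp (a * Im w) * (K * nrm F / Im w)) * (s / M * exp (cs * (Im w - 1) - B * Im w))"
        using 1 s M by (intro mult_right_mono) auto
      also have "\<dots> = Ch * K / M * nrm F * (s / Im w) * (exp (a * Im w) * exp (cs * (Im w - 1) - B * Im w))" by (simp add: mult_ac)
      also have "exp (a * Im w) * exp (cs * (Im w - 1) - B * Im w) = exp (- cs)"
        by (simp add: exp_add[symmetric] B_def algebra_simps)
      also have "Ch * K / M * nrm F * (s / Im w) * exp (- cs) \<le> C1 * nrm F * 1 * 1"
      proof (intro mult_mono)
        show "Ch * K / M \<le> C1" unfolding C1_def using K_pos M by (intro divide_right_mono mult_right_mono) auto
      qed (use Ch K_pos M C1 PW_norm_nonneg[of \<mu> F] s w w0 cs0 in auto)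
      finally show ?thesis by simp
    qed
    define H where "H = exp ((\<kappa> - ln s) * ((cmod z + cmod z0)\<^sup>2 / ((Im z - s) * (Im z0 - s))))"
    have hol: "F holomorphic_on S" for S using PW_entire[OF F] holomorphic_on_subset by blast
    have g0: "exp (- (\<kappa> - ln s)) \<le> cmod (g z0)"
    proof -
      have "exp (- (\<kappa> - ln s)) = s * exp (- \<kappa>)" using s by (simp add: exp_diff exp_minus field_simps)
      also have "\<dots> = s / M * (M * exp (- \<kappa>))" using M by simp
      also have "\<dots> \<le> s / M * cmod (\<Phi> z0 * exp (- \<i> * of_real cs * (z0 - \<i>)))" using s M low by (intro mult_left_mono) auto
      also have "\<dots> = cmod (g z0)" unfolding g_def norm_mult[of "of_real (s / M)"] norm_of_real using s M by simp
      finally show ?thesis .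
    qed
    have eps: "cmod (f z) \<le> (C1 * nrm F + e) * H" if e: "e > 0" for e
      unfolding H_def
    proof (rule quotient_bound_half_plane[where g = g and s = s])
      show "f holomorphic_on {z. s < Im z}" unfolding f_def by (intro holomorphic_intros hol)
      show "g holomorphic_on {z. s < Im z}" unfolding g_def using s
        by (intro holomorphic_intros holomorphic_on_subset[OF \<Phi>_hol]) auto
      have "ln s \<le> 0" using s by simp
      then show "0 \<le> \<kappa> - ln s" using \<kappa> by linarith
      show "0 < C1 * nrm F + e" using C1 PW_norm_nonneg[of \<mu> F] e by (simp add: add_nonneg_pos)
      show "cmod (f w * g w) \<le> C1 * nrm F + e" if "s < Im w" for w using fg[OF that] e by simp
    qed (use g_le g0 z z0 s in auto)
    have "cmod (f z) \<le> C1 * nrm F * H"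
    proof (rule field_le_epsilon)
      fix e :: real assume e: "e > 0"
      have H: "H > 0" by (simp add: H_def)
      then show "cmod (f z) \<le> C1 * nrm F * H + e" using eps[of "e / H"] e by (simp add: distrib_right)
    qed
    moreover have "cmod (F z) = cmod (f z) * exp (B * Im z)" unfolding f_def norm_mult nB by (simp add: exp_minus)
    ultimately have "cmod (F z) \<le> C1 * nrm F * H * exp (B * Im z)" by simp
    then show ?thesis by (simp add: H_def exp_add mult_ac)
  qed
  have upper: "\<exists>D>0. \<forall>F\<in>PW a. \<forall>z. Im z > 0 \<longrightarrow>
     cmod (F z) \<le> (C1 * nrm F) * exp (off_axis_exponent B \<eta> D z)"
    if \<eta>: "\<eta> > 0" for \<eta>
  proof -
    \<comment> \<open>One factor 2 is lost in \<open>Im z - 1 \<ge> Im z / 2\<close>, another in \<open>(\<bar>z\<bar> + \<bar>z0\<bar>)\<^sup>2 \<le> 2 \<bar>z\<bar>\<^sup>2 + 2 \<bar>z0\<bar>\<^sup>2\<close>.\<close>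
    define e where "e = \<eta> / 4"
    have e: "e > 0" using \<eta> by (simp add: e_def)
    have "cs + e \<notin> S"
    proof
      assume "cs + e \<in> S"
      then have "cs + e \<le> cs" unfolding cs_def by (rule cSup_upper[OF _ S_bdd])
      then show False using e by simp
    qed
    then obtain z0 where z0: "Im z0 \<ge> 1" "cmod (\<Phi> z0) > M * exp (- (cs + e) * (Im z0 - 1))"
    proof -
      have "\<not> (\<forall>z. Im z \<ge> 1 \<longrightarrow> cmod (\<Phi> z) \<le> M * exp (- (cs + e) * (Im z - 1)))"
        using \<open>cs + e \<notin> S\<close> cs0 e unfolding S_def mem_Collect_eq by (simp del: minus_add_distrib)
      then show ?thesis using that by (meson not_le)
    qed
    have y0: "Im z0 > 1"
    proof (rule ccontr)
      assume "\<not> Im z0 > 1"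
      then have "Im z0 = 1" using z0 by simp
      then show False using z0 csS[of z0] by simp
    qed
    define q where "q = Im z0 - 1"
    have q: "q > 0" using y0 by (simp add: q_def)
    have low: "M * exp (- (e * q)) \<le> cmod (\<Phi> z0 * exp (- \<i> * of_real cs * (z0 - \<i>)))"
    proof -
      have "cmod (exp (- \<i> * of_real cs * (z0 - \<i>))) = exp (cs * q)" by (simp add: algebra_simps q_def)
      then have "cmod (\<Phi> z0 * exp (- \<i> * of_real cs * (z0 - \<i>))) = cmod (\<Phi> z0) * exp (cs * q)" by (simp only: norm_mult)
      moreover have "M * exp (- (cs + e) * q) * exp (cs * q) \<le> cmod (\<Phi> z0) * exp (cs * q)"
        using z0(2) by (intro mult_right_mono) (auto simp: q_def)
      moreover have "M * exp (- (cs + e) * q) * exp (cs * q) = M * exp (- (e * q))"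
        by (simp add: exp_add[symmetric] mult.assoc algebra_simps)
      ultimately show ?thesis by (simp only:)
    qed
    define W where "W = 1 + cmod z0"
    have W: "W \<ge> 1" by (simp add: W_def)
    define D where "D = \<eta> * (cmod z0)\<^sup>2 + (4 * e * q + 4) * W\<^sup>2 / q"
    have D1: "\<eta> * (cmod z0)\<^sup>2 \<le> D" "(4 * e * q + 4) * W\<^sup>2 / q \<le> D" using q e \<eta> by (auto simp: D_def)
    have D0: "D > 0"
    proof -
      have "(4 * e * q + 4) * W\<^sup>2 / q > 0" using q e W by (intro divide_pos_pos mult_pos_pos) (auto intro: add_nonneg_pos)
      then show ?thesis using D1 by linarith
    qed
    have "cmod (F z) \<le> (C1 * nrm F) * exp (off_axis_exponent B \<eta> D z)"
      if F: "F \<in> PW a" and z: "Im z > 0" for F z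
    proof -
      define y where "y = Im z"
      define R where "R = 1 + cmod z"
      have y: "y > 0" using z by (simp add: y_def)
      have R: "R \<ge> 1" "y \<le> R" using abs_Im_le_cmod[of z] by (auto simp: R_def y_def)
      have mono: "cmod (F z) \<le> (C1 * nrm F) * exp (off_axis_exponent B \<eta> D z)"
        if "cmod (F z) \<le> (C1 * nrm F) * exp (B * y + E)" "E \<le> \<eta> * R\<^sup>2 / y + D * R\<^sup>2 / y\<^sup>2" for E
      proof -
        have "exp (B * y + E) \<le> exp (off_axis_exponent B \<eta> D z)"
          using that(2) z by (simp add: y_def R_def)
        then have "(C1 * nrm F) * exp (B * y + E) \<le> (C1 * nrm F) * exp (off_axis_exponent B \<eta> D z)"
          using C1 PW_norm_nonneg[of \<mu> F] by (intro mult_left_mono) auto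
        then show ?thesis using that(1) by linarith
      qed
      show ?thesis
      proof (cases "y \<ge> 2")
        case True
        have "cmod (F z) \<le> (C1 * nrm F) * exp (B * y + (e * q - ln 1) * ((cmod z + cmod z0)\<^sup>2 / ((y - 1) * (Im z0 - 1))))"
          unfolding y_def by (rule half[OF F _ _ _ _ _ low]) (use True y0 e q in \<open>auto simp: y_def\<close>)
        then show ?thesis
        proof (rule mono)
          have "(e * q - ln 1) * ((cmod z + cmod z0)\<^sup>2 / ((y - 1) * (Im z0 - 1))) = e * (cmod z + cmod z0)\<^sup>2 / (y - 1)"
            using q by (simp add: q_def[symmetric])
          also have "\<dots> \<le> e * (cmod z + cmod z0)\<^sup>2 / (y / 2)" using True e by (intro divide_left_mono) auto
          also have "\<dots> \<le> e * (2 * R\<^sup>2 + 2 * (cmod z0)\<^sup>2) / (y / 2)"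
          proof (intro divide_right_mono mult_left_mono)
            have "(cmod z + cmod z0)\<^sup>2 \<le> 2 * (cmod z)\<^sup>2 + 2 * (cmod z0)\<^sup>2"
              using sum_squares_bound[of "cmod z" "cmod z0"] by (simp add: power2_sum)
            moreover have "(cmod z)\<^sup>2 \<le> R\<^sup>2" by (intro power_mono) (auto simp: R_def)
            ultimately show "(cmod z + cmod z0)\<^sup>2 \<le> 2 * R\<^sup>2 + 2 * (cmod z0)\<^sup>2" by linarith
          qed (use e y in auto)
          also have "\<dots> = \<eta> * R\<^sup>2 / y + \<eta> * (cmod z0)\<^sup>2 * (1 / y)" using y by (simp add: e_def field_simps)
          also have "\<dots> \<le> \<eta> * R\<^sup>2 / y + D * (R\<^sup>2 / y\<^sup>2)"
          proof (intro add_left_mono mult_mono D1)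
            have "y * 1 \<le> R * R" using R y by (intro mult_mono) auto
            then show "1 / y \<le> R\<^sup>2 / y\<^sup>2" using y by (simp add: field_simps power2_eq_square)
          qed (use D0 y in auto)
          finally show "(e * q - ln 1) * ((cmod z + cmod z0)\<^sup>2 / ((y - 1) * (Im z0 - 1))) \<le> \<eta> * R\<^sup>2 / y + D * R\<^sup>2 / y\<^sup>2" by simp
        qed
      next
        case False
        define s where "s = y / 2"
        have s: "0 < s" "s \<le> 1" "s < y" using y False by (auto simp: s_def)
        have "cmod (F z) \<le> (C1 * nrm F) * exp (B * y + (e * q - ln s) * ((cmod z + cmod z0)\<^sup>2 / ((y - s) * (Im z0 - s))))"
          unfolding y_def by (rule half[OF F s(1,2) _ _ _ low]) (use s y0 e q in \<open>auto simp: y_def\<close>)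
        then show ?thesis
        proof (rule mono)
          have "- ln s = ln (1 / s)" using s by (simp add: ln_div)
          also have "\<dots> \<le> 1 / s - 1" using s by (intro ln_le_minus_one) auto
          finally have "e * q - ln s \<le> e * q * 1 + 2 / y" by (simp add: s_def)
          also have "\<dots> \<le> e * q * (2 / y) + 2 / y" using False y e q by (intro add_right_mono mult_left_mono) auto
          also have "\<dots> = (2 * e * q + 2) / y" by (simp add: add_divide_distrib)
          finally have 1: "e * q - ln s \<le> (2 * e * q + 2) / y" .
          have 2: "(cmod z + cmod z0)\<^sup>2 \<le> W\<^sup>2 * R\<^sup>2"
          proof -
            have "cmod z + cmod z0 \<le> W * R" by (simp add: W_def R_def algebra_simps)
            then have "(cmod z + cmod z0)\<^sup>2 \<le> (W * R)\<^sup>2" by (intro power_mono) auto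
            then show ?thesis by (simp add: power_mult_distrib)
          qed
          have 3: "(y / 2) * q \<le> (y - s) * (Im z0 - s)"
            using y q s by (intro mult_mono) (auto simp: s_def q_def)
          have "(cmod z + cmod z0)\<^sup>2 / ((y - s) * (Im z0 - s)) \<le> (W\<^sup>2 * R\<^sup>2) / ((y / 2) * q)"
            using 2 3 y q by (intro frac_le) auto
          then have "(e * q - ln s) * ((cmod z + cmod z0)\<^sup>2 / ((y - s) * (Im z0 - s))) \<le> ((2 * e * q + 2) / y) * ((W\<^sup>2 * R\<^sup>2) / ((y / 2) * q))"
            using 1 e q y s y0 by (intro mult_mono) (auto intro!: divide_nonneg_nonneg mult_nonneg_nonneg)
          also have "\<dots> = ((4 * e * q + 4) * W\<^sup>2 / q) * (R\<^sup>2 / y\<^sup>2)" using y q by (simp add: field_simps power2_eq_square)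
          also have "\<dots> \<le> D * (R\<^sup>2 / y\<^sup>2)" by (intro mult_right_mono D1) auto
          also have "\<dots> \<le> \<eta> * R\<^sup>2 / y + D * R\<^sup>2 / y\<^sup>2" using \<eta> y by simp
          finally show "(e * q - ln s) * ((cmod z + cmod z0)\<^sup>2 / ((y - s) * (Im z0 - s))) \<le> \<eta> * R\<^sup>2 / y + D * R\<^sup>2 / y\<^sup>2" .
        qed
      qed
    qed
    then show ?thesis using D0 by blast
  qed
  have "\<exists>D>0. \<forall>F\<in>PW a. \<forall>z. Im z \<noteq> 0 \<longrightarrow>
     cmod (F z) \<le> (C1 * nrm F) * exp (off_axis_exponent B \<eta> D z)"
    if \<eta>: "\<eta> > 0" for \<eta>
  proof -
    obtain D where D: "D > 0" "\<And>F z. F \<in> PW a \<Longrightarrow> Im z > 0 \<Longrightarrow>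
     cmod (F z) \<le> (C1 * nrm F) * exp (off_axis_exponent B \<eta> D z)"
      using upper[OF \<eta>] by blast
    show ?thesis
    proof (intro exI[of _ D] conjI D(1) ballI allI impI)
      fix F z assume F: "F \<in> PW a" and z: "Im z \<noteq> 0"
      show "cmod (F z) \<le> (C1 * nrm F) * exp (off_axis_exponent B \<eta> D z)"
      proof (cases "Im z > 0")
        case False
        then have "Im (cnj z) > 0" using z by simp
        from D(2)[OF PW_reflect[OF F] this] show ?thesis by (simp add: nrm_reflect)
      qed (rule D(2)[OF F])
    qed
  qed
  then show ?thesis using B C1 by blast
qed

end

lemma cnj_L2:
  assumes "k \<in> L2_functions \<mu>"
  shows "(\<lambda>t. cnj (k t)) \<in> L2_functions \<mu>"
proof -
  have [measurable]: "k \<in> borel_measurable \<mu>" using assms by (simp add: L2_functions_iff)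
  have "(\<lambda>t. cnj (k t)) \<in> borel_measurable \<mu>"
    by (rule measurable_compose[OF _ borel_measurable_continuous_onI[OF continuous_on_cnj[OF continuous_on_id]]]) measurable
  then show ?thesis using assms by (simp add: L2_functions_iff)
qed

text \<open>Conjugation interchanges the two half-planes, so a Cauchy transform that is non-trivial in the lower
  half-plane yields one that is non-trivial in the upper half-plane.\<close>

lemma (in annihilating_functional) conjugate_functional:
  "annihilating_functional \<mu> a (\<lambda>k. cnj (L (\<lambda>t. cnj (k t)))) K"
proof
  show "sets \<mu> = sets borel" "polynomial_growth \<mu>" "a > 0" "K > 0" by (rule sets_\<mu> growth a_pos K_pos)+
  show "cnj (L (\<lambda>t. cnj (c * k t + d * l t))) = c * cnj (L (\<lambda>t. cnj (k t))) + d * cnj (L (\<lambda>t. cnj (l t)))"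
    if "k \<in> L2_functions \<mu>" "l \<in> L2_functions \<mu>" for k l c d
    using L_lin[OF cnj_L2[OF that(1)] cnj_L2[OF that(2)], of "cnj c" "cnj d"] by simp
  show "cmod (cnj (L (\<lambda>t. cnj (k t)))) \<le> K * sqrt (sq_norm \<mu> k)" if "k \<in> L2_functions \<mu>" for k
    using L_bound[OF cnj_L2[OF that]] by (simp add: sq_norm_def)
  show "cnj (L (\<lambda>t. cnj (F (of_real t)))) = 0" if "F \<in> PW a" for F
    using L_PW[OF PW_reflect[OF that]] by simp
qed

lemma non_dense_growth:
  assumes sets: "sets \<mu> = sets borel" and gr: "polynomial_growth \<mu>" and a: "a > 0"
    and nd: "\<not> dense_in_L2 (fourier_space a) \<mu>"
  shows "\<exists>B C1. B \<ge> 0 \<and> C1 > 0 \<and> (\<forall>\<eta>>0. \<exists>D>0. \<forall>F\<in>PW a. \<forall>z. Im z \<noteq> 0 \<longrightarrow>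
     cmod (F z) \<le> (C1 * PW_norm \<mu> F) * exp (off_axis_exponent B \<eta> D z))"
proof -
  let ?V = "(\<lambda>F t. F (complex_of_real t)) ` PW a"
  have V: "fourier_space a = ?V" by (rule fourier_space_eq[OF a])
  have lin: "(\<lambda>t. c * v t + d * w t) \<in> ?V" if "v \<in> ?V" "w \<in> ?V" for v w c d
  proof -
    obtain F G where "F \<in> PW a" "v = (\<lambda>t. F (of_real t))" "G \<in> PW a" "w = (\<lambda>t. G (of_real t))" using \<open>v \<in> ?V\<close> \<open>w \<in> ?V\<close> by blast
    then show ?thesis using PW_linear_combination[of F a G c d] by (auto simp: image_iff intro!: bexI[of _ "\<lambda>z. c * F z + d * G z"])
  qed
  have V2: "?V \<subseteq> L2_functions \<mu>" using PW_in_L2[OF sets gr] by auto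
  have V0: "?V \<noteq> {}" using PW_nonvanishing[OF a, of 0] by force
  obtain L K g where g: "g \<in> L2_functions \<mu>" "L g \<noteq> 0" and K: "K > 0"
    and L: "\<And>k l c d. k \<in> L2_functions \<mu> \<Longrightarrow> l \<in> L2_functions \<mu> \<Longrightarrow> L (\<lambda>t. c * k t + d * l t) = c * L k + d * L l"
    "\<And>k. k \<in> L2_functions \<mu> \<Longrightarrow> cmod (L k) \<le> K * sqrt (sq_norm \<mu> k)" "\<And>v. v \<in> ?V \<Longrightarrow> L v = (0::complex)"
  proof (rule exists_annihilating_functional[OF V2 V0 _ nd[unfolded V]], goal_cases)
    case 1
    from 1(2,3) show ?case by (rule lin)
  next
    case 2
    show ?case by (rule 2(1)[OF 2(2-)])
  qed
  interpret annihilating_functional \<mu> a L K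
    by unfold_locales (use sets gr a K L in auto)
  interpret cnj: annihilating_functional \<mu> a "\<lambda>k. cnj (L (\<lambda>t. cnj (k t)))" K
    by (rule conjugate_functional)
  obtain h z where h: "h \<in> PW a" and z: "Im z \<noteq> 0" "cauchy_transform h z \<noteq> 0"
    using cauchy_transform_nontrivial[OF g] by blast
  show ?thesis
  proof (cases "Im z > 0")
    case True
    show ?thesis using growth_off_axis[OF h True z(2)] .
  next
    case False
    have "cnj.cauchy_transform (\<lambda>z. cnj (h (cnj z))) (cnj z) = cnj (cauchy_transform h z)"
      by (simp add: cnj.cauchy_transform_def cauchy_transform_def)
    then have "cnj.cauchy_transform (\<lambda>z. cnj (h (cnj z))) (cnj z) \<noteq> 0" using z(2) by simp
    moreover have "Im (cnj z) > 0" using False z(1) by simp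
    ultimately show ?thesis using cnj.growth_off_axis[OF PW_reflect[OF h], of "cnj z"] by simp
  qed
qed

lemma non_dense_local_bound:
  assumes sets: "sets \<mu> = sets borel" and gr: "polynomial_growth \<mu>" and a: "a > 0"
    and nd: "\<not> dense_in_L2 (fourier_space a) \<mu>" and \<rho>: "\<rho> > 0"
  shows "\<exists>K>0. \<forall>F\<in>PW a. \<forall>z. cmod z \<le> \<rho> \<longrightarrow> cmod (F z) \<le> K * PW_norm \<mu> F"
proof -
  obtain B C1 where "B \<ge> 0" "C1 > 0" and gb: "(\<forall>\<eta>>0. \<exists>D>0. \<forall>F\<in>PW a. \<forall>z. Im z \<noteq> 0 \<longrightarrow>
     cmod (F z) \<le> (C1 * PW_norm \<mu> F) * exp (off_axis_exponent B \<eta> D z))"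
    using non_dense_growth[OF sets gr a nd] by (elim exE conjE) (rule that; assumption)
  obtain D where D: "D > 0" and bd: "\<And>F z. F \<in> PW a \<Longrightarrow> Im z \<noteq> 0 \<Longrightarrow>
     cmod (F z) \<le> (C1 * PW_norm \<mu> F) * exp (off_axis_exponent B 1 D z)"
    using gb[rule_format, OF zero_less_one] by blast
  have B: "B \<ge> 0" "C1 > 0" "D > 0" by fact+
  define r where "r = 4 * \<rho>"
  define K where "K = C1 * exp (B * r / 2 + 7 * 1 * (1 + \<bar>0\<bar> + r)\<^sup>2 / r + 30 * D * (1 + \<bar>0\<bar> + r)\<^sup>2 / r\<^sup>2)"
  have "cmod (F z) \<le> K * PW_norm \<mu> F" if F: "F \<in> PW a" and z: "cmod z \<le> \<rho>" for F z
  proof -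
    have "cmod (F z) \<le> (C1 * PW_norm \<mu> F) * exp (B * r / 2 + 7 * 1 * (1 + \<bar>0\<bar> + r)\<^sup>2 / r + 30 * D * (1 + \<bar>0\<bar> + r)\<^sup>2 / r\<^sup>2)"
      by (rule near_axis_bound[OF PW_entire[OF F] _ _ _ _ _ bd[OF F]]) (use \<rho> B z PW_norm_nonneg[of \<mu> F] in \<open>auto simp: r_def\<close>)
    then show ?thesis by (simp add: K_def mult_ac)
  qed
  moreover have "K > 0" using B by (simp add: K_def)
  ultimately show ?thesis by blast
qed

text \<open>On a rhombus with centre \<open>x\<close> and half-diagonal \<open>r \<approx> \<tau> (1 + \<bar>x\<bar>)\<close> the three terms of the exponent are of
  sizes \<open>B \<tau> \<bar>x\<bar>\<close>, \<open>\<eta> \<bar>x\<bar> / \<tau>\<close> and \<open>D / \<tau>\<^sup>2\<close>. First \<open>\<tau>\<close> is chosen small, then \<open>\<eta>\<close> small compared with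
  \<open>\<tau>\<close>; the large constant \<open>D\<close> that belongs to \<open>\<eta>\<close> only enters the bounded term. The summand 12 in \<open>r\<close>
  puts the disc of radius 3 about \<open>x\<close> inside the disc of radius \<open>r / 4\<close>.\<close>

lemma non_dense_real_axis_bound:
  assumes sets: "sets \<mu> = sets borel" and gr: "polynomial_growth \<mu>" and a: "a > 0"
    and nd: "\<not> dense_in_L2 (fourier_space a) \<mu>" and \<epsilon>: "\<epsilon> > 0"
  shows "\<exists>C>0. \<forall>F\<in>PW a. \<forall>x::real. \<forall>z. cmod (z - of_real x) \<le> 3 \<longrightarrow> cmod (F z) \<le> C * exp (\<epsilon> * \<bar>x\<bar>) * PW_norm \<mu> F"
proof -
  obtain B C1 where B: "B \<ge> 0" "C1 > 0" and gb: "(\<forall>\<eta>>0. \<exists>D>0. \<forall>F\<in>PW a. \<forall>z. Im z \<noteq> 0 \<longrightarrow>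
     cmod (F z) \<le> (C1 * PW_norm \<mu> F) * exp (off_axis_exponent B \<eta> D z))"
    using non_dense_growth[OF sets gr a nd] by (elim exE conjE) (rule that; assumption)
  define \<tau> where "\<tau> = min 1 (\<epsilon> / (B + 1))"
  have \<tau>: "\<tau> > 0" "\<tau> \<le> 1" using \<epsilon> B by (auto simp: \<tau>_def)
  have B\<tau>: "B * \<tau> \<le> \<epsilon>"
  proof -
    have "B * \<tau> \<le> B * (\<epsilon> / (B + 1))" using B by (intro mult_left_mono) (auto simp: \<tau>_def)
    also have "\<dots> \<le> \<epsilon>" using B \<epsilon> by (simp add: field_simps)
    finally show ?thesis .
  qed
  \<comment> \<open>\<open>2744 = 2 * 7 * 14\<^sup>2\<close>, with 7 from \<open>near_axis_bound\<close> and \<open>1 + \<bar>x\<bar> + r \<le> 14 (1 + \<bar>x\<bar>)\<close>.\<close>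
  define \<eta> where "\<eta> = \<epsilon> * \<tau> / 2744"
  have \<eta>: "\<eta> > 0" using \<epsilon> \<tau> by (simp add: \<eta>_def)
  obtain D where D: "D > 0" "\<And>F z. F \<in> PW a \<Longrightarrow> Im z \<noteq> 0 \<Longrightarrow>
     cmod (F z) \<le> (C1 * PW_norm \<mu> F) * exp (off_axis_exponent B \<eta> D z)"
    using gb[rule_format, OF \<eta>] by blast
  define c0 where "c0 = 6 * B + 5880 * D / \<tau>\<^sup>2 + \<epsilon>"
  have "cmod (F z) \<le> (C1 * exp c0) * exp (\<epsilon> * \<bar>x\<bar>) * PW_norm \<mu> F"
    if F: "F \<in> PW a" and z: "cmod (z - of_real x) \<le> 3" for F z and x :: real
  proof -
    define X where "X = 1 + \<bar>x\<bar>"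
    define r where "r = 12 + \<tau> * X"
    have X: "X \<ge> 1" by (simp add: X_def)
    have \<tau>X: "0 < \<tau> * X" "\<tau> * X \<le> X" using \<tau> X by (auto simp: mult_le_cancel_right1)
    have r: "r > 0" "\<tau> * X \<le> r" using \<tau>X by (auto simp: r_def)
    have "cmod (F z) \<le> (C1 * PW_norm \<mu> F) * exp (B * r / 2 + 7 * \<eta> * (1 + \<bar>x\<bar> + r)\<^sup>2 / r + 30 * D * (1 + \<bar>x\<bar> + r)\<^sup>2 / r\<^sup>2)"
      by (rule near_axis_bound[OF PW_entire[OF F] _ _ _ _ _ D(2)[OF F]]) (use r B \<eta> D z \<tau>X PW_norm_nonneg[of \<mu> F] in \<open>auto simp: r_def\<close>)
    also have "\<dots> \<le> (C1 * PW_norm \<mu> F) * exp (c0 + \<epsilon> * \<bar>x\<bar>)"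
    proof (intro mult_left_mono)
      have R: "(1 + \<bar>x\<bar> + r)\<^sup>2 \<le> (14 * X)\<^sup>2" using X \<tau>X by (intro power_mono) (auto simp: r_def X_def)
      have "7 * \<eta> * (1 + \<bar>x\<bar> + r)\<^sup>2 / r \<le> 7 * \<eta> * (14 * X)\<^sup>2 / (\<tau> * X)"
        using R r \<eta> \<tau>X by (intro frac_le mult_left_mono) auto
      also have "\<dots> = \<epsilon> / 2 * X" using \<tau> X by (simp add: \<eta>_def field_simps power2_eq_square)
      finally have 1: "7 * \<eta> * (1 + \<bar>x\<bar> + r)\<^sup>2 / r \<le> \<epsilon> / 2 * X" .
      have "30 * D * (1 + \<bar>x\<bar> + r)\<^sup>2 / r\<^sup>2 \<le> 30 * D * (14 * X)\<^sup>2 / (\<tau> * X)\<^sup>2"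
      proof (intro frac_le mult_left_mono R)
        show "(\<tau> * X)\<^sup>2 \<le> r\<^sup>2" using r \<tau>X by (intro power_mono) auto
      qed (use D \<tau>X in auto)
      also have "\<dots> = 5880 * D / \<tau>\<^sup>2" using \<tau> X by (simp add: field_simps power2_eq_square)
      finally have 2: "30 * D * (1 + \<bar>x\<bar> + r)\<^sup>2 / r\<^sup>2 \<le> 5880 * D / \<tau>\<^sup>2" .
      have "(B * \<tau>) * X \<le> \<epsilon> * X" using B\<tau> X by (intro mult_right_mono) auto
      then have 3: "B * r / 2 \<le> 6 * B + \<epsilon> / 2 * X" by (simp add: r_def algebra_simps)
      have "\<epsilon> / 2 * X + \<epsilon> / 2 * X = \<epsilon> + \<epsilon> * \<bar>x\<bar>" by (simp add: X_def algebra_simps)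
      with 1 2 3 have "B * r / 2 + 7 * \<eta> * (1 + \<bar>x\<bar> + r)\<^sup>2 / r + 30 * D * (1 + \<bar>x\<bar> + r)\<^sup>2 / r\<^sup>2 \<le> c0 + \<epsilon> * \<bar>x\<bar>"
        unfolding c0_def by linarith
      then show "exp (B * r / 2 + 7 * \<eta> * (1 + \<bar>x\<bar> + r)\<^sup>2 / r + 30 * D * (1 + \<bar>x\<bar> + r)\<^sup>2 / r\<^sup>2) \<le> exp (c0 + \<epsilon> * \<bar>x\<bar>)" by simp
      show "0 \<le> C1 * PW_norm \<mu> F" using B PW_norm_nonneg[of \<mu> F] by simp
    qed
    finally show ?thesis by (simp add: exp_add mult_ac)
  qed
  moreover have "C1 * exp c0 > 0" using B by simp
  ultimately show ?thesis by blast
qed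

lemma entire_oscillation_bound:
  assumes G: "G holomorphic_on UNIV" and M: "\<And>z. cmod (z - of_real x) \<le> 3 \<Longrightarrow> cmod (G z) \<le> M" and t: "\<bar>t - x\<bar> \<le> 2"
  shows "cmod (G (of_real t) - G (of_real x)) \<le> M * \<bar>t - x\<bar>"
proof -
  have d: "cmod (deriv G w) \<le> M" if w: "w \<in> cball (of_real x) 2" for w
  proof -
    have "cmod ((deriv ^^ 1) G w) \<le> fact 1 * M / 1 ^ 1"
    proof (rule Cauchy_inequality)
      show "G holomorphic_on ball w 1" "continuous_on (cball w 1) G"
        using G holomorphic_on_subset holomorphic_on_imp_continuous_on by blast+
      fix z assume "cmod (w - z) = 1"
      then have "cmod (z - of_real x) \<le> 3"
        using norm_triangle_ineq[of "z - w" "w - of_real x"] w by (simp add: dist_norm norm_minus_commute)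
      then show "cmod (G z) \<le> M" by (rule M)
    qed simp
    then show ?thesis by simp
  qed
  have "cmod (G (of_real t) - G (of_real x)) \<le> M * cmod (of_real t - of_real x)"
  proof (rule field_differentiable_bound[of "cball (of_real x) 2" G "deriv G"])
    show "(G has_field_derivative deriv G w) (at w within cball (of_real x) 2)" for w
      using holomorphic_derivI[OF G, of w] by (auto intro: has_field_derivative_at_within)
    show "of_real t \<in> cball (complex_of_real x) 2" using t by (simp add: dist_norm norm_minus_commute flip: of_real_diff)
  qed (use d in auto)
  then show ?thesis by (simp flip: of_real_diff)
qed

section \<open>Comparison of the two measures\<close>

lemma polynomial_growth_emeasure:
  assumes sets: "sets \<mu> = sets borel" and gr: "polynomial_growth \<mu>"
  shows "\<exists>J m. J \<ge> 0 \<and> (\<forall>r\<ge>0. emeasure \<mu> {- r..r} \<le> ennreal (J * (1 + r) ^ m))"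
proof -
  obtain m where m: "integrable \<mu> (\<lambda>t. 1 / (1 + \<bar>t\<bar>) ^ m)" using polynomial_growth_weight[OF sets gr] by blast
  define J where "J = (\<integral>t. 1 / (1 + \<bar>t\<bar>) ^ m \<partial>\<mu>)"
  have "emeasure \<mu> {- r..r} \<le> ennreal (J * (1 + r) ^ m)" if r: "r \<ge> 0" for r
  proof -
    have "emeasure \<mu> {- r..r} = (\<integral>\<^sup>+ t. indicator {- r..r} t \<partial>\<mu>)" using sets by simp
    also have "\<dots> \<le> (\<integral>\<^sup>+ t. ennreal ((1 + r) ^ m * (1 / (1 + \<bar>t\<bar>) ^ m)) \<partial>\<mu>)"
    proof (intro nn_integral_mono)
      fix t
      show "(indicator {- r..r} t :: ennreal) \<le> ennreal ((1 + r) ^ m * (1 / (1 + \<bar>t\<bar>) ^ m))"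
      proof (cases "t \<in> {- r..r}")
        case True
        then have "(1 + \<bar>t\<bar>) ^ m \<le> (1 + r) ^ m" by (intro power_mono) auto
        moreover have "(1 + \<bar>t\<bar>) ^ m > 0" by simp
        ultimately have "1 \<le> (1 + r) ^ m * (1 / (1 + \<bar>t\<bar>) ^ m)" by simp
        then have "ennreal 1 \<le> ennreal ((1 + r) ^ m * (1 / (1 + \<bar>t\<bar>) ^ m))" by (rule ennreal_leI)
        then show ?thesis using True by simp
      qed simp
    qed
    also have "\<dots> = ennreal (\<integral>t. (1 + r) ^ m * (1 / (1 + \<bar>t\<bar>) ^ m) \<partial>\<mu>)"
      using r by (intro nn_integral_eq_integral integrable_mult_right m) auto
    also have "(\<integral>t. (1 + r) ^ m * (1 / (1 + \<bar>t\<bar>) ^ m) \<partial>\<mu>) = J * (1 + r) ^ m"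
      unfolding J_def by (subst integral_mult_right_zero) (rule mult.commute)
    finally show ?thesis .
  qed
  moreover have "J \<ge> 0" by (simp add: J_def)
  ultimately show ?thesis by blast
qed

lemma polynomial_growth_intervals:
  assumes sets: "sets \<mu> = sets borel" and gr: "polynomial_growth \<mu>"
  shows "\<exists>Q m. Q > 0 \<and> (\<forall>x. emeasure \<mu> {x - 2..x + 2} \<le> ennreal (Q * (1 + \<bar>x\<bar>) ^ m))"
proof -
  obtain J m where J: "J \<ge> 0" "\<And>r. r \<ge> 0 \<Longrightarrow> emeasure \<mu> {- r..r} \<le> ennreal (J * (1 + r) ^ m)"
    using polynomial_growth_emeasure[OF assms] by blast
  have "emeasure \<mu> {x - 2..x + 2} \<le> ennreal ((J * 3 ^ m + 1) * (1 + \<bar>x\<bar>) ^ m)" for x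
  proof -
    have "emeasure \<mu> {x - 2..x + 2} \<le> emeasure \<mu> {- (\<bar>x\<bar> + 2)..\<bar>x\<bar> + 2}" using sets by (intro emeasure_mono) auto
    also have "\<dots> \<le> ennreal (J * (1 + (\<bar>x\<bar> + 2)) ^ m)" by (rule J(2)) simp
    also have "\<dots> \<le> ennreal ((J * 3 ^ m + 1) * (1 + \<bar>x\<bar>) ^ m)"
    proof (rule ennreal_leI)
      have "(1 + (\<bar>x\<bar> + 2)) ^ m \<le> (3 * (1 + \<bar>x\<bar>)) ^ m" by (intro power_mono) auto
      then have "J * (1 + (\<bar>x\<bar> + 2)) ^ m \<le> J * (3 ^ m * (1 + \<bar>x\<bar>) ^ m)"
        using J(1) by (intro mult_left_mono) (simp_all only: power_mult_distrib)
      also have "\<dots> \<le> (J * 3 ^ m + 1) * (1 + \<bar>x\<bar>) ^ m" by (simp add: distrib_right mult.assoc)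
      finally show "J * (1 + (\<bar>x\<bar> + 2)) ^ m \<le> (J * 3 ^ m + 1) * (1 + \<bar>x\<bar>) ^ m" .
    qed
    finally show ?thesis .
  qed
  moreover have "J * 3 ^ m + 1 > 0" using J(1) by (simp add: add_nonneg_pos)
  ultimately show ?thesis by blast
qed

lemma sigma_finite_polynomial_growth:
  assumes sets: "sets \<mu> = sets borel" and gr: "polynomial_growth \<mu>"
  shows "sigma_finite_measure \<mu>"
proof
  obtain Q m where Q: "\<And>x. emeasure \<mu> {x - 2..x + 2} \<le> ennreal (Q * (1 + \<bar>x\<bar>) ^ m)"
    using polynomial_growth_intervals[OF assms] by blast
  have sp: "space \<mu> = UNIV" using sets_eq_imp_space_eq[OF sets] by simp
  show "\<exists>A. countable A \<and> A \<subseteq> sets \<mu> \<and> \<Union> A = space \<mu> \<and> (\<forall>a\<in>A. emeasure \<mu> a \<noteq> \<infinity>)"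
  proof (intro exI[of _ "range (\<lambda>n::int. {real_of_int n - 2..real_of_int n + 2})"] conjI ballI)
    show "\<Union> (range (\<lambda>n::int. {real_of_int n - 2..real_of_int n + 2})) = space \<mu>"
    proof -
      have "x \<in> \<Union> (range (\<lambda>n::int. {real_of_int n - 2..real_of_int n + 2}))" for x :: real
      proof (rule UnionI[OF rangeI[of _ "\<lfloor>x\<rfloor>"]])
        have "real_of_int \<lfloor>x\<rfloor> - 2 \<le> x" "x \<le> real_of_int \<lfloor>x\<rfloor> + 2" by linarith+
        then show "x \<in> {real_of_int \<lfloor>x\<rfloor> - 2..real_of_int \<lfloor>x\<rfloor> + 2}"
          unfolding atLeastAtMost_iff by (rule conjI)
      qed
      then show ?thesis unfolding sp by (intro equalityI subsetI UNIV_I)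
    qed
    fix A assume "A \<in> range (\<lambda>n::int. {real_of_int n - 2..real_of_int n + 2})"
    then obtain n :: int where n: "A = {real_of_int n - 2..real_of_int n + 2}" by blast
    have "emeasure \<mu> A < \<infinity>" unfolding n by (rule le_less_trans[OF Q]) simp
    then show "emeasure \<mu> A \<noteq> \<infinity>" by simp
  qed (simp_all add: sets image_subset_iff)
qed

lemma polynomial_le_exp:
  assumes "\<beta> > 0"
  shows "\<exists>c>0. \<forall>s\<ge>0. (1 + s) ^ k \<le> c * exp (\<beta> * s :: real)"
proof (cases "k = 0")
  case True
  then show ?thesis using assms by (intro exI[of _ 1]) auto
next
  case False
  define c where "c = 1 + real k / \<beta>"
  have c: "c > 0" using assms by (simp add: c_def add_pos_nonneg)
  have "(1 + s) ^ k \<le> c ^ k * exp (\<beta> * s)" if s: "s \<ge> 0" for s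
  proof -
    have "c * (1 + \<beta> * s / real k) = 1 + \<beta> * s / real k + real k / \<beta> + s"
      using assms False by (simp add: c_def field_simps)
    moreover have "0 \<le> \<beta> * s / real k" "0 \<le> real k / \<beta>" using assms s by auto
    ultimately have "1 + s \<le> c * (1 + \<beta> * s / real k)" by linarith
    also have "\<dots> \<le> c * exp (\<beta> * s / real k)" using c exp_ge_add_one_self[of "\<beta> * s / real k"] by (intro mult_left_mono) auto
    finally have "(1 + s) ^ k \<le> (c * exp (\<beta> * s / real k)) ^ k" using s by (intro power_mono) auto
    also have "\<dots> = c ^ k * exp (\<beta> * s)" using False by (simp add: power_mult_distrib exp_of_nat_mult[symmetric])
    finally show ?thesis .
  qed
  then show ?thesis using c by (intro exI[of _ "c ^ k"]) auto
qed

lemma nn_integral_exp_abs_finite: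
  assumes b: "\<beta> > 0"
  shows "(\<integral>\<^sup>+ x. ennreal (exp (- \<beta> * \<bar>x\<bar>)) \<partial>lborel) < \<infinity>"
proof -
  have half: "(\<integral>\<^sup>+ x. ennreal (exp (- \<beta> * x)) * indicator {0..} x \<partial>lborel) = ennreal (0 - (- exp (- \<beta> * 0) / \<beta>))"
  proof (rule nn_integral_FTC_atLeast)
    show "((\<lambda>x. - exp (- \<beta> * x) / \<beta>) has_real_derivative exp (- \<beta> * x)) (at x)" for x
      using b by (auto intro!: derivative_eq_intros)
    have "((\<lambda>x. - exp (- (\<beta> * x)) / \<beta>) \<longlongrightarrow> - 0 / \<beta>) at_top"
      using b by (intro tendsto_divide tendsto_minus tendsto_const filterlim_compose[OF exp_at_bot] filterlim_uminus_at_bot_at_top[THEN filterlim_compose]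
        filterlim_tendsto_pos_mult_at_top[OF tendsto_const _ filterlim_ident]) auto
    then show "((\<lambda>x. - exp (- \<beta> * x) / \<beta>) \<longlongrightarrow> 0) at_top" by simp
  qed auto
  have "(\<integral>\<^sup>+ x. ennreal (exp (- \<beta> * \<bar>x\<bar>)) \<partial>lborel) \<le>
     (\<integral>\<^sup>+ x. ennreal (exp (- \<beta> * x)) * indicator {0..} x + ennreal (exp (- \<beta> * (0 + (-1) * x))) * indicator {0..} (0 + (-1) * x) \<partial>lborel)"
    by (intro nn_integral_mono) (auto simp: indicator_def abs_if)
  also have "\<dots> = (\<integral>\<^sup>+ x. ennreal (exp (- \<beta> * x)) * indicator {0..} x \<partial>lborel) + (\<integral>\<^sup>+ x. ennreal (exp (- \<beta> * (0 + (-1) * x))) * indicator {0..} (0 + (-1) * x) \<partial>lborel)"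
    by (rule nn_integral_add) auto
  also have "(\<integral>\<^sup>+ x. ennreal (exp (- \<beta> * (0 + (-1) * x))) * indicator {0..} (0 + (-1) * x) \<partial>lborel) = (\<integral>\<^sup>+ x. ennreal (exp (- \<beta> * x)) * indicator {0..} x \<partial>lborel)"
    using nn_integral_real_affine[of "\<lambda>x. ennreal (exp (- \<beta> * x)) * indicator {0..} x" "-1" 0] by simp
  finally show ?thesis unfolding half by (rule le_less_trans) simp
qed

text \<open>Up to the oscillation, \<open>\<bar>G\<bar>\<^sup>2\<close> on \<open>I\<close> is at most twice the value \<open>\<bar>g\<bar>\<^sup>2\<close> at the centre, which in turn is at most
  twice \<open>\<bar>G\<bar>\<^sup>2\<close> anywhere on \<open>J\<close>; the measure of \<open>I\<close> is traded for that of \<open>J\<close> in between.\<close>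

lemma interval_comparison:
  fixes G :: "real \<Rightarrow> complex"
  assumes \<mu>: "I \<in> sets \<mu>" and \<nu>: "J \<in> sets \<nu>" and sub: "I \<subseteq> J" and Gm: "G \<in> borel_measurable \<nu>"
    and osc: "\<And>t. t \<in> J \<Longrightarrow> (cmod (G t - g))\<^sup>2 \<le> o2" and u: "(cmod g)\<^sup>2 \<le> u" and pos: "o2 \<ge> 0" "u \<ge> 0" "c \<ge> 0" "e \<ge> 0" "a1 \<ge> 0" "a2 \<ge> 0"
    and a: "emeasure \<mu> I \<le> ennreal a1" "emeasure \<nu> J \<le> ennreal a2"
    and dom: "emeasure \<mu> I \<le> ennreal c * (emeasure \<nu> J + ennreal e)"
  shows "(\<integral>\<^sup>+ t. indicator I t * ennreal ((cmod (G t))\<^sup>2) \<partial>\<mu>)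
     \<le> ennreal (4 * c) * (\<integral>\<^sup>+ t. indicator J t * ennreal ((cmod (G t))\<^sup>2) \<partial>\<nu>) + ennreal (2 * c * (2 * o2 * a2 + u * e) + 2 * o2 * a1)"
proof -
  define v where "v = (cmod g)\<^sup>2"
  have v: "0 \<le> v" "v \<le> u" using u by (auto simp: v_def)
  have sq: "(cmod x)\<^sup>2 \<le> 2 * (cmod y)\<^sup>2 + 2 * (cmod (x - y))\<^sup>2" for x y :: complex
  proof -
    have "(cmod x)\<^sup>2 \<le> (cmod y + cmod (x - y))\<^sup>2" using norm_triangle_ineq[of y "x - y"] by (intro power_mono) auto
    also have "\<dots> \<le> 2 * (cmod y)\<^sup>2 + 2 * (cmod (x - y))\<^sup>2" using sum_squares_bound[of "cmod y" "cmod (x - y)"] by (simp add: power2_sum)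
    finally show ?thesis .
  qed
  define j where "j = (\<integral>\<^sup>+ t. indicator J t * ennreal ((cmod (G t))\<^sup>2) \<partial>\<nu>)"
  have up: "(cmod (G t))\<^sup>2 \<le> 2 * v + 2 * o2" if "t \<in> J" for t
    using sq[of "G t" g] osc[OF that] by (simp add: v_def)
  have lo: "v \<le> 2 * (cmod (G t))\<^sup>2 + 2 * o2" if "t \<in> J" for t
    using sq[of g "G t"] osc[OF that] by (simp add: v_def norm_minus_commute)
  have 1: "(\<integral>\<^sup>+ t. indicator I t * ennreal ((cmod (G t))\<^sup>2) \<partial>\<mu>) \<le> ennreal (2 * v) * emeasure \<mu> I + ennreal (2 * o2) * emeasure \<mu> I"
  proof -
    have "(\<integral>\<^sup>+ t. indicator I t * ennreal ((cmod (G t))\<^sup>2) \<partial>\<mu>) \<le> (\<integral>\<^sup>+ t. ennreal (2 * v + 2 * o2) * indicator I t \<partial>\<mu>)"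
      using up sub by (intro nn_integral_mono) (auto simp: indicator_def intro!: ennreal_leI)
    also have "\<dots> = ennreal (2 * v + 2 * o2) * emeasure \<mu> I" by (rule nn_integral_cmult_indicator[OF \<mu>])
    also have "\<dots> = ennreal (2 * v) * emeasure \<mu> I + ennreal (2 * o2) * emeasure \<mu> I"
      using v pos by (subst ennreal_plus) (auto simp: distrib_right)
    finally show ?thesis .
  qed
  have 2: "ennreal v * emeasure \<nu> J \<le> ennreal 2 * j + ennreal (2 * o2 * a2)"
  proof -
    have "ennreal v * emeasure \<nu> J = (\<integral>\<^sup>+ t. ennreal v * indicator J t \<partial>\<nu>)" by (rule nn_integral_cmult_indicator[OF \<nu>, symmetric])
    also have "\<dots> \<le> (\<integral>\<^sup>+ t. ennreal 2 * (indicator J t * ennreal ((cmod (G t))\<^sup>2)) + ennreal (2 * o2) * indicator J t \<partial>\<nu>)"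
    proof (intro nn_integral_mono)
      fix t
      show "ennreal v * indicator J t \<le> ennreal 2 * (indicator J t * ennreal ((cmod (G t))\<^sup>2)) + ennreal (2 * o2) * indicator J t"
      proof (cases "t \<in> J")
        case True
        have "ennreal v \<le> ennreal (2 * (cmod (G t))\<^sup>2 + 2 * o2)" using lo[OF True] by (rule ennreal_leI)
        also have "\<dots> = ennreal 2 * ennreal ((cmod (G t))\<^sup>2) + ennreal (2 * o2)" using pos by (simp add: ennreal_plus ennreal_mult)
        finally show ?thesis using True by simp
      qed simp
    qed
    also have "\<dots> = ennreal 2 * j + ennreal (2 * o2) * emeasure \<nu> J"
      unfolding j_def using \<nu> Gm by (subst nn_integral_add) (auto simp: nn_integral_cmult nn_integral_cmult_indicator)
    also have "ennreal (2 * o2) * emeasure \<nu> J \<le> ennreal (2 * o2) * ennreal a2" by (intro mult_left_mono a) auto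
    also have "\<dots> = ennreal (2 * o2 * a2)" using pos by (simp add: ennreal_mult)
    finally show ?thesis by simp
  qed
  have "ennreal (2 * v) * emeasure \<mu> I \<le> ennreal (2 * v) * (ennreal c * (emeasure \<nu> J + ennreal e))" by (intro mult_left_mono dom) auto
  also have "\<dots> = ennreal (2 * c) * (ennreal v * emeasure \<nu> J + ennreal (v * e))"
    using v pos by (simp add: ennreal_mult distrib_left mult_ac)
  also have "\<dots> \<le> ennreal (2 * c) * ((ennreal 2 * j + ennreal (2 * o2 * a2)) + ennreal (u * e))"
    using 2 v pos by (intro mult_left_mono add_mono ennreal_leI mult_right_mono) auto
  also have "\<dots> = ennreal (4 * c) * j + ennreal (2 * c * (2 * o2 * a2 + u * e))"
  proof -
    have "ennreal (2 * c) * ennreal 2 = ennreal (4 * c)" using pos by (subst ennreal_mult[symmetric]) auto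
    then have "ennreal (2 * c) * (ennreal 2 * j) = ennreal (4 * c) * j" by (simp only: mult.assoc[symmetric])
    moreover have "ennreal (2 * o2 * a2) + ennreal (u * e) = ennreal (2 * o2 * a2 + u * e)" using pos by (simp add: ennreal_plus)
    moreover have "ennreal (2 * c) * ennreal (2 * o2 * a2 + u * e) = ennreal (2 * c * (2 * o2 * a2 + u * e))"
      using pos by (simp add: ennreal_mult)
    ultimately show ?thesis by (simp only: add.assoc distrib_left)
  qed
  finally have 3: "ennreal (2 * v) * emeasure \<mu> I \<le> ennreal (4 * c) * j + ennreal (2 * c * (2 * o2 * a2 + u * e))" .
  have 4: "ennreal (2 * o2) * emeasure \<mu> I \<le> ennreal (2 * o2 * a1)"
  proof -
    have "ennreal (2 * o2) * emeasure \<mu> I \<le> ennreal (2 * o2) * ennreal a1" by (intro mult_left_mono a) auto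
    then show ?thesis using pos by (simp add: ennreal_mult)
  qed
  have "(\<integral>\<^sup>+ t. indicator I t * ennreal ((cmod (G t))\<^sup>2) \<partial>\<mu>) \<le> (ennreal (4 * c) * j + ennreal (2 * c * (2 * o2 * a2 + u * e))) + ennreal (2 * o2 * a1)"
    using 1 add_mono[OF 3 4] by (rule order_trans)
  also have "\<dots> = ennreal (4 * c) * j + ennreal (2 * c * (2 * o2 * a2 + u * e) + 2 * o2 * a1)"
    using pos by (simp add: ennreal_plus add.assoc)
  finally show ?thesis by (simp add: j_def)
qed

lemma mem_scaled_interval: "t \<in> scaled_interval r x \<delta> \<longleftrightarrow> \<bar>t - x\<bar> \<le> r * exp (- \<delta> * \<bar>x\<bar>)"
  by (auto simp: scaled_interval_def abs_le_iff algebra_simps)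

lemma scaled_interval_subset:
  assumes "\<delta> > 0"
  shows "scaled_interval 1 x \<delta> \<subseteq> scaled_interval 2 x \<delta>" and "scaled_interval 2 x \<delta> \<subseteq> {x - 2..x + 2}"
proof -
  have "exp (- \<delta> * \<bar>x\<bar>) \<le> 1" "exp (- \<delta> * \<bar>x\<bar>) > 0" using assms by auto
  then show "scaled_interval 1 x \<delta> \<subseteq> scaled_interval 2 x \<delta>" "scaled_interval 2 x \<delta> \<subseteq> {x - 2..x + 2}"
    by (auto simp: scaled_interval_def)
qed

text \<open>Integration over the centres \<open>x\<close> with density \<open>exp (\<delta> \<bar>x\<bar>)\<close> replaces a covering of the line by the intervals
  \<open>I\<^bsub>x,\<delta>\<^esub>\<close>: the centres whose interval contains \<open>t\<close> form a set of length about \<open>exp (- \<delta> \<bar>t\<bar>)\<close>, which the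
  density compensates. The normalisation \<open>exp (2 \<delta>) / 2\<close> makes the constant here equal to one.\<close>

lemma centre_average_lower:
  assumes d: "\<delta> > 0" and t: "\<rho> + 1 < \<bar>t\<bar>" and g: "g \<ge> 0"
  shows "ennreal g \<le> (\<integral>\<^sup>+ x. (if \<rho> < \<bar>x\<bar> \<and> \<bar>t - x\<bar> \<le> exp (- \<delta> * \<bar>x\<bar>) then ennreal (exp (\<delta> * \<bar>x\<bar> + 2 * \<delta>) / 2 * g) else 0) \<partial>lborel)"
proof -
  define h where "h = exp (- \<delta> - \<delta> * \<bar>t\<bar>)"
  define c where "c = exp (\<delta> * \<bar>t\<bar> + \<delta>) / 2 * g"
  have h: "0 < h" "h \<le> 1"
  proof -
    have "0 \<le> \<delta> * \<bar>t\<bar>" using d by simp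
    then have "- \<delta> - \<delta> * \<bar>t\<bar> \<le> 0" using d by linarith
    then show "h \<le> 1" by (simp only: h_def exp_le_one_iff)
  qed (simp add: h_def)
  have "2 * h * c = g"
  proof -
    have "exp (- \<delta> - \<delta> * \<bar>t\<bar>) * exp (\<delta> * \<bar>t\<bar> + \<delta>) = 1" by (simp add: exp_add[symmetric])
    then show ?thesis by (simp add: h_def c_def)
  qed
  then have "ennreal g = ennreal (c * (2 * h))" by (simp add: mult_ac)
  also have "\<dots> = ennreal c * ennreal (2 * h)" using g by (subst ennreal_mult) (auto simp: c_def h_def)
  also have "\<dots> = (\<integral>\<^sup>+ x. ennreal c * indicator {t - h..t + h} x \<partial>lborel)"
    using h by (subst nn_integral_cmult_indicator) auto
  also have "\<dots> \<le> (\<integral>\<^sup>+ x. (if \<rho> < \<bar>x\<bar> \<and> \<bar>t - x\<bar> \<le> exp (- \<delta> * \<bar>x\<bar>) then ennreal (exp (\<delta> * \<bar>x\<bar> + 2 * \<delta>) / 2 * g) else 0) \<partial>lborel)"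
  proof (intro nn_integral_mono)
    fix x
    show "ennreal c * indicator {t - h..t + h} x \<le> (if \<rho> < \<bar>x\<bar> \<and> \<bar>t - x\<bar> \<le> exp (- \<delta> * \<bar>x\<bar>) then ennreal (exp (\<delta> * \<bar>x\<bar> + 2 * \<delta>) / 2 * g) else 0)"
    proof (cases "x \<in> {t - h..t + h}")
      case True
      then have tx: "\<bar>t - x\<bar> \<le> h" by (auto simp: abs_le_iff)
      then have x: "\<bar>x\<bar> \<le> \<bar>t\<bar> + 1" "\<bar>t\<bar> - 1 \<le> \<bar>x\<bar>" using h by linarith+
      have "\<delta> * \<bar>x\<bar> \<le> \<delta> * (\<bar>t\<bar> + 1)" "\<delta> * (\<bar>t\<bar> - 1) \<le> \<delta> * \<bar>x\<bar>" using d x by (auto intro!: mult_left_mono)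
      then have "h \<le> exp (- \<delta> * \<bar>x\<bar>)" "exp (\<delta> * \<bar>t\<bar> + \<delta>) \<le> exp (\<delta> * \<bar>x\<bar> + 2 * \<delta>)"
        by (auto simp: h_def algebra_simps)
      then have "c \<le> exp (\<delta> * \<bar>x\<bar> + 2 * \<delta>) / 2 * g" "\<bar>t - x\<bar> \<le> exp (- \<delta> * \<bar>x\<bar>)" "\<rho> < \<bar>x\<bar>"
        using g tx x t by (auto simp: c_def intro!: mult_right_mono)
      then show ?thesis using True by (auto intro!: ennreal_leI)
    qed simp
  qed
  finally show ?thesis .
qed

text \<open>The counterpart for the doubled intervals bounds the overlap of the \<open>2 I\<^bsub>x,\<delta>\<^esub>\<close> that contain \<open>t\<close>.\<close>

lemma centre_average_upper:
  assumes d: "\<delta> > 0" and g: "g \<ge> 0" and C0: "C0 > 0"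
  shows "(\<integral>\<^sup>+ x. (if \<bar>t - x\<bar> \<le> 2 * exp (- \<delta> * \<bar>x\<bar>) then ennreal (4 * (C0 * (1 + \<bar>x\<bar>) ^ n) * (exp (\<delta> * \<bar>x\<bar> + 2 * \<delta>) / 2) * g) else 0) \<partial>lborel)
    \<le> ennreal (8 * C0 * 3 ^ n * exp (6 * \<delta>)) * ennreal ((1 + \<bar>t\<bar>) ^ n * g)"
proof -
  define h where "h = 2 * exp (2 * \<delta> - \<delta> * \<bar>t\<bar>)"
  define c where "c = 4 * (C0 * (3 ^ n * (1 + \<bar>t\<bar>) ^ n)) * (exp (\<delta> * \<bar>t\<bar> + 4 * \<delta>) / 2) * g"
  have h: "0 < h" by (simp add: h_def)
  have c: "c \<ge> 0" using g C0 by (simp add: c_def)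
  have "(\<integral>\<^sup>+ x. (if \<bar>t - x\<bar> \<le> 2 * exp (- \<delta> * \<bar>x\<bar>) then ennreal (4 * (C0 * (1 + \<bar>x\<bar>) ^ n) * (exp (\<delta> * \<bar>x\<bar> + 2 * \<delta>) / 2) * g) else 0) \<partial>lborel)
    \<le> (\<integral>\<^sup>+ x. ennreal c * indicator {t - h..t + h} x \<partial>lborel)"
  proof (intro nn_integral_mono)
    fix x
    show "(if \<bar>t - x\<bar> \<le> 2 * exp (- \<delta> * \<bar>x\<bar>) then ennreal (4 * (C0 * (1 + \<bar>x\<bar>) ^ n) * (exp (\<delta> * \<bar>x\<bar> + 2 * \<delta>) / 2) * g) else 0) \<le> ennreal c * indicator {t - h..t + h} x"
    proof (cases "\<bar>t - x\<bar> \<le> 2 * exp (- \<delta> * \<bar>x\<bar>)")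
      case True
      have "exp (- \<delta> * \<bar>x\<bar>) \<le> 1" using d by simp
      then have x: "\<bar>x\<bar> \<le> \<bar>t\<bar> + 2" "\<bar>t\<bar> - 2 \<le> \<bar>x\<bar>" using True by linarith+
      have m: "\<delta> * \<bar>x\<bar> \<le> \<delta> * (\<bar>t\<bar> + 2)" "\<delta> * (\<bar>t\<bar> - 2) \<le> \<delta> * \<bar>x\<bar>" using d x by (auto intro!: mult_left_mono)
      then have e: "2 * exp (- \<delta> * \<bar>x\<bar>) \<le> h" "exp (\<delta> * \<bar>x\<bar> + 2 * \<delta>) \<le> exp (\<delta> * \<bar>t\<bar> + 4 * \<delta>)"
        by (auto simp: h_def algebra_simps)
      have "(1 + \<bar>x\<bar>) ^ n \<le> (3 * (1 + \<bar>t\<bar>)) ^ n" using x by (intro power_mono) auto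
      then have p: "(1 + \<bar>x\<bar>) ^ n \<le> 3 ^ n * (1 + \<bar>t\<bar>) ^ n" by (simp only: power_mult_distrib)
      have "4 * (C0 * (1 + \<bar>x\<bar>) ^ n) * (exp (\<delta> * \<bar>x\<bar> + 2 * \<delta>) / 2) * g \<le> c"
        unfolding c_def using p e(2) g C0 by (intro mult_mono mult_nonneg_nonneg) auto
      moreover have "x \<in> {t - h..t + h}" using True e(1) by (auto simp: abs_le_iff)
      ultimately show ?thesis using True by (auto intro!: ennreal_leI)
    qed simp
  qed
  also have "\<dots> = ennreal c * ennreal (2 * h)" using h by (subst nn_integral_cmult_indicator) auto
  also have "\<dots> = ennreal (c * (2 * h))" using c h by (subst ennreal_mult) auto
  also have "c * (2 * h) = (8 * C0 * 3 ^ n * exp (6 * \<delta>)) * ((1 + \<bar>t\<bar>) ^ n * g)"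
  proof -
    have "exp (\<delta> * \<bar>t\<bar> + 4 * \<delta>) * exp (2 * \<delta> - \<delta> * \<bar>t\<bar>) = exp (6 * \<delta>)" by (simp add: exp_add[symmetric])
    then have "(C0 * 3 ^ n * (1 + \<bar>t\<bar>) ^ n * g) * (exp (\<delta> * \<bar>t\<bar> + 4 * \<delta>) * exp (2 * \<delta> - \<delta> * \<bar>t\<bar>)) = (C0 * 3 ^ n * (1 + \<bar>t\<bar>) ^ n * g) * exp (6 * \<delta>)"
      by (simp only:)
    then show ?thesis by (simp add: c_def h_def mult_ac)
  qed
  also have "ennreal \<dots> = ennreal (8 * C0 * 3 ^ n * exp (6 * \<delta>)) * ennreal ((1 + \<bar>t\<bar>) ^ n * g)"
    using g C0 by (subst ennreal_mult) auto
  finally show ?thesis .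
qed

text \<open>For each centre \<open>x\<close>, \<open>interval_comparison\<close> bounds the integral of \<open>\<bar>G\<bar>\<^sup>2\<close> over \<open>I\<^bsub>x,\<delta>\<^esub>\<close> with respect to \<open>\<mu>\<close> by the
  one over \<open>2 I\<^bsub>x,\<delta>\<^esub>\<close> with respect to \<open>\<nu>\<close>, with an error of order \<open>A\<^sup>2 exp (- 2 \<delta> \<bar>x\<bar>) exp (\<delta> \<bar>x\<bar> / 4)\<close> up to a polynomial factor.
  Multiplied by the density \<open>exp (\<delta> \<bar>x\<bar>)\<close> of the centres, the error is still integrable, and its integral over
  \<open>\<bar>x\<bar> > \<rho>\<close> is as small as desired. Fubini's theorem and the two averaging lemmas finish the proof.
  In the application, \<open>A\<close> is the norm of \<open>G\<close> in \<open>L\<^sup>2(\<mu>)\<close>.\<close>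

lemma sampling_tail:
  fixes \<mu> \<nu> :: "real measure" and \<delta> C0 C \<kappa> :: real and n :: nat
  assumes sets[measurable_cong]: "sets \<mu> = sets borel" "sets \<nu> = sets borel"
    and gr: "polynomial_growth \<mu>" "polynomial_growth \<nu>"
    and d: "\<delta> > 0" and C: "C0 > 0" "C > 0" and \<kappa>: "\<kappa> > 0"
    and dom: "\<And>x. emeasure \<mu> (scaled_interval 1 x \<delta>)
             \<le> ennreal (C0 * (1 + \<bar>x\<bar>) ^ n) * (emeasure \<nu> (scaled_interval 2 x \<delta>) + ennreal (exp (- 2 * \<delta> * \<bar>x\<bar>)))"
  shows "\<exists>\<rho>>0. \<exists>C6>0. \<forall>(G :: real \<Rightarrow> complex) A. G \<in> borel_measurable borel \<longrightarrow> A \<ge> 0 \<longrightarrow>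
      (\<forall>x. cmod (G x) \<le> C * exp (\<delta> / 8 * \<bar>x\<bar>) * A) \<longrightarrow>
      (\<forall>x t. \<bar>t - x\<bar> \<le> 2 \<longrightarrow> cmod (G t - G x) \<le> C * exp (\<delta> / 8 * \<bar>x\<bar>) * A * \<bar>t - x\<bar>) \<longrightarrow>
      (\<integral>\<^sup>+ t. indicator {t. \<rho> < \<bar>t\<bar>} t * ennreal ((cmod (G t))\<^sup>2) \<partial>\<mu>)
      \<le> ennreal C6 * (\<integral>\<^sup>+ t. ennreal ((1 + \<bar>t\<bar>) ^ n * (cmod (G t))\<^sup>2) \<partial>\<nu>) + ennreal (\<kappa> * A\<^sup>2)"
proof -
  obtain Q1 m1 where Q1: "Q1 > 0" "\<And>x. emeasure \<mu> {x - 2..x + 2} \<le> ennreal (Q1 * (1 + \<bar>x\<bar>) ^ m1)"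
    using polynomial_growth_intervals[OF sets(1) gr(1)] by blast
  obtain Q2 m2 where Q2: "Q2 > 0" "\<And>x. emeasure \<nu> {x - 2..x + 2} \<le> ennreal (Q2 * (1 + \<bar>x\<bar>) ^ m2)"
    using polynomial_growth_intervals[OF sets(2) gr(2)] by blast
  define Q where "Q = Q1 + Q2"
  define m where "m = m1 + m2"
  have Q: "Q > 0" using Q1 Q2 by (simp add: Q_def)
  have Qle: "Q1 * (1 + \<bar>x\<bar>) ^ m1 \<le> Q * (1 + \<bar>x\<bar>) ^ m" "Q2 * (1 + \<bar>x\<bar>) ^ m2 \<le> Q * (1 + \<bar>x\<bar>) ^ m" for x
    using Q1(1) Q2(1) by (auto simp: Q_def m_def intro!: mult_mono power_increasing)
  have meas_in: "scaled_interval r x \<delta> \<in> sets \<mu>" "scaled_interval r x \<delta> \<in> sets \<nu>" for r x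
    using sets by (auto simp: scaled_interval_def)
  have emI: "emeasure \<mu> (scaled_interval 1 x \<delta>) \<le> ennreal (Q * (1 + \<bar>x\<bar>) ^ m)" for x
  proof -
    have "emeasure \<mu> (scaled_interval 1 x \<delta>) \<le> emeasure \<mu> {x - 2..x + 2}"
      using scaled_interval_subset[OF d, of x] sets by (intro emeasure_mono) auto
    also have "\<dots> \<le> ennreal (Q1 * (1 + \<bar>x\<bar>) ^ m1)" by (rule Q1)
    also have "\<dots> \<le> ennreal (Q * (1 + \<bar>x\<bar>) ^ m)" by (intro ennreal_leI Qle)
    finally show ?thesis .
  qed
  have emJ: "emeasure \<nu> (scaled_interval 2 x \<delta>) \<le> ennreal (Q * (1 + \<bar>x\<bar>) ^ m)" for x
  proof -
    have "emeasure \<nu> (scaled_interval 2 x \<delta>) \<le> emeasure \<nu> {x - 2..x + 2}"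
      using scaled_interval_subset[OF d, of x] sets by (intro emeasure_mono) auto
    also have "\<dots> \<le> ennreal (Q2 * (1 + \<bar>x\<bar>) ^ m2)" by (rule Q2)
    also have "\<dots> \<le> ennreal (Q * (1 + \<bar>x\<bar>) ^ m)" by (intro ennreal_leI Qle)
    finally show ?thesis .
  qed
  interpret \<mu>: sigma_finite_measure \<mu> by (rule sigma_finite_polynomial_growth[OF sets(1) gr(1)])
  interpret \<nu>: sigma_finite_measure \<nu> by (rule sigma_finite_polynomial_growth[OF sets(2) gr(2)])
  interpret P\<mu>: pair_sigma_finite lborel \<mu> ..
  interpret P\<nu>: pair_sigma_finite lborel \<nu> ..
  define T0 where "T0 = 2 * C0 * (8 * Q + 1) + 8 * Q"
  have T0: "T0 > 0" using C Q by (simp add: T0_def add_pos_pos)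
  obtain c2 where c2: "c2 > 0" "\<And>s. s \<ge> 0 \<Longrightarrow> (1 + s) ^ (n + m) \<le> c2 * exp (\<delta> / 4 * s)"
    using polynomial_le_exp[of "\<delta> / 4" "n + m"] d by auto
  define T1 where "T1 = C\<^sup>2 * T0 * exp (2 * \<delta>) / 2 * c2"
  have T1: "T1 > 0" using C T0 c2 by (simp add: T1_def)
  define w where "w x = exp (\<delta> * \<bar>x\<bar> + 2 * \<delta>) / 2" for x :: real
  have w: "w x > 0" for x by (simp add: w_def)
  obtain T2 where T2: "T2 \<ge> 0" "(\<integral>\<^sup>+ x. ennreal (exp (- (\<delta> / 4) * \<bar>x\<bar>)) \<partial>lborel) = ennreal T2"
    using nn_integral_exp_abs_finite[of "\<delta> / 4"] d by (metis ennreal_cases less_irrefl infinity_ennreal_def zero_less_divide_iff zero_less_numeral)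
  define \<rho> where "\<rho> = 1 + (4 / \<delta>) * (T1 * T2 / \<kappa>)"
  have \<rho>: "\<rho> > 0" using d T1 T2 \<kappa> by (simp add: \<rho>_def add_pos_nonneg)
  have small: "T1 * exp (- (\<delta> / 4) * \<rho>) * T2 \<le> \<kappa>"
  proof -
    have "(\<delta> / 4) * \<rho> = \<delta> / 4 + T1 * T2 / \<kappa>" using d by (simp add: \<rho>_def field_simps)
    then have "T1 * T2 / \<kappa> \<le> exp ((\<delta> / 4) * \<rho>)" using exp_ge_add_one_self[of "(\<delta> / 4) * \<rho>"] d by linarith
    then have "T1 * T2 \<le> \<kappa> * exp ((\<delta> / 4) * \<rho>)" using \<kappa> by (simp add: field_simps)
    then have "T1 * T2 * exp (- ((\<delta> / 4) * \<rho>)) \<le> \<kappa> * exp ((\<delta> / 4) * \<rho>) * exp (- ((\<delta> / 4) * \<rho>))" by (intro mult_right_mono) auto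
    also have "\<dots> = \<kappa>" by (simp add: exp_minus)
    finally show ?thesis by (simp add: mult_ac)
  qed
  define C6 where "C6 = 8 * C0 * 3 ^ n * exp (6 * \<delta>)"
  have C6: "C6 > 0" using C by (simp add: C6_def)
  have main: "(\<integral>\<^sup>+ t. indicator {t. \<rho> + 1 < \<bar>t\<bar>} t * ennreal ((cmod (G t))\<^sup>2) \<partial>\<mu>)
      \<le> ennreal C6 * (\<integral>\<^sup>+ t. ennreal ((1 + \<bar>t\<bar>) ^ n * (cmod (G t))\<^sup>2) \<partial>\<nu>) + ennreal (\<kappa> * A\<^sup>2)"
    if G[measurable]: "G \<in> borel_measurable borel" and A: "A \<ge> 0"
      and Gb: "\<And>x. cmod (G x) \<le> C * exp (\<delta> / 8 * \<bar>x\<bar>) * A"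
      and Go: "\<And>x t. \<bar>t - x\<bar> \<le> 2 \<Longrightarrow> cmod (G t - G x) \<le> C * exp (\<delta> / 8 * \<bar>x\<bar>) * A * \<bar>t - x\<bar>" for G :: "real \<Rightarrow> complex" and A
  proof -
    define g where "g t = (cmod (G t))\<^sup>2" for t
    have g: "g t \<ge> 0" for t by (simp add: g_def)
    have gm[measurable]: "g \<in> borel_measurable borel" unfolding g_def by measurable
    have ind_m: "(\<lambda>t. indicator (scaled_interval r x \<delta>) t * ennreal (g t)) \<in> borel_measurable \<mu>"
      "(\<lambda>t. indicator (scaled_interval r x \<delta>) t * ennreal (g t)) \<in> borel_measurable \<nu>" for r x
      by (intro borel_measurable_times_ennreal borel_measurable_indicator meas_in; measurable)+
    define k1 where "k1 x t = (if \<rho> < \<bar>x\<bar> \<and> \<bar>t - x\<bar> \<le> exp (- \<delta> * \<bar>x\<bar>) then ennreal (exp (\<delta> * \<bar>x\<bar> + 2 * \<delta>) / 2 * g t) else 0)" for x t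
    define k2 where "k2 x t = (if \<bar>t - x\<bar> \<le> 2 * exp (- \<delta> * \<bar>x\<bar>) then ennreal (4 * (C0 * (1 + \<bar>x\<bar>) ^ n) * (exp (\<delta> * \<bar>x\<bar> + 2 * \<delta>) / 2) * g t) else 0)" for x t
    have k1m: "(\<lambda>(x, t). k1 x t) \<in> borel_measurable (lborel \<Otimes>\<^sub>M \<mu>)" unfolding k1_def split_beta by measurable
    have k2m: "(\<lambda>(x, t). k2 x t) \<in> borel_measurable (lborel \<Otimes>\<^sub>M \<nu>)" unfolding k2_def split_beta by measurable
    have k2m'[measurable]: "(\<lambda>x. \<integral>\<^sup>+ t. k2 x t \<partial>\<nu>) \<in> borel_measurable lborel"
      using \<nu>.borel_measurable_nn_integral[OF k2m] by simp
    have point: "(\<integral>\<^sup>+ t. k1 x t \<partial>\<mu>) \<le> (\<integral>\<^sup>+ t. k2 x t \<partial>\<nu>) + ennreal (A\<^sup>2 * T1 * exp (- (\<delta> / 4) * \<rho>)) * ennreal (exp (- (\<delta> / 4) * \<bar>x\<bar>))" for x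
    proof (cases "\<rho> < \<bar>x\<bar>")
      case False
      then show ?thesis by (simp add: k1_def)
    next
      case True
      define E where "E = exp (- \<delta> * \<bar>x\<bar>)"
      define B where "B = C * exp (\<delta> / 8 * \<bar>x\<bar>) * A"
      define X where "X = 1 + \<bar>x\<bar>"
      have E: "0 < E" "E \<le> 1" using d by (auto simp: E_def)
      have B: "B \<ge> 0" using C A by (simp add: B_def)
      have X: "X \<ge> 1" by (simp add: X_def)
      let ?I = "scaled_interval 1 x \<delta>" and ?J = "scaled_interval 2 x \<delta>"
      define r where "r = 2 * (C0 * X ^ n) * (2 * (2 * E * B)\<^sup>2 * (Q * X ^ m) + B\<^sup>2 * E\<^sup>2) + 2 * (2 * E * B)\<^sup>2 * (Q * X ^ m)"
      have cmp: "(\<integral>\<^sup>+ t. indicator ?I t * ennreal ((cmod (G t))\<^sup>2) \<partial>\<mu>)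
         \<le> ennreal (4 * (C0 * X ^ n)) * (\<integral>\<^sup>+ t. indicator ?J t * ennreal ((cmod (G t))\<^sup>2) \<partial>\<nu>) + ennreal r"
        unfolding r_def
      proof (rule interval_comparison[where g = "G x"])
        show "(cmod (G t - G x))\<^sup>2 \<le> (2 * E * B)\<^sup>2" if "t \<in> ?J" for t
        proof (rule power_mono)
          have tx: "\<bar>t - x\<bar> \<le> 2 * E" using that by (simp add: mem_scaled_interval E_def)
          then have "cmod (G t - G x) \<le> B * \<bar>t - x\<bar>" using Go[of t x] E by (simp add: B_def)
          also have "\<dots> \<le> B * (2 * E)" using tx B by (intro mult_left_mono)
          finally show "cmod (G t - G x) \<le> 2 * E * B" by (simp add: mult_ac)
        qed simp
        show "(cmod (G x))\<^sup>2 \<le> B\<^sup>2" using Gb[of x] by (intro power_mono) (auto simp: B_def)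
        have "exp (- 2 * \<delta> * \<bar>x\<bar>) = E\<^sup>2" by (simp add: E_def exp_double[symmetric] mult_ac flip: exp_of_nat_mult)
        then show "emeasure \<mu> ?I \<le> ennreal (C0 * X ^ n) * (emeasure \<nu> ?J + ennreal (E\<^sup>2))"
          using dom[of x] by (simp add: X_def)
        show "emeasure \<mu> ?I \<le> ennreal (Q * X ^ m)" "emeasure \<nu> ?J \<le> ennreal (Q * X ^ m)"
          using emI[of x] emJ[of x] by (auto simp: X_def)
        show "?I \<subseteq> ?J" by (rule scaled_interval_subset[OF d])
        show "G \<in> borel_measurable \<nu>" by measurable
      qed (use meas_in C Q X B in auto)
      have wr: "w x * r \<le> A\<^sup>2 * T1 * exp (- (\<delta> / 4) * \<rho>) * exp (- (\<delta> / 4) * \<bar>x\<bar>)"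
      proof -
        have "r = (E * B)\<^sup>2 * (2 * (C0 * X ^ n) * (8 * (Q * X ^ m) + 1) + 8 * (Q * X ^ m))"
          by (simp add: r_def power_mult_distrib algebra_simps)
        also have "\<dots> \<le> (E * B)\<^sup>2 * (T0 * X ^ (n + m))"
        proof (intro mult_left_mono)
          have a: "1 \<le> X ^ m" "1 \<le> X ^ n" using X by auto
          have "8 * (Q * X ^ m) + 1 \<le> (8 * Q + 1) * X ^ m" using a by (simp add: distrib_right)
          then have "2 * (C0 * X ^ n) * (8 * (Q * X ^ m) + 1) \<le> 2 * (C0 * X ^ n) * ((8 * Q + 1) * X ^ m)"
            using C X by (intro mult_left_mono) auto
          moreover have "8 * (Q * X ^ m) * 1 \<le> 8 * (Q * X ^ m) * X ^ n" using a Q X by (intro mult_left_mono) auto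
          ultimately show "2 * (C0 * X ^ n) * (8 * (Q * X ^ m) + 1) + 8 * (Q * X ^ m) \<le> T0 * X ^ (n + m)"
            by (simp add: T0_def power_add algebra_simps)
        qed simp
        also have "\<dots> \<le> (E * B)\<^sup>2 * (T0 * (c2 * exp (\<delta> / 4 * \<bar>x\<bar>)))"
          using c2(2)[of "\<bar>x\<bar>"] T0 by (intro mult_left_mono) (auto simp: X_def)
        finally have "w x * r \<le> w x * ((E * B)\<^sup>2 * (T0 * (c2 * exp (\<delta> / 4 * \<bar>x\<bar>))))" using w[of x] by (intro mult_left_mono) auto
        also have "\<dots> = A\<^sup>2 * T1 * (exp (\<delta> * \<bar>x\<bar>) * (exp (- \<delta> * \<bar>x\<bar>))\<^sup>2 * (exp (\<delta> / 8 * \<bar>x\<bar>))\<^sup>2 * exp (\<delta> / 4 * \<bar>x\<bar>))"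
          by (simp add: w_def E_def B_def T1_def exp_add power_mult_distrib mult_ac)
        also have "exp (\<delta> * \<bar>x\<bar>) * (exp (- \<delta> * \<bar>x\<bar>))\<^sup>2 * (exp (\<delta> / 8 * \<bar>x\<bar>))\<^sup>2 * exp (\<delta> / 4 * \<bar>x\<bar>) = exp (- (\<delta> / 4) * \<bar>x\<bar>) * exp (- (\<delta> / 4) * \<bar>x\<bar>)"
          by (simp add: power2_eq_square exp_add[symmetric])
        also have "A\<^sup>2 * T1 * (exp (- (\<delta> / 4) * \<bar>x\<bar>) * exp (- (\<delta> / 4) * \<bar>x\<bar>)) \<le> A\<^sup>2 * T1 * (exp (- (\<delta> / 4) * \<rho>) * exp (- (\<delta> / 4) * \<bar>x\<bar>))"
          using True d T1 by (intro mult_left_mono mult_right_mono) auto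
        finally show ?thesis by (simp add: mult_ac)
      qed
      have "(\<integral>\<^sup>+ t. k1 x t \<partial>\<mu>) = (\<integral>\<^sup>+ t. ennreal (w x) * (indicator ?I t * ennreal (g t)) \<partial>\<mu>)"
        using True g w[of x] by (intro nn_integral_cong) (auto simp: k1_def w_def mem_scaled_interval indicator_def ennreal_mult[symmetric])
      also have "\<dots> = ennreal (w x) * (\<integral>\<^sup>+ t. indicator ?I t * ennreal (g t) \<partial>\<mu>)"
        by (intro nn_integral_cmult ind_m)
      also have "\<dots> \<le> ennreal (w x) * (ennreal (4 * (C0 * X ^ n)) * (\<integral>\<^sup>+ t. indicator ?J t * ennreal (g t) \<partial>\<nu>) + ennreal r)"
        using cmp unfolding g_def by (intro mult_left_mono) auto
      also have "\<dots> = ennreal (w x) * ennreal (4 * (C0 * X ^ n)) * (\<integral>\<^sup>+ t. indicator ?J t * ennreal (g t) \<partial>\<nu>) + ennreal (w x) * ennreal r"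
        by (simp add: distrib_left mult.assoc)
      also have "ennreal (w x) * ennreal (4 * (C0 * X ^ n)) * (\<integral>\<^sup>+ t. indicator ?J t * ennreal (g t) \<partial>\<nu>) = (\<integral>\<^sup>+ t. k2 x t \<partial>\<nu>)"
      proof -
        have "(\<integral>\<^sup>+ t. k2 x t \<partial>\<nu>) = (\<integral>\<^sup>+ t. (ennreal (w x) * ennreal (4 * (C0 * X ^ n))) * (indicator ?J t * ennreal (g t)) \<partial>\<nu>)"
          using g w[of x] C X by (intro nn_integral_cong) (auto simp: k2_def w_def X_def mem_scaled_interval indicator_def ennreal_mult[symmetric] mult_ac)
        also have "\<dots> = (ennreal (w x) * ennreal (4 * (C0 * X ^ n))) * (\<integral>\<^sup>+ t. indicator ?J t * ennreal (g t) \<partial>\<nu>)"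
          by (intro nn_integral_cmult ind_m)
        finally show ?thesis by simp
      qed
      also have "ennreal (w x) * ennreal r \<le> ennreal (A\<^sup>2 * T1 * exp (- (\<delta> / 4) * \<rho>)) * ennreal (exp (- (\<delta> / 4) * \<bar>x\<bar>))"
      proof -
        have "r \<ge> 0" unfolding r_def using C Q X by simp
        then have "ennreal (w x) * ennreal r = ennreal (w x * r)" using w[of x] by (subst ennreal_mult) auto
        also have "\<dots> \<le> ennreal (A\<^sup>2 * T1 * exp (- (\<delta> / 4) * \<rho>) * exp (- (\<delta> / 4) * \<bar>x\<bar>))" by (intro ennreal_leI wr)
        also have "\<dots> = ennreal (A\<^sup>2 * T1 * exp (- (\<delta> / 4) * \<rho>)) * ennreal (exp (- (\<delta> / 4) * \<bar>x\<bar>))" using T1 by (subst ennreal_mult) auto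
        finally show ?thesis .
      qed
      finally show ?thesis by (simp add: add_left_mono)
    qed
    have "(\<integral>\<^sup>+ t. indicator {t. \<rho> + 1 < \<bar>t\<bar>} t * ennreal (g t) \<partial>\<mu>) \<le> (\<integral>\<^sup>+ t. (\<integral>\<^sup>+ x. k1 x t \<partial>lborel) \<partial>\<mu>)"
    proof (intro nn_integral_mono)
      fix t
      show "indicator {t. \<rho> + 1 < \<bar>t\<bar>} t * ennreal (g t) \<le> (\<integral>\<^sup>+ x. k1 x t \<partial>lborel)"
        using centre_average_lower[OF d, of \<rho> t "g t"] g by (cases "\<rho> + 1 < \<bar>t\<bar>") (auto simp: k1_def)
    qed
    also have "\<dots> = (\<integral>\<^sup>+ x. (\<integral>\<^sup>+ t. k1 x t \<partial>\<mu>) \<partial>lborel)" by (rule P\<mu>.Fubini'[OF k1m])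
    also have "\<dots> \<le> (\<integral>\<^sup>+ x. (\<integral>\<^sup>+ t. k2 x t \<partial>\<nu>) + ennreal (A\<^sup>2 * T1 * exp (- (\<delta> / 4) * \<rho>)) * ennreal (exp (- (\<delta> / 4) * \<bar>x\<bar>)) \<partial>lborel)"
      by (intro nn_integral_mono point)
    also have "\<dots> = (\<integral>\<^sup>+ x. (\<integral>\<^sup>+ t. k2 x t \<partial>\<nu>) \<partial>lborel) + ennreal (A\<^sup>2 * T1 * exp (- (\<delta> / 4) * \<rho>)) * ennreal T2"
      unfolding T2(2)[symmetric] by (subst nn_integral_add) (auto simp: nn_integral_cmult)
    also have "(\<integral>\<^sup>+ x. (\<integral>\<^sup>+ t. k2 x t \<partial>\<nu>) \<partial>lborel) = (\<integral>\<^sup>+ t. (\<integral>\<^sup>+ x. k2 x t \<partial>lborel) \<partial>\<nu>)"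
      by (rule P\<nu>.Fubini'[OF k2m, symmetric])
    also have "\<dots> \<le> (\<integral>\<^sup>+ t. ennreal C6 * ennreal ((1 + \<bar>t\<bar>) ^ n * g t) \<partial>\<nu>)"
      unfolding k2_def C6_def by (intro nn_integral_mono centre_average_upper d g C)
    also have "\<dots> = ennreal C6 * (\<integral>\<^sup>+ t. ennreal ((1 + \<bar>t\<bar>) ^ n * g t) \<partial>\<nu>)" by (intro nn_integral_cmult) measurable
    also have "ennreal (A\<^sup>2 * T1 * exp (- (\<delta> / 4) * \<rho>)) * ennreal T2 \<le> ennreal (\<kappa> * A\<^sup>2)"
    proof -
      have "ennreal (A\<^sup>2 * T1 * exp (- (\<delta> / 4) * \<rho>)) * ennreal T2 = ennreal (A\<^sup>2 * T1 * exp (- (\<delta> / 4) * \<rho>) * T2)"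
        using T1 T2 by (subst ennreal_mult) auto
      also have "\<dots> \<le> ennreal (\<kappa> * A\<^sup>2)"
      proof (rule ennreal_leI)
        have "A\<^sup>2 * (T1 * exp (- (\<delta> / 4) * \<rho>) * T2) \<le> A\<^sup>2 * \<kappa>" by (intro mult_left_mono small) auto
        then show "A\<^sup>2 * T1 * exp (- (\<delta> / 4) * \<rho>) * T2 \<le> \<kappa> * A\<^sup>2" by (simp add: mult_ac)
      qed
      finally show ?thesis .
    qed
    finally show ?thesis unfolding g_def by (simp add: add_mono)
  qed
  show ?thesis
    by (rule exI[of _ "\<rho> + 1"], rule conjI, use \<rho> in simp, rule exI[of _ C6], rule conjI[OF C6]) (intro allI impI main; simp)
qed

section \<open>Evaluation at a point and transfer of density\<close>

text \<open>Let \<open>G = z\<^sup>N F\<close> with norm \<open>A\<close> in \<open>L\<^sup>2(\<mu>)\<close>. The part of \<open>A\<^sup>2\<close> outside \<open>[- R, R]\<close> is at most \<open>C6 W + A\<^sup>2 / 4\<close>, where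
  \<open>W\<close> is a weighted integral with respect to \<open>\<nu>\<close>. On \<open>\<bar>z\<bar> = 2 R\<close> one has \<open>\<bar>G\<bar> \<le> K A\<close>, so the maximum principle for
  \<open>F\<close> yields \<open>\<bar>G\<bar> \<le> K A / 2\<^sup>N\<close> on \<open>[- R, R]\<close>, and for large \<open>N\<close> this part of \<open>A\<^sup>2\<close> is at most \<open>A\<^sup>2 / 4\<close> as well.
  Hence \<open>A\<^sup>2 \<le> 2 C6 W\<close>, and \<open>\<bar>F(\<i>)\<bar> = \<bar>G(\<i>)\<bar> \<le> K A\<close>.\<close>

lemma point_evaluation_bound:
  assumes sets: "sets \<mu> = sets borel" "sets \<nu> = sets borel"
    and gr: "polynomial_growth \<mu>" "polynomial_growth \<nu>" and a: "a > 0"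
    and nd: "\<not> dense_in_L2 (fourier_space a) \<mu>" and dom: "\<mu> \<preceq>\<^sub>w \<nu>"
  shows "\<exists>C m. C \<ge> 0 \<and> (\<forall>F\<in>PW a. ennreal ((cmod (F \<i>))\<^sup>2) \<le> ennreal C * (\<integral>\<^sup>+ t. ennreal ((1 + \<bar>t\<bar>) ^ m * (cmod (F (of_real t)))\<^sup>2) \<partial>\<nu>))"
proof -
  obtain \<delta> C0 n' where \<delta>: "\<delta> > 0" and C0: "C0 > 0" and n': "n' \<ge> 0"
    and dom': "\<And>x. emeasure \<mu> (scaled_interval 1 x \<delta>)
             \<le> ennreal (C0 * (1 + \<bar>x\<bar>) powr n') * (emeasure \<nu> (scaled_interval 2 x \<delta>) + ennreal (exp (- 2 * \<delta> * \<bar>x\<bar>)))"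
    using dom unfolding weakly_dominated_def by blast
  define n where "n = nat \<lceil>n'\<rceil>"
  have dom'': "emeasure \<mu> (scaled_interval 1 x \<delta>)
      \<le> ennreal (C0 * (1 + \<bar>x\<bar>) ^ n) * (emeasure \<nu> (scaled_interval 2 x \<delta>) + ennreal (exp (- 2 * \<delta> * \<bar>x\<bar>)))" for x
  proof -
    have "n' \<le> real n" unfolding n_def by linarith
    then have "(1 + \<bar>x\<bar>) powr n' \<le> (1 + \<bar>x\<bar>) powr real n" by (intro powr_mono) auto
    also have "\<dots> = (1 + \<bar>x\<bar>) ^ n" by (intro powr_realpow) auto
    finally have "ennreal (C0 * (1 + \<bar>x\<bar>) powr n') \<le> ennreal (C0 * (1 + \<bar>x\<bar>) ^ n)" using C0 by (intro ennreal_leI mult_left_mono) auto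
    then have "ennreal (C0 * (1 + \<bar>x\<bar>) powr n') * (emeasure \<nu> (scaled_interval 2 x \<delta>) + ennreal (exp (- 2 * \<delta> * \<bar>x\<bar>)))
       \<le> ennreal (C0 * (1 + \<bar>x\<bar>) ^ n) * (emeasure \<nu> (scaled_interval 2 x \<delta>) + ennreal (exp (- 2 * \<delta> * \<bar>x\<bar>)))"
      by (rule mult_right_mono) simp
    with dom'[of x] show ?thesis by (rule order_trans)
  qed
  obtain C where C: "C > 0" and Cb: "\<And>F x z. F \<in> PW a \<Longrightarrow> cmod (z - of_real x) \<le> 3 \<Longrightarrow> cmod (F z) \<le> C * exp (\<delta> / 8 * \<bar>x\<bar>) * PW_norm \<mu> F"
    using non_dense_real_axis_bound[OF sets(1) gr(1) a nd, of "\<delta> / 8"] \<delta> by auto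
  obtain \<rho> C6 where \<rho>: "\<rho> > 0" and C6: "C6 > 0" and tail: "\<And>(G :: real \<Rightarrow> complex) A. G \<in> borel_measurable borel \<Longrightarrow> A \<ge> 0 \<Longrightarrow>
      (\<And>x. cmod (G x) \<le> C * exp (\<delta> / 8 * \<bar>x\<bar>) * A) \<Longrightarrow>
      (\<And>x t. \<bar>t - x\<bar> \<le> 2 \<Longrightarrow> cmod (G t - G x) \<le> C * exp (\<delta> / 8 * \<bar>x\<bar>) * A * \<bar>t - x\<bar>) \<Longrightarrow>
      (\<integral>\<^sup>+ t. indicator {t. \<rho> < \<bar>t\<bar>} t * ennreal ((cmod (G t))\<^sup>2) \<partial>\<mu>)
      \<le> ennreal C6 * (\<integral>\<^sup>+ t. ennreal ((1 + \<bar>t\<bar>) ^ n * (cmod (G t))\<^sup>2) \<partial>\<nu>) + ennreal (1 / 4 * A\<^sup>2)"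
  proof -
    have "0 < (1 / 4 :: real)" by simp
    from sampling_tail[OF sets gr \<delta> C0 C this dom''] show thesis
    proof (elim exE conjE, goal_cases)
      case (1 \<rho> C6)
      show ?case by (rule that[OF 1(1,2)]) (use 1(3) in simp)
    qed
  qed
  define R where "R = max \<rho> 1"
  have R: "R \<ge> 1" "\<rho> \<le> R" by (auto simp: R_def)
  obtain K where K: "K > 0" and Kb: "\<And>F z. F \<in> PW a \<Longrightarrow> cmod z \<le> 2 * R \<Longrightarrow> cmod (F z) \<le> K * PW_norm \<mu> F"
    using non_dense_local_bound[OF sets(1) gr(1) a nd, of "2 * R"] R by auto
  obtain M where M: "M \<ge> 0" "emeasure \<mu> {- R..R} \<le> ennreal M"
  proof -
    obtain J k where "J \<ge> 0" "\<And>r. r \<ge> 0 \<Longrightarrow> emeasure \<mu> {- r..r} \<le> ennreal (J * (1 + r) ^ k)"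
      using polynomial_growth_emeasure[OF sets(1) gr(1)] by blast
    then show ?thesis using R by (intro that[of "J * (1 + R) ^ k"]) auto
  qed
  obtain N where N: "(1 / 4 :: real) ^ N < 1 / (4 * (M * K\<^sup>2 + 1))"
    using real_arch_pow_inv[of "1 / (4 * (M * K\<^sup>2 + 1))" "1 / 4"] M by (auto simp: add_nonneg_pos)
  have N': "M * K\<^sup>2 * (1 / 4) ^ N \<le> 1 / 4"
  proof -
    have "(M * K\<^sup>2 + 1) * (1 / 4) ^ N \<le> (M * K\<^sup>2 + 1) * (1 / (4 * (M * K\<^sup>2 + 1)))" using N M by (intro mult_left_mono) auto
    also have "\<dots> = 1 / 4"
    proof -
      have "M * K\<^sup>2 + 1 > 0" using M by (simp add: add_nonneg_pos)
      then show ?thesis by simp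
    qed
    finally have "M * K\<^sup>2 * (1 / 4) ^ N + (1 / 4) ^ N \<le> 1 / 4" by (simp add: distrib_right)
    moreover have "(1 / 4 :: real) ^ N \<ge> 0" by simp
    ultimately show ?thesis by linarith
  qed
  have "ennreal ((cmod (F \<i>))\<^sup>2) \<le> ennreal (2 * K\<^sup>2 * C6) * (\<integral>\<^sup>+ t. ennreal ((1 + \<bar>t\<bar>) ^ (n + 2 * N) * (cmod (F (of_real t)))\<^sup>2) \<partial>\<nu>)"
    if F: "F \<in> PW a" for F
  proof -
    define G where "G z = z ^ N * F z" for z
    have G: "G \<in> PW a" unfolding G_def by (rule PW_power_times[OF F])
    define A where "A = PW_norm \<mu> G"
    have A: "A \<ge> 0" by (simp add: A_def PW_norm_nonneg)
    have GL: "(\<lambda>t. G (of_real t)) \<in> L2_functions \<mu>" by (rule PW_in_L2[OF sets(1) gr(1) G])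
    have A2: "ennreal (A\<^sup>2) = (\<integral>\<^sup>+ t. ennreal ((cmod (G (of_real t)))\<^sup>2) \<partial>\<mu>)"
      using nn_integral_sq_norm[OF GL] by (simp add: A_def PW_norm_def sq_norm_nonneg)
    have [measurable_cong]: "sets \<mu> = sets borel" "sets \<nu> = sets borel" by (rule sets)+
    have Gm[measurable]: "(\<lambda>t::real. G (of_real t)) \<in> borel_measurable borel" by (rule PW_measurable[OF G refl])
    have Fsmall: "cmod (F z) \<le> K * A / (2 * R) ^ N" if "cmod z \<le> 2 * R" for z
    proof (rule maximum_modulus_frontier[of F "cball (0::complex) (2 * R)"])
      show "F holomorphic_on interior (cball 0 (2 * R))" "continuous_on (closure (cball 0 (2 * R))) F"
        using PW_entire[OF F] holomorphic_on_subset holomorphic_on_imp_continuous_on by blast+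
      fix w :: complex assume "w \<in> frontier (cball 0 (2 * R))"
      then have w: "cmod w = 2 * R" using R by simp
      have "(2 * R) ^ N * cmod (F w) \<le> K * A" using Kb[OF G, of w] w by (simp add: G_def A_def norm_mult norm_power)
      then show "cmod (F w) \<le> K * A / (2 * R) ^ N" using R by (simp add: pos_le_divide_eq mult.commute)
    qed (use that in auto)
    have Gsmall: "(cmod (G (of_real t)))\<^sup>2 \<le> K\<^sup>2 * A\<^sup>2 * (1 / 4) ^ N" if t: "\<bar>t\<bar> \<le> R" for t
    proof -
      have "cmod (G (of_real t)) = \<bar>t\<bar> ^ N * cmod (F (of_real t))" by (simp add: G_def norm_mult norm_power)
      also have "\<dots> \<le> R ^ N * (K * A / (2 * R) ^ N)" using t R Fsmall[of "of_real t"] by (intro mult_mono power_mono) auto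
      also have "\<dots> = K * A / 2 ^ N" using R by (simp add: power_mult_distrib)
      finally have "(cmod (G (of_real t)))\<^sup>2 \<le> (K * A / 2 ^ N)\<^sup>2" by (intro power_mono) auto
      also have "\<dots> = K\<^sup>2 * A\<^sup>2 * (1 / 4) ^ N"
      proof -
        have "(2 ^ N)\<^sup>2 = (4 :: real) ^ N" by (simp add: power2_eq_square power_mult_distrib[symmetric])
        then show ?thesis by (simp add: power_divide power_mult_distrib)
      qed
      finally show ?thesis .
    qed
    define W where "W = (\<integral>\<^sup>+ t. ennreal ((1 + \<bar>t\<bar>) ^ n * (cmod (G (of_real t)))\<^sup>2) \<partial>\<nu>)"
    have near: "(\<integral>\<^sup>+ t. indicator {- R..R} t * ennreal ((cmod (G (of_real t)))\<^sup>2) \<partial>\<mu>) \<le> ennreal (A\<^sup>2 / 4)"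
    proof -
      have "(\<integral>\<^sup>+ t. indicator {- R..R} t * ennreal ((cmod (G (of_real t)))\<^sup>2) \<partial>\<mu>) \<le> (\<integral>\<^sup>+ t. ennreal (K\<^sup>2 * A\<^sup>2 * (1 / 4) ^ N) * indicator {- R..R} t \<partial>\<mu>)"
        using Gsmall by (intro nn_integral_mono) (auto simp: indicator_def abs_le_iff intro!: ennreal_leI)
      also have "\<dots> = ennreal (K\<^sup>2 * A\<^sup>2 * (1 / 4) ^ N) * emeasure \<mu> {- R..R}" using sets by (intro nn_integral_cmult_indicator) auto
      also have "\<dots> \<le> ennreal (K\<^sup>2 * A\<^sup>2 * (1 / 4) ^ N) * ennreal M" by (intro mult_left_mono M) auto
      also have "\<dots> = ennreal (A\<^sup>2 * (M * K\<^sup>2 * (1 / 4) ^ N))" using M by (subst ennreal_mult[symmetric]) (auto simp: mult_ac)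
      also have "\<dots> \<le> ennreal (A\<^sup>2 * (1 / 4))" by (intro ennreal_leI mult_left_mono N') auto
      finally show ?thesis by simp
    qed
    have far: "(\<integral>\<^sup>+ t. indicator {t. \<rho> < \<bar>t\<bar>} t * ennreal ((cmod (G (of_real t)))\<^sup>2) \<partial>\<mu>) \<le> ennreal C6 * W + ennreal (1 / 4 * A\<^sup>2)"
      unfolding W_def
    proof (rule tail[OF Gm A])
      show "cmod (G (of_real x)) \<le> C * exp (\<delta> / 8 * \<bar>x\<bar>) * A" for x unfolding A_def by (rule Cb[OF G]) simp
      show "cmod (G (of_real t) - G (of_real x)) \<le> C * exp (\<delta> / 8 * \<bar>x\<bar>) * A * \<bar>t - x\<bar>" if "\<bar>t - x\<bar> \<le> 2" for x t
        unfolding A_def by (rule entire_oscillation_bound[OF PW_entire[OF G] Cb[OF G] that])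
    qed
    have "ennreal (A\<^sup>2) \<le> (\<integral>\<^sup>+ t. indicator {- R..R} t * ennreal ((cmod (G (of_real t)))\<^sup>2) + indicator {t. \<rho> < \<bar>t\<bar>} t * ennreal ((cmod (G (of_real t)))\<^sup>2) \<partial>\<mu>)"
      unfolding A2
    proof (intro nn_integral_mono)
      fix t
      have "t \<in> {- R..R} \<or> \<rho> < \<bar>t\<bar>" using R by (auto simp: abs_le_iff)
      then show "ennreal ((cmod (G (of_real t)))\<^sup>2) \<le> indicator {- R..R} t * ennreal ((cmod (G (of_real t)))\<^sup>2) + indicator {t. \<rho> < \<bar>t\<bar>} t * ennreal ((cmod (G (of_real t)))\<^sup>2)"
        by (auto simp: indicator_def)
    qed
    also have "\<dots> = (\<integral>\<^sup>+ t. indicator {- R..R} t * ennreal ((cmod (G (of_real t)))\<^sup>2) \<partial>\<mu>) + (\<integral>\<^sup>+ t. indicator {t. \<rho> < \<bar>t\<bar>} t * ennreal ((cmod (G (of_real t)))\<^sup>2) \<partial>\<mu>)"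
      by (rule nn_integral_add) measurable
    also have "\<dots> \<le> ennreal (A\<^sup>2 / 4) + (ennreal C6 * W + ennreal (1 / 4 * A\<^sup>2))" by (intro add_mono near far)
    also have "\<dots> = ennreal (A\<^sup>2 / 2) + ennreal C6 * W"
    proof -
      have "ennreal (A\<^sup>2 / 4) + ennreal (1 / 4 * A\<^sup>2) = ennreal (A\<^sup>2 / 2)" by (subst ennreal_plus[symmetric]) auto
      then show ?thesis by (metis add.assoc add.commute)
    qed
    finally have "ennreal (A\<^sup>2 / 2) + ennreal (A\<^sup>2 / 2) \<le> ennreal (A\<^sup>2 / 2) + ennreal C6 * W"
      by (subst (asm) field_sum_of_halves[symmetric], subst (asm) ennreal_plus) auto
    then have half: "ennreal (A\<^sup>2 / 2) \<le> ennreal C6 * W" by (simp add: ennreal_add_left_cancel_le)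
    have "cmod (F \<i>) = cmod (G \<i>)" by (simp add: G_def norm_mult norm_power)
    also have "\<dots> \<le> K * A" unfolding A_def using R by (intro Kb[OF G]) auto
    finally have "(cmod (F \<i>))\<^sup>2 \<le> (K * A)\<^sup>2" by (intro power_mono) auto
    then have "(cmod (F \<i>))\<^sup>2 \<le> (2 * K\<^sup>2) * (A\<^sup>2 / 2)" by (simp add: power_mult_distrib)
    then have "ennreal ((cmod (F \<i>))\<^sup>2) \<le> ennreal ((2 * K\<^sup>2) * (A\<^sup>2 / 2))" by (rule ennreal_leI)
    also have "\<dots> = ennreal (2 * K\<^sup>2) * ennreal (A\<^sup>2 / 2)" by (rule ennreal_mult) auto
    also have "\<dots> \<le> ennreal (2 * K\<^sup>2) * (ennreal C6 * W)" by (intro mult_left_mono half) auto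
    also have "\<dots> = ennreal (2 * K\<^sup>2 * C6) * W" using C6 by (simp add: ennreal_mult mult.assoc)
    also have "\<dots> \<le> ennreal (2 * K\<^sup>2 * C6) * (\<integral>\<^sup>+ t. ennreal ((1 + \<bar>t\<bar>) ^ (n + 2 * N) * (cmod (F (of_real t)))\<^sup>2) \<partial>\<nu>)"
      unfolding W_def
    proof (intro mult_left_mono nn_integral_mono ennreal_leI)
      fix t :: real
      have "(cmod (G (of_real t)))\<^sup>2 = \<bar>t\<bar> ^ (2 * N) * (cmod (F (of_real t)))\<^sup>2"
        by (simp add: G_def norm_mult norm_power power_mult_distrib power_mult[symmetric] mult.commute)
      also have "\<dots> \<le> (1 + \<bar>t\<bar>) ^ (2 * N) * (cmod (F (of_real t)))\<^sup>2" by (intro mult_right_mono power_mono) auto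
      finally have "(1 + \<bar>t\<bar>) ^ n * (cmod (G (of_real t)))\<^sup>2 \<le> (1 + \<bar>t\<bar>) ^ n * ((1 + \<bar>t\<bar>) ^ (2 * N) * (cmod (F (of_real t)))\<^sup>2)"
        by (intro mult_left_mono) auto
      then show "(1 + \<bar>t\<bar>) ^ n * (cmod (G (of_real t)))\<^sup>2 \<le> (1 + \<bar>t\<bar>) ^ (n + 2 * N) * (cmod (F (of_real t)))\<^sup>2"
        by (simp add: power_add mult.assoc)
    qed simp
    finally show ?thesis .
  qed
  moreover have "2 * K\<^sup>2 * C6 \<ge> 0" using C6 by simp
  ultimately show ?thesis by (intro exI[of _ "2 * K\<^sup>2 * C6"] exI[of _ "n + 2 * N"]) simp
qed

text \<open>If \<open>H \<in> \<E>(a)\<close> is close to \<open>g = h / (x - \<i>)\<close> in \<open>L\<^sup>2(\<nu>)\<close>, then \<open>F = (z - \<i>) h H - h\<^sup>2 = (z - \<i>) h (H - g)\<close> is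
  small in every polynomially weighted \<open>L\<^sup>2(\<nu>)\<close>, since \<open>h\<close> decreases rapidly. But \<open>\<bar>F(\<i>)\<bar> = \<bar>h(\<i>)\<bar>\<^sup>2\<close> is
  fixed. The type of \<open>h\<close> is so small that \<open>F\<close> has type at most \<open>a1\<close>.\<close>

lemma density_transfer:
  assumes sets: "sets \<mu> = sets borel" "sets \<nu> = sets borel"
    and gr: "polynomial_growth \<mu>" "polynomial_growth \<nu>" and dom: "\<mu> \<preceq>\<^sub>w \<nu>"
    and a: "0 < a" "a < a1" and dense: "dense_in_L2 (fourier_space a) \<nu>"
  shows "dense_in_L2 (fourier_space a1) \<mu>"
proof (rule ccontr)
  assume nd: "\<not> ?thesis"
  have a1: "a1 > 0" using a by simp
  obtain C m where C: "C \<ge> 0" and pe: "\<And>F. F \<in> PW a1 \<Longrightarrow> ennreal ((cmod (F \<i>))\<^sup>2) \<le> ennreal C * (\<integral>\<^sup>+ t. ennreal ((1 + \<bar>t\<bar>) ^ m * (cmod (F (of_real t)))\<^sup>2) \<partial>\<nu>)"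
    using point_evaluation_bound[OF sets gr a1 nd dom] by blast
  define b where "b = min (a1 - a) (a1 / 2)"
  have b: "b > 0" "a + b \<le> a1" "b + b \<le> a1" using a a1 by (auto simp: b_def min_def)
  obtain h where h: "h \<in> PW b" "h \<i> \<noteq> 0" using PW_nonvanishing[OF b(1), of 0] by auto
  obtain D where D: "D \<ge> 0" "\<And>t::real. (1 + \<bar>t\<bar>) ^ (m + 1) * cmod (h (of_real t)) \<le> D" using PW_decay[OF h(1), of "m + 1"] by blast
  have [measurable_cong]: "sets \<mu> = sets borel" "sets \<nu> = sets borel" by (rule sets)+
  have ti: "of_real t - \<i> \<noteq> 0" for t :: real by (simp add: complex_eq_iff)
  define g where "g t = 1 / (of_real t - \<i>) * h (of_real t)" for t :: real
  have kb: "cmod (1 / (of_real t - \<i>)) \<le> 1" for t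
  proof -
    have "1 \<le> cmod (of_real t - \<i>)" using abs_Im_le_cmod[of "of_real t - \<i>"] by simp
    then have "inverse (cmod (of_real t - \<i>)) \<le> inverse 1" by (rule le_imp_inverse_le) simp
    then show ?thesis by (simp only: divide_inverse norm_inverse inverse_1 mult_1)
  qed
  have km: "(\<lambda>t. 1 / (complex_of_real t - \<i>)) \<in> borel_measurable \<nu>" by measurable
  have gL: "g \<in> L2_functions \<nu>" unfolding g_def
    by (rule L2_bounded_mult(1)[OF PW_in_L2[OF sets(2) gr(2) h(1)] km kb])
  have est: "(cmod (h \<i>)) ^ 4 \<le> C * (D\<^sup>2 * e)" if e: "e > 0" for e
  proof -
    have "\<exists>H\<in>fourier_space a. (\<integral>\<^sup>+ t. ennreal ((cmod (g t - H t))\<^sup>2) \<partial>\<nu>) < ennreal ((sqrt e)\<^sup>2)"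
      using dense gL e unfolding dense_in_L2_def by (meson real_sqrt_gt_zero)
    then obtain H where H: "H \<in> PW a" and Hd: "(\<integral>\<^sup>+ t. ennreal ((cmod (g t - H (of_real t)))\<^sup>2) \<partial>\<nu>) < ennreal e"
      using e unfolding fourier_space_eq[OF a(1)] by auto
    define F where "F z = 1 * ((z * h z + (- \<i>) * h z) * H z) + (- 1) * (h z * h z)" for z
    have "(\<lambda>z. 1 * (z * h z) + (- \<i>) * h z) \<in> PW b" by (intro PW_linear_combination PW_times_z h)
    then have "(\<lambda>z. (z * h z + (- \<i>) * h z) * H z) \<in> PW (b + a)" using PW_mult[OF _ H] by simp
    then have "(\<lambda>z. (z * h z + (- \<i>) * h z) * H z) \<in> PW a1" using PW_mono b(2) by (simp add: add.commute)
    moreover have "(\<lambda>z. h z * h z) \<in> PW a1" using PW_mono[OF PW_mult[OF h(1) h(1)] b(3)] .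
    ultimately have F: "F \<in> PW a1" unfolding F_def by (rule PW_linear_combination)
    have Ft: "F (of_real t) = (of_real t - \<i>) * h (of_real t) * (H (of_real t) - g t)" for t :: real
    proof -
      have "(of_real t - \<i>) * g t = h (of_real t)" using ti[of t] by (simp add: g_def)
      then have "h (of_real t) * h (of_real t) = h (of_real t) * ((of_real t - \<i>) * g t)" by (simp only:)
      moreover have "F (of_real t) = (of_real t - \<i>) * h (of_real t) * H (of_real t) - h (of_real t) * h (of_real t)"
        by (simp add: F_def algebra_simps)
      moreover have "h (of_real t) * ((of_real t - \<i>) * g t) = (of_real t - \<i>) * h (of_real t) * g t" by simp
      ultimately show ?thesis by (simp only: right_diff_distrib)
    qed
    have Fi: "(cmod (F \<i>))\<^sup>2 = (cmod (h \<i>)) ^ 4" by (simp add: F_def norm_mult power2_eq_square eval_nat_numeral)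
    have "(\<integral>\<^sup>+ t. ennreal ((1 + \<bar>t\<bar>) ^ m * (cmod (F (of_real t)))\<^sup>2) \<partial>\<nu>) \<le> (\<integral>\<^sup>+ t. ennreal (D\<^sup>2) * ennreal ((cmod (g t - H (of_real t)))\<^sup>2) \<partial>\<nu>)"
    proof (intro nn_integral_mono)
      fix t :: real
      have "cmod (of_real t - \<i>) \<le> 1 + \<bar>t\<bar>" using norm_triangle_ineq4[of "of_real t" \<i>] by simp
      then have "cmod ((of_real t - \<i>) * h (of_real t)) \<le> (1 + \<bar>t\<bar>) * cmod (h (of_real t))" by (simp add: norm_mult mult_right_mono)
      then have "(1 + \<bar>t\<bar>) ^ m * cmod ((of_real t - \<i>) * h (of_real t)) \<le> (1 + \<bar>t\<bar>) ^ m * ((1 + \<bar>t\<bar>) * cmod (h (of_real t)))"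
        by (intro mult_left_mono) auto
      also have "\<dots> \<le> D" using D(2)[of t] by (simp add: mult_ac)
      finally have 1: "(1 + \<bar>t\<bar>) ^ m * cmod ((of_real t - \<i>) * h (of_real t)) \<le> D" .
      have "cmod ((of_real t - \<i>) * h (of_real t)) * 1 \<le> cmod ((of_real t - \<i>) * h (of_real t)) * (1 + \<bar>t\<bar>) ^ m"
        by (intro mult_left_mono one_le_power) auto
      then have 2: "cmod ((of_real t - \<i>) * h (of_real t)) \<le> D" using 1 by (simp add: mult.commute)
      have "(1 + \<bar>t\<bar>) ^ m * (cmod ((of_real t - \<i>) * h (of_real t)))\<^sup>2 \<le> D * D"
        using mult_mono[OF 1 2] D(1) by (simp add: power2_eq_square mult.assoc)
      then have "(1 + \<bar>t\<bar>) ^ m * (cmod ((of_real t - \<i>) * h (of_real t)))\<^sup>2 * (cmod (g t - H (of_real t)))\<^sup>2 \<le> D\<^sup>2 * (cmod (g t - H (of_real t)))\<^sup>2"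
        by (intro mult_right_mono) (auto simp: power2_eq_square)
      then have "(1 + \<bar>t\<bar>) ^ m * (cmod (F (of_real t)))\<^sup>2 \<le> D\<^sup>2 * (cmod (g t - H (of_real t)))\<^sup>2"
        unfolding Ft norm_mult[of "(of_real t - \<i>) * h (of_real t)"] power_mult_distrib
        by (simp add: mult.assoc norm_minus_commute)
      then have "ennreal ((1 + \<bar>t\<bar>) ^ m * (cmod (F (of_real t)))\<^sup>2) \<le> ennreal (D\<^sup>2 * (cmod (g t - H (of_real t)))\<^sup>2)" by (rule ennreal_leI)
      then show "ennreal ((1 + \<bar>t\<bar>) ^ m * (cmod (F (of_real t)))\<^sup>2) \<le> ennreal (D\<^sup>2) * ennreal ((cmod (g t - H (of_real t)))\<^sup>2)"
        by (simp add: ennreal_mult)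
    qed
    also have "\<dots> = ennreal (D\<^sup>2) * (\<integral>\<^sup>+ t. ennreal ((cmod (g t - H (of_real t)))\<^sup>2) \<partial>\<nu>)"
    proof -
      have [measurable]: "g \<in> borel_measurable \<nu>" using gL by (simp add: L2_functions_iff)
      have [measurable]: "(\<lambda>t. H (of_real t)) \<in> borel_measurable \<nu>" by (rule PW_measurable[OF H sets(2)])
      show ?thesis by (intro nn_integral_cmult) measurable
    qed
    also have "\<dots> \<le> ennreal (D\<^sup>2) * ennreal e" using Hd by (intro mult_left_mono) auto
    finally have "ennreal C * (\<integral>\<^sup>+ t. ennreal ((1 + \<bar>t\<bar>) ^ m * (cmod (F (of_real t)))\<^sup>2) \<partial>\<nu>) \<le> ennreal C * (ennreal (D\<^sup>2) * ennreal e)"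
      by (intro mult_left_mono) auto
    with pe[OF F] have "ennreal ((cmod (F \<i>))\<^sup>2) \<le> ennreal C * (ennreal (D\<^sup>2) * ennreal e)" by (rule order_trans)
    also have "\<dots> = ennreal (C * (D\<^sup>2 * e))" using C e by (simp add: ennreal_mult)
    finally show ?thesis using C e unfolding Fi by (subst (asm) ennreal_le_iff) auto
  qed
  have hp: "(cmod (h \<i>)) ^ 4 > 0" using h(2) by simp
  define q where "q = C * D\<^sup>2 + 1"
  have q: "q > 0" using C by (simp add: q_def add_nonneg_pos)
  have "(cmod (h \<i>)) ^ 4 \<le> C * D\<^sup>2 * ((cmod (h \<i>)) ^ 4 / (2 * q))" using est[of "(cmod (h \<i>)) ^ 4 / (2 * q)"] hp q by (simp add: mult.assoc)
  also have "\<dots> \<le> q * ((cmod (h \<i>)) ^ 4 / (2 * q))" using hp q by (intro mult_right_mono) (auto simp: q_def)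
  also have "\<dots> = (cmod (h \<i>)) ^ 4 / 2" using q by simp
  finally show False using hp by simp
qed

lemma measure_type_mono:
  assumes sets: "sets \<mu> = sets borel" "sets \<nu> = sets borel"
    and gr: "polynomial_growth \<mu>" "polynomial_growth \<nu>" and dom: "\<mu> \<preceq>\<^sub>w \<nu>"
  shows "measure_type \<mu> \<le> measure_type \<nu>"
  unfolding measure_type_def[of \<nu>]
proof (rule Inf_greatest, clarify)
  fix a :: real assume a: "0 < a" "dense_in_L2 (fourier_space a) \<nu>"
  show "measure_type \<mu> \<le> ennreal a"
  proof (rule ennreal_le_epsilon)
    fix e :: real assume e: "0 < e"
    have d: "dense_in_L2 (fourier_space (a + e)) \<mu>"
      by (rule density_transfer[OF sets gr dom a(1) _ a(2)]) (use e in simp)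
    have "measure_type \<mu> \<le> ennreal (a + e)"
      unfolding measure_type_def by (rule Inf_lower, rule CollectI, rule exI[of _ "a + e"]) (use a e d in simp)
    then show "measure_type \<mu> \<le> ennreal a + ennreal e" using a e by (simp add: ennreal_plus)
  qed
qed

theorem corollary1p5:
  fixes \<mu> \<nu> :: "real measure"
  assumes "sets \<mu> = sets borel" and "sets \<nu> = sets borel"
    and "polynomial_growth \<mu>" and "polynomial_growth \<nu>"
    and "weakly_equivalent \<mu> \<nu>"
  shows "measure_type \<mu> = measure_type \<nu>"
  using assms by (intro antisym measure_type_mono) (auto simp: weakly_equivalent_def)

end
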